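(* Let $\pi:\mathcal S\to\mathcal P(\mathcal A)$ be a stochastic policy and let the stochastic process $(S_t)_{t\ge 0}$ with values in $\mathcal S\subset\mathbb R^n$ follow the controlled stochastic differential equation $$dS_t=\mu(S_t,A_t)\,dt+\sigma(S_t,A_t)\,dB_t,\qquad A_t\sim\pi(\cdot\mid S_t),$$ with $\mu:\mathcal S\times\mathcal A\to\mathbb R^n$, $\sigma:\mathcal S\times\mathcal A\to\mathbb R^{n\times m}$ and $(B_t)_{t\ge0}$ an $m$-dimensional Brownian motion, where the process is well-defined in the sense specified in the context. Then for every time $t\ge 0$, every state $s_t\in\mathcal S$ and all $i,j\in\{1,\dots,n\}$, $$\mathbb E_{\pi}\left[\mu^i(s_t,A_t)\right]=\lim_{\Delta t\to0}\mathbb E_{p_\pi}\left[\frac{S^i_{t+\Delta t}-s^i_t}{\Delta t}\right]$$ and $$\mathbb E_{\pi}\left[[\sigma(s_t,A_t)\sigma^\top(s_t,A_t)]^{ij}\right]=\lim_{\Delta t\to0}\mathbb E_{p_\pi}\left[\frac{(S^i_{t+\Delta t}-s^i_t)(S^j_{t+\Delta t}-s^j_t)}{\Delta t}\right],$$ where the limits are taken over $\Delta t>0$.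
   Context: $\mathcal S\subset\mathbb R^n$ is the state space, $\mathcal A$ the action space, and $\mathcal P(\mathcal A)$ the space of probability distributions on $\mathcal A$. Superscripts denote components: $\mu^i$ is the $i$-th component of $\mu$ and $[\sigma\sigma^\top]^{ij}$ is the $(i,j)$ entry of $\sigma\sigma^\top$. For a fixed state $s_t$, $\mathbb E_\pi[\,\cdot\,]$ denotes the expectation over $A_t\sim\pi(\cdot\mid s_t)$. $p_\pi$ denotes the transition kernel of the process $(S_t)$ under the policy $\pi$ (accounting both for the Brownian noise and for the randomness of action selection), and $\mathbb E_{p_\pi}[\,\cdot\,]$ is the expectation under this kernel with the process started from $S_t=s_t$ at time $t$. Standing assumption (well-definedness of the process). The law of the state at each time, for a given initial condition, coincides with that of the averaged dynamics $$d\widetilde S_t=\widetilde\mu(\widetilde S_t,\pi)\,dt+\widetilde\sigma(\widetilde S_t,\pi)\,d\widetilde B_t$$ with the same initial condition, where $$\widetilde\mu(s,\pi)=\int_{\mathcal A}\mu(s,a)\,\pi(da\mid s),\qquad \widetilde\sigma(s,\pi)=\left(\int_{\mathcal A}\sigma(s,a)\sigma^\top(s,a)\,\pi(da\mid s)\right)^{1/2}$$ (the symmetric positive semidefinite square root), and $\widetilde B$ is a standard Brownian motion of the matching dimension. It is assumed that these integrals exist, that $s\mapsto\widetilde\mu(s,\pi)$ and $s\mapsto\widetilde\sigma(s,\pi)$ are Lipschitz continuous with linear growth, and that the averaged process takes values in $\mathcal S$, so that the averaged equation is well-posed in the classical sense. *)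

theory Defs
  imports "HOL-Probability.Probability"
begin

section \<open>Brownian motion\<close>

definition filtered_prob_space :: "'w measure \<Rightarrow> (real \<Rightarrow> 'w measure) \<Rightarrow> bool" where
  "filtered_prob_space M F \<longleftrightarrow>
     prob_space M \<and> filtration (space M) F \<and> (\<forall>t. subalgebra M (F t))"

text \<open>
  Filtrations are indexed by \<^typ>\<open>real\<close>, but only times \<open>t \<ge> 0\<close> matter. The three increment clauses
  say that \<open>B u - B r\<close> is independent of \<open>F r\<close> and normal with mean 0 and covariance \<open>(u - r)\<close> times
  the identity matrix.
\<close>

definition brownian_motion ::
  "'w measure \<Rightarrow> (real \<Rightarrow> 'w measure) \<Rightarrow> (real \<Rightarrow> 'w \<Rightarrow> real^'m) \<Rightarrow> bool" where
  "brownian_motion M F B \<longleftrightarrow>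
     (AE \<omega> in M. B 0 \<omega> = 0) \<and>
     (AE \<omega> in M. continuous_on {0..} (\<lambda>t. B t \<omega>)) \<and>
     (\<forall>t\<ge>0. B t \<in> borel_measurable (F t)) \<and>
     (\<forall>r u. 0 \<le> r \<and> r < u \<longrightarrow>
        prob_space.indep_set M (sets (F r))
          {(\<lambda>\<omega>. B u \<omega> - B r \<omega>) -` D \<inter> space M | D. D \<in> sets borel} \<and>
        prob_space.indep_vars M (\<lambda>_. borel) (\<lambda>i \<omega>. (B u \<omega> - B r \<omega>) $ i) UNIV \<and>
        (\<forall>i. distributed M lborel (\<lambda>\<omega>. (B u \<omega> - B r \<omega>) $ i) (normal_density 0 (sqrt (u - r)))))"

section \<open>The Ito integral\<close>

definition progressive ::
  "(real \<Rightarrow> 'w measure) \<Rightarrow> real \<Rightarrow> (real \<Rightarrow> 'w \<Rightarrow> 'b::topological_space) \<Rightarrow> bool" where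
  "progressive F a f \<longleftrightarrow>
     (\<forall>u\<ge>a. (\<lambda>(r, \<omega>). f r \<omega>) \<in> borel_measurable (restrict_space borel {a..u} \<Otimes>\<^sub>M F u))"

text \<open>
  A simple integrand on \<open>{a..b}\<close> is given by a number \<open>k\<close>, deterministic partition points
  \<open>p 0, \<dots>, p k\<close> and bounded random matrices \<open>\<xi> 0, \<dots>, \<xi> (k - 1)\<close>, where \<open>\<xi> i\<close> is known at
  time \<open>p i\<close> and is the value of the integrand on \<open>{p i<..p (Suc i)}\<close>.
\<close>

definition simple_integrand ::
  "'w measure \<Rightarrow> (real \<Rightarrow> 'w measure) \<Rightarrow> real \<Rightarrow> real \<Rightarrow>
   nat \<Rightarrow> (nat \<Rightarrow> real) \<Rightarrow> (nat \<Rightarrow> 'w \<Rightarrow> real^'m^'n) \<Rightarrow> bool" where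
  "simple_integrand M F a b k p \<xi> \<longleftrightarrow>
     a \<le> p 0 \<and> p k \<le> b \<and> (\<forall>i<k. p i \<le> p (Suc i)) \<and>
     (\<forall>i<k. \<xi> i \<in> borel_measurable (F (p i))) \<and>
     (\<exists>C. \<forall>i<k. \<forall>\<omega>\<in>space M. norm (\<xi> i \<omega>) \<le> C)"

definition simple_process ::
  "nat \<Rightarrow> (nat \<Rightarrow> real) \<Rightarrow> (nat \<Rightarrow> 'w \<Rightarrow> real^'m^'n) \<Rightarrow> real \<Rightarrow> 'w \<Rightarrow> real^'m^'n" where
  "simple_process k p \<xi> r \<omega> = (\<Sum>i<k. indicator {p i<..p (Suc i)} r *\<^sub>R \<xi> i \<omega>)"

definition simple_ito_integral ::
  "(real \<Rightarrow> 'w \<Rightarrow> real^'m) \<Rightarrow> nat \<Rightarrow> (nat \<Rightarrow> real) \<Rightarrow> (nat \<Rightarrow> 'w \<Rightarrow> real^'m^'n) \<Rightarrow> 'w \<Rightarrow> real^'n" where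
  "simple_ito_integral B k p \<xi> \<omega> = (\<Sum>i<k. \<xi> i \<omega> *v (B (p (Suc i)) \<omega> - B (p i) \<omega>))"

text \<open>
  \<open>I\<close> is (a version of) the Ito integral of \<open>g\<close> over \<open>{a..b}\<close>: the integrand is progressively
  measurable with almost surely square-integrable paths (no moment condition is imposed), and \<open>I\<close>
  is the limit in probability of the integrals of simple integrands \<open>\<phi>\<^sub>n\<close> for which the pathwise
  integral of \<open>(norm (\<phi>\<^sub>n - g))\<^sup>2\<close> tends to 0 in probability.
\<close>

definition is_ito_integral ::
  "'w measure \<Rightarrow> (real \<Rightarrow> 'w measure) \<Rightarrow> (real \<Rightarrow> 'w \<Rightarrow> real^'m) \<Rightarrow> real \<Rightarrow> real \<Rightarrow>
   (real \<Rightarrow> 'w \<Rightarrow> real^'m^'n) \<Rightarrow> ('w \<Rightarrow> real^'n) \<Rightarrow> bool" where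
  "is_ito_integral M F B a b g I \<longleftrightarrow>
     progressive F a g \<and>
     (AE \<omega> in M. set_integrable lborel {a..b} (\<lambda>r. (norm (g r \<omega>))\<^sup>2)) \<and>
     I \<in> borel_measurable M \<and>
     (\<exists>k p \<xi>.
        (\<forall>n::nat. simple_integrand M F a b (k n) (p n) (\<xi> n)) \<and>
        (\<forall>\<epsilon>>0. (\<lambda>n. measure M {\<omega> \<in> space M. ennreal \<epsilon> <
           (\<integral>\<^sup>+ r\<in>{a..b}. ennreal ((norm (simple_process (k n) (p n) (\<xi> n) r \<omega> - g r \<omega>))\<^sup>2) \<partial>lborel)})
           \<longlonglongrightarrow> 0) \<and>
        (\<forall>\<epsilon>>0. (\<lambda>n. measure M {\<omega> \<in> space M. \<epsilon> <
           norm (simple_ito_integral B (k n) (p n) (\<xi> n) \<omega> - I \<omega>)}) \<longlonglongrightarrow> 0))"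

section \<open>Ito processes and stochastic differential equations\<close>

text \<open>
  \<open>X\<close> starts from \<open>x0\<close> at time \<open>a\<close> and satisfies \<open>dX = b dt + g dB\<close> on \<open>{a..}\<close>.
\<close>

definition ito_process ::
  "'w measure \<Rightarrow> (real \<Rightarrow> 'w measure) \<Rightarrow> (real \<Rightarrow> 'w \<Rightarrow> real^'m) \<Rightarrow> real \<Rightarrow> real^'n \<Rightarrow>
   (real \<Rightarrow> 'w \<Rightarrow> real^'n) \<Rightarrow> (real \<Rightarrow> 'w \<Rightarrow> real^'m^'n) \<Rightarrow> (real \<Rightarrow> 'w \<Rightarrow> real^'n) \<Rightarrow> bool" where
  "ito_process M F B a x0 b g X \<longleftrightarrow>
     filtered_prob_space M F \<and> brownian_motion M F B \<and>
     (\<forall>u\<ge>a. X u \<in> borel_measurable (F u)) \<and>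
     (AE \<omega> in M. continuous_on {a..} (\<lambda>u. X u \<omega>)) \<and>
     (AE \<omega> in M. X a \<omega> = x0) \<and>
     progressive F a b \<and>
     (\<forall>u\<ge>a. AE \<omega> in M. set_integrable lborel {a..u} (\<lambda>r. b r \<omega>)) \<and>
     (\<forall>u\<ge>a. \<exists>I. is_ito_integral M F B a u g I \<and>
        (AE \<omega> in M. X u \<omega> = x0 + (LINT r:{a..u}|lborel. b r \<omega>) + I \<omega>))"

definition stochastic_policy :: "(real^'n) set \<Rightarrow> 'a measure \<Rightarrow> (real^'n \<Rightarrow> 'a measure) \<Rightarrow> bool" where
  "stochastic_policy \<S> \<A> \<pi> \<longleftrightarrow> \<pi> \<in> restrict_space borel \<S> \<rightarrow>\<^sub>M prob_algebra \<A>"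

text \<open>
  The last clause says that the conditional distribution of the action \<open>A u\<close> given the state \<open>S u\<close>
  is \<open>\<pi> (S u)\<close>.
\<close>

definition controlled_process ::
  "(real^'n) set \<Rightarrow> 'a measure \<Rightarrow> (real^'n \<Rightarrow> 'a measure) \<Rightarrow>
   (real^'n \<Rightarrow> 'a \<Rightarrow> real^'n) \<Rightarrow> (real^'n \<Rightarrow> 'a \<Rightarrow> real^'m^'n) \<Rightarrow>
   'w measure \<Rightarrow> (real \<Rightarrow> 'w measure) \<Rightarrow> (real \<Rightarrow> 'w \<Rightarrow> real^'m) \<Rightarrow> (real \<Rightarrow> 'w \<Rightarrow> 'a) \<Rightarrow>
   real \<Rightarrow> real^'n \<Rightarrow> (real \<Rightarrow> 'w \<Rightarrow> real^'n) \<Rightarrow> bool" where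
  "controlled_process \<S> \<A> \<pi> \<mu> \<sigma> M F B A t s S \<longleftrightarrow>
     ito_process M F B t s (\<lambda>u \<omega>. \<mu> (S u \<omega>) (A u \<omega>)) (\<lambda>u \<omega>. \<sigma> (S u \<omega>) (A u \<omega>)) S \<and>
     (\<forall>u\<ge>t. \<forall>\<omega>\<in>space M. S u \<omega> \<in> \<S>) \<and>
     (\<forall>u\<ge>t. A u \<in> F u \<rightarrow>\<^sub>M \<A>) \<and>
     (\<forall>u\<ge>t. \<forall>D\<in>sets borel. \<forall>C\<in>sets \<A>.
        measure M {\<omega> \<in> space M. S u \<omega> \<in> D \<and> A u \<omega> \<in> C} =
        (\<integral>\<omega>. indicator D (S u \<omega>) * measure (\<pi> (S u \<omega>)) C \<partial>M))"

section \<open>The averaged dynamics\<close>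

definition psd_sqrt :: "real^'n^'n \<Rightarrow> real^'n^'n" where
  "psd_sqrt Q = (THE R. transpose R = R \<and> (\<forall>x. 0 \<le> x \<bullet> (R *v x)) \<and> R ** R = Q)"

definition avg_drift ::
  "(real^'n \<Rightarrow> 'a measure) \<Rightarrow> (real^'n \<Rightarrow> 'a \<Rightarrow> real^'n) \<Rightarrow> real^'n \<Rightarrow> real^'n" where
  "avg_drift \<pi> \<mu> s = (\<integral>a. \<mu> s a \<partial>\<pi> s)"

definition avg_diffusion ::
  "(real^'n \<Rightarrow> 'a measure) \<Rightarrow> (real^'n \<Rightarrow> 'a \<Rightarrow> real^'m^'n) \<Rightarrow> real^'n \<Rightarrow> real^'n^'n" where
  "avg_diffusion \<pi> \<sigma> s = psd_sqrt (\<integral>a. \<sigma> s a ** transpose (\<sigma> s a) \<partial>\<pi> s)"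

definition regular_averaged_coefficients ::
  "(real^'n) set \<Rightarrow> (real^'n \<Rightarrow> 'a measure) \<Rightarrow>
   (real^'n \<Rightarrow> 'a \<Rightarrow> real^'n) \<Rightarrow> (real^'n \<Rightarrow> 'a \<Rightarrow> real^'m^'n) \<Rightarrow> bool" where
  "regular_averaged_coefficients \<S> \<pi> \<mu> \<sigma> \<longleftrightarrow>
     (\<forall>s\<in>\<S>. integrable (\<pi> s) (\<mu> s)) \<and>
     (\<forall>s\<in>\<S>. integrable (\<pi> s) (\<lambda>a. \<sigma> s a ** transpose (\<sigma> s a))) \<and>
     (\<exists>L. L-lipschitz_on \<S> (avg_drift \<pi> \<mu>)) \<and>
     (\<exists>L. L-lipschitz_on \<S> (avg_diffusion \<pi> \<sigma>)) \<and>
     (\<exists>K. \<forall>s\<in>\<S>. norm (avg_drift \<pi> \<mu> s) + norm (avg_diffusion \<pi> \<sigma> s) \<le> K * (1 + norm s))"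

definition averaged_process ::
  "(real^'n) set \<Rightarrow> (real^'n \<Rightarrow> 'a measure) \<Rightarrow>
   (real^'n \<Rightarrow> 'a \<Rightarrow> real^'n) \<Rightarrow> (real^'n \<Rightarrow> 'a \<Rightarrow> real^'m^'n) \<Rightarrow>
   'w measure \<Rightarrow> (real \<Rightarrow> 'w measure) \<Rightarrow> (real \<Rightarrow> 'w \<Rightarrow> real^'n) \<Rightarrow>
   real \<Rightarrow> real^'n \<Rightarrow> (real \<Rightarrow> 'w \<Rightarrow> real^'n) \<Rightarrow> bool" where
  "averaged_process \<S> \<pi> \<mu> \<sigma> M F B t s S \<longleftrightarrow>
     ito_process M F B t s
       (\<lambda>u \<omega>. avg_drift \<pi> \<mu> (S u \<omega>)) (\<lambda>u \<omega>. avg_diffusion \<pi> \<sigma> (S u \<omega>)) S \<and>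
     (\<forall>u\<ge>t. \<forall>\<omega>\<in>space M. S u \<omega> \<in> \<S>)"

section \<open>Transition kernel\<close>

text \<open>
  For a family of processes, \<open>S t s\<close> being the one on \<open>M t s\<close> that is started from \<open>s\<close> at time \<open>t\<close>:
  the distribution of the state at time \<open>u \<ge> t\<close> given that the state at time \<open>t\<close> is \<open>s\<close>.
\<close>

definition transition_kernel ::
  "(real \<Rightarrow> real^'n \<Rightarrow> 'w measure) \<Rightarrow> (real \<Rightarrow> real^'n \<Rightarrow> real \<Rightarrow> 'w \<Rightarrow> real^'n) \<Rightarrow>
   real \<Rightarrow> real^'n \<Rightarrow> real \<Rightarrow> (real^'n) measure" where
  "transition_kernel M S t s u = distr (M t s) borel (S t s u)"

end

theory Submission
  imports Defs
begin

text \<open>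
  By equality of laws only the averaged process \<open>X\<close> matters; it solves an equation with
  Lipschitz coefficients \<open>\<beta>\<close>, \<open>\<gamma>\<close>. Truncating simple integrands at a fixed energy yields
  the \<open>L\<^sup>2\<close> bound for Ito integrals localized to \<open>2 \<integral>\<bar>g\<bar>\<^sup>2 < C\<close>, which together with Gronwall's inequality
  and \<open>C \<rightarrow> \<infinity>\<close> gives \<open>E \<bar>X (t + h) - x0\<bar>\<^sup>2 = O(h)\<close>. Freezing the coefficients at \<open>x0\<close> then shows
  \<open>X (t + h) - x0 = h \<beta> x0 + R + J + \<gamma> x0 (B (t + h) - B t)\<close>, where \<open>E \<bar>R\<bar>\<^sup>2 = O(h\<^sup>3)\<close>, \<open>E \<bar>J\<bar>\<^sup>2 = O(h\<^sup>2)\<close> and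
  \<open>E J = 0\<close>. The mean of the Brownian term is 0 and its covariance is \<open>h \<gamma> x0 (\<gamma> x0)\<^sup>T\<close>, and \<open>\<gamma> \<gamma>\<^sup>T\<close> is the
  averaged covariance by existence and uniqueness of the positive semidefinite square root.
\<close>

section \<open>Square roots of positive semidefinite matrices\<close>

text \<open>An Ito integral is given here only as a limit in probability, so a priori
  \<open>X\<close> has no moments at all, and a direct moment bound is circular: the second moment
  of the Ito term needs that of \<gamma> along the path, which needs that of \<open>X\<close>. The
  circle is broken pathwise. \<open>Q\<close> is the running time integral of twice the squared
  coefficients; it is finite, continuous and nondecreasing along almost every path, so
  \<open>min C (Q u)\<close> is at most the integral of its density over the times at which
  \<open>Q < C\<close>. At such a time the localized bound controls the displacement, the
  displacement controls the density, and Gronwall's inequality applies to the mean of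
  \<open>min C (Q u)\<close>. A bounded quantity thus takes the place of a stopped process.
  Localization cannot show that \<open>J\<close> has mean 0, because the localizing event depends on
  the whole path; this comes instead from truncated simple integrals with growing cutoffs.\<close>

definition psd :: "real^'n^'n \<Rightarrow> bool" where
  "psd Q \<longleftrightarrow> transpose Q = Q \<and> (\<forall>x. 0 \<le> x \<bullet> (Q *v x))"

lemma symmetric_matrix_inner:
  fixes Q :: "real^'n^'n"
  assumes "transpose Q = Q"
  shows "x \<bullet> (Q *v y) = (Q *v x) \<bullet> y"
  by (metis assms dot_lmul_matrix vector_transpose_matrix)

text \<open>A nonnegative form that vanishes at \<open>v\<close> has a minimum there, so its first
  variation vanishes: otherwise a small step from \<open>v\<close> against \<open>Q *v v\<close>
  would make the form negative.\<close>

lemma psd_inner_zero: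
  fixes Q :: "real^'n^'n"
  assumes "psd Q" "v \<bullet> (Q *v v) = 0"
  shows "Q *v v = 0"
proof (rule ccontr)
  assume nz: "Q *v v \<noteq> 0"
  define w where "w = Q *v v"
  define c where "c = w \<bullet> (Q *v w)"
  have sym: "transpose Q = Q" and pos: "\<And>x. 0 \<le> x \<bullet> (Q *v x)"
    using assms(1) by (auto simp: psd_def)
  have c0: "c \<ge> 0" unfolding c_def by (rule pos)
  have ww: "w \<bullet> w > 0" using nz by (simp add: w_def)
  \<comment> \<open>Along \<open>v + t w\<close> the form equals
    \<open>2 t (w \<bullet> w) + t^2 c\<close>, which is negative for small negative
    \<open>t\<close>. The denominator \<open>1 + c\<close> makes the step short enough and also
    covers \<open>c = 0\<close>.\<close>
  define t where "t = - (w \<bullet> w) / (1 + c)"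
  have "0 \<le> (v + t *\<^sub>R w) \<bullet> (Q *v (v + t *\<^sub>R w))" by (rule pos)
  also have "\<dots> = 2 * t * (w \<bullet> w) + t\<^sup>2 * c"
    using assms(2) symmetric_matrix_inner[OF sym, of v w]
    by (simp add: matrix_vector_right_distrib matrix_vector_mult_scaleR inner_add_left inner_add_right
        w_def[symmetric] c_def[symmetric] power2_eq_square algebra_simps)
  also have "\<dots> = t * (2 * (w \<bullet> w) + t * c)" by (simp add: power2_eq_square algebra_simps)
  finally have "0 \<le> t * (2 * (w \<bullet> w) + t * c)" .
  moreover have "t < 0" using ww c0 by (simp add: t_def divide_neg_pos)
  moreover have "2 * (w \<bullet> w) + t * c > 0"
  proof -
    have "(w \<bullet> w) * (c / (1 + c)) \<le> (w \<bullet> w) * 1"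
      using c0 ww by (intro mult_left_mono) auto
    moreover have "t * c = - ((w \<bullet> w) * (c / (1 + c)))" by (simp add: t_def)
    ultimately show ?thesis using ww by linarith
  qed
  ultimately show False by (simp add: zero_le_mult_iff)
qed

text \<open>The vector \<open>v\<close> maximizes the Rayleigh quotient, which exists by compactness
  of the sphere. Then \<open>l *\<^sub>R mat 1 - Q\<close> is positive semidefinite and its form
  vanishes at \<open>v\<close>, so \<open>psd_inner_zero\<close> yields the eigenvalue equation
  without Lagrange multipliers.\<close>

lemma symmetric_matrix_max_eigenvector:
  fixes Q :: "real^'n^'n"
  assumes sym: "transpose Q = Q"
  obtains l v where "norm v = 1" "Q *v v = l *\<^sub>R v" "\<And>x. x \<bullet> (Q *v x) \<le> l * (x \<bullet> x)"
proof -
  have "continuous_on (sphere 0 1) (\<lambda>x::real^'n. x \<bullet> (Q *v x))"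
    by (intro continuous_intros linear_continuous_on matrix_vector_mul_bounded_linear)
  moreover have "sphere (0::real^'n) 1 \<noteq> {}"
    using norm_axis_1 by (auto simp: sphere_def dist_norm intro!: exI[of _ "axis undefined 1"])
  ultimately obtain v :: "real^'n" where v: "norm v = 1"
    and max: "\<And>y. norm y = 1 \<Longrightarrow> y \<bullet> (Q *v y) \<le> v \<bullet> (Q *v v)"
    using continuous_attains_sup[OF compact_sphere, of 0 1 "\<lambda>x. x \<bullet> (Q *v x)"]
    by (auto simp: dist_norm)
  define l where "l = v \<bullet> (Q *v v)"
  have le: "x \<bullet> (Q *v x) \<le> l * (x \<bullet> x)" for x
  proof (cases "x = 0")
    case False
    have "(inverse (norm x) *\<^sub>R x) \<bullet> (Q *v (inverse (norm x) *\<^sub>R x)) \<le> l"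
      unfolding l_def using False by (intro max) simp
    then have "inverse (norm x) * inverse (norm x) * (x \<bullet> (Q *v x)) \<le> l"
      by (simp add: matrix_vector_mult_scaleR)
    then have "(x \<bullet> (Q *v x)) / (x \<bullet> x) \<le> l"
      by (simp add: dot_square_norm power2_eq_square field_simps)
    then show ?thesis using False by (simp add: field_simps)
  qed simp
  define N where "N = l *\<^sub>R mat 1 - Q"
  have N: "N *v x = l *\<^sub>R x - Q *v x" for x
    by (simp add: N_def matrix_vector_mult_diff_rdistrib scaleR_matrix_vector_assoc[symmetric])
  have "psd N"
    unfolding psd_def
  proof
    show "transpose N = N"
      using sym by (simp add: N_def transpose_def vec_eq_iff mat_def)
  next
    show "\<forall>x. 0 \<le> x \<bullet> (N *v x)"
      using le by (simp add: N inner_diff_right)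
  qed
  moreover have "v \<bullet> (N *v v) = 0"
    using v by (simp add: N inner_diff_right l_def dot_square_norm)
  ultimately have "N *v v = 0" by (rule psd_inner_zero)
  then show ?thesis using that[of v l] v le by (simp add: N)
qed

lemma symmetric_matrix_inner_zero:
  fixes D :: "real^'n^'n"
  assumes sym: "transpose D = D" and z: "\<And>x. x \<bullet> (D *v x) = 0"
  shows "D = 0"
proof -
  have "psd D" using assms by (simp add: psd_def)
  then have "D *v x = 0" for x using psd_inner_zero z by blast
  then show ?thesis by (metis matrix_eq matrix_vector_mult_0)
qed

text \<open>
  If \<open>R\<^sup>2 = R'\<^sup>2\<close>, then \<open>R D + D R' = 0\<close> for \<open>D = R - R'\<close>; evaluated at an eigenvector of \<open>D\<close>
  this shows that the largest eigenvalue of \<open>D\<close> vanishes, although \<open>R\<close> and \<open>R'\<close> are not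
  known to commute.
\<close>

lemma psd_square_le:
  fixes R R' :: "real^'n^'n"
  assumes R: "psd R" and R': "psd R'" and eq: "R ** R = R' ** R'"
  shows "x \<bullet> ((R - R') *v x) \<le> 0"
proof -
  define D where "D = R - R'"
  have symD: "transpose D = D"
    using R R' by (simp add: D_def psd_def transpose_def vec_eq_iff)
  obtain l v where v: "norm v = 1" "D *v v = l *\<^sub>R v" "\<And>x. x \<bullet> (D *v x) \<le> l * (x \<bullet> x)"
    using symmetric_matrix_max_eigenvector[OF symD] by metis
  have "R ** D + D ** R' = 0"
    using eq by (simp add: D_def matrix_eq matrix_vector_mul_assoc[symmetric] matrix_vector_mult_add_rdistrib
        matrix_vector_mult_diff_rdistrib matrix_vector_mult_diff_distrib)
  then have "v \<bullet> ((R ** D + D ** R') *v v) = 0" by simp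
  moreover have "v \<bullet> ((R ** D + D ** R') *v v) = l * (v \<bullet> (R *v v) + v \<bullet> (R' *v v))"
    using v(2) symmetric_matrix_inner[OF symD, of v "R' *v v"]
    by (simp add: matrix_vector_mult_add_rdistrib matrix_vector_mul_assoc[symmetric]
        matrix_vector_mult_scaleR inner_add_right algebra_simps)
  ultimately have or: "l = 0 \<or> v \<bullet> (R *v v) + v \<bullet> (R' *v v) = 0" by simp
  \<comment> \<open>If \<open>l\<close> were nonzero, two nonnegative numbers would sum to 0, so
    \<open>R\<close> and \<open>R'\<close> would both annihilate \<open>v\<close>, and so would
    \<open>D\<close>, against \<open>D *v v = l *\<^sub>R v\<close>.\<close>
  have "l = 0"
  proof (rule ccontr)
    assume "l \<noteq> 0"
    with or have "v \<bullet> (R *v v) + v \<bullet> (R' *v v) = 0" by simp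
    moreover have "v \<bullet> (R *v v) \<ge> 0" "v \<bullet> (R' *v v) \<ge> 0" using R R' by (auto simp: psd_def)
    ultimately have "R *v v = 0" "R' *v v = 0"
      using psd_inner_zero R R' by (auto simp: add_nonneg_eq_0_iff)
    then have "D *v v = 0" by (simp add: D_def matrix_vector_mult_diff_rdistrib)
    with v \<open>l \<noteq> 0\<close> show False by auto
  qed
  then show ?thesis using v(3) by (simp add: D_def)
qed

lemma psd_sqrt_unique:
  fixes R R' :: "real^'n^'n"
  assumes R: "psd R" and R': "psd R'" and eq: "R ** R = R' ** R'"
  shows "R = R'"
proof -
  have "x \<bullet> ((R - R') *v x) = 0" for x
    using psd_square_le[OF R R' eq, of x] psd_square_le[OF R' R eq[symmetric], of x]
    by (simp add: matrix_vector_mult_diff_rdistrib inner_diff_right)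
  moreover have "transpose (R - R') = R - R'"
    using R R' by (simp add: psd_def transpose_def vec_eq_iff)
  ultimately have "R - R' = 0" by (intro symmetric_matrix_inner_zero)
  then show ?thesis by simp
qed

text \<open>
  Splitting off the rank-one part \<open>l v v\<^sup>T\<close> of a top eigenvector enlarges the kernel.
\<close>

lemma psd_sqrt_exists:
  fixes Q :: "real^'n^'n"
  assumes "psd Q"
  shows "\<exists>R. psd R \<and> R ** R = Q"
  using assms
proof (induction "CARD('n) - dim {x. Q *v x = 0}" arbitrary: Q rule: less_induct)
  case less
  have sym: "transpose Q = Q" and pos: "\<And>x. 0 \<le> x \<bullet> (Q *v x)"
    using less.prems by (auto simp: psd_def)
  obtain l v where v: "norm v = 1" "Q *v v = l *\<^sub>R v" "\<And>x. x \<bullet> (Q *v x) \<le> l * (x \<bullet> x)"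
    using symmetric_matrix_max_eigenvector[OF sym] by metis
  have vv: "v \<bullet> v = 1" using v(1) by (simp add: dot_square_norm)
  have l0: "l \<ge> 0" using pos[of v] v(2) vv by simp
  show ?case
  proof (cases "l = 0")
    case True
    then have "x \<bullet> (Q *v x) = 0" for x using v(3)[of x] pos[of x] by simp
    then have "Q = 0" using sym by (intro symmetric_matrix_inner_zero) auto
    then have "psd (0::real^'n^'n) \<and> 0 ** 0 = Q"
      by (simp add: psd_def transpose_def vec_eq_iff)
    then show ?thesis by blast
  next
    case False
    then have lpos: "l > 0" using l0 by simp
    define P :: "real^'n^'n" where "P = (\<chi> i j. v $ i * v $ j)"
    have P: "P *v x = (v \<bullet> x) *\<^sub>R v" for x
      by (simp add: P_def matrix_vector_mult_def vec_eq_iff inner_vec_def sum_distrib_left sum_distrib_right algebra_simps)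
    have symP: "transpose P = P" by (simp add: P_def transpose_def vec_eq_iff mult.commute)
    define Q' where "Q' = Q - l *\<^sub>R P"
    have Q': "Q' *v x = Q *v x - (l * (v \<bullet> x)) *\<^sub>R v" for x
      by (simp add: Q'_def matrix_vector_mult_diff_rdistrib scaleR_matrix_vector_assoc[symmetric] P)
    have symQ': "transpose Q' = Q'"
      using sym symP by (simp add: Q'_def transpose_def vec_eq_iff)
    have vQ: "v \<bullet> (Q *v x) = l * (v \<bullet> x)" for x
      using symmetric_matrix_inner[OF sym, of v x] v(2) by simp
    have psdQ': "psd Q'"
      unfolding psd_def
    proof (intro conjI allI)
      fix x
      \<comment> \<open>\<open>w\<close> is the part of \<open>x\<close> orthogonal to
        \<open>v\<close>. The form of \<open>Q'\<close> at \<open>x\<close> is that of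
        \<open>Q\<close> at \<open>w\<close>, from which it inherits its sign.\<close>
      define w where "w = x - (v \<bullet> x) *\<^sub>R v"
      have "w \<bullet> (Q *v w) = x \<bullet> (Q' *v x)"
        using v(2) vv vQ[of x]
        by (simp add: w_def Q' matrix_vector_mult_diff_distrib matrix_vector_mult_scaleR
            inner_diff_left inner_diff_right inner_commute algebra_simps)
      with pos[of w] show "0 \<le> x \<bullet> (Q' *v x)" by simp
    qed (rule symQ')
    have sub: "subspace {x. Q *v x = 0}" for Q :: "real^'n^'n"
      by (simp add: subspace_def matrix_vector_right_distrib matrix_vector_mult_scaleR)
    have "{x. Q *v x = 0} \<subset> {x. Q' *v x = 0}"
    proof
      show "{x. Q *v x = 0} \<subseteq> {x. Q' *v x = 0}"
      proof
        fix x assume "x \<in> {x. Q *v x = 0}"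
        then have "Q *v x = 0" by simp
        then show "x \<in> {x. Q' *v x = 0}" using vQ[of x] lpos by (simp add: Q')
      qed
      show "{x. Q *v x = 0} \<noteq> {x. Q' *v x = 0}"
      proof -
        have "v \<in> {x. Q' *v x = 0}" using v(2) vv by (simp add: Q')
        moreover have "v \<notin> {x. Q *v x = 0}" using v lpos by auto
        ultimately show ?thesis by blast
      qed
    qed
    then have "dim {x. Q *v x = 0} < dim {x. Q' *v x = 0}"
      by (intro dim_psubset) (simp add: span_eq_iff[THEN iffD2, OF sub])
    moreover have "dim {x. Q' *v x = 0} \<le> CARD('n)"
      using dim_subset_UNIV[of "{x. Q' *v x = 0}"] by simp
    ultimately have "CARD('n) - dim {x. Q' *v x = 0} < CARD('n) - dim {x. Q *v x = 0}" by simp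
    from less.hyps[OF this psdQ'] obtain R' where R': "psd R'" "R' ** R' = Q'" by blast
    have symR': "transpose R' = R'" using R' by (simp add: psd_def)
    \<comment> \<open>Since \<open>R'\<close> annihilates \<open>v\<close>, the products of
      \<open>R'\<close> and \<open>P\<close> vanish in both orders, so squaring
      \<open>R' + sqrt l *\<^sub>R P\<close> produces no mixed terms and gives
      \<open>Q' + l *\<^sub>R P = Q\<close>.\<close>
    have "(R' *v v) \<bullet> (R' *v v) = v \<bullet> (Q' *v v)"
      using symmetric_matrix_inner[OF symR', of v "R' *v v"] R'(2)
      by (simp add: matrix_vector_mul_assoc)
    also have "\<dots> = 0" using v(2) vv by (simp add: Q')
    finally have R'v: "R' *v v = 0" by simp
    define R where "R = R' + sqrt l *\<^sub>R P"
    have R: "R *v x = R' *v x + (sqrt l * (v \<bullet> x)) *\<^sub>R v" for x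
      by (simp add: R_def matrix_vector_mult_add_rdistrib scaleR_matrix_vector_assoc[symmetric] P)
    have vR': "v \<bullet> (R' *v x) = 0" for x
      using symmetric_matrix_inner[OF symR', of v x] R'v by simp
    have "psd R"
      unfolding psd_def
    proof (intro conjI allI)
      show "transpose R = R" using symR' symP by (simp add: R_def transpose_def vec_eq_iff)
      fix x show "0 \<le> x \<bullet> (R *v x)"
        using R'(1) l0 by (simp add: psd_def R inner_add_right inner_commute[of x v] mult.assoc)
    qed
    moreover have "R ** R = Q"
    proof -
      have "R *v (R *v x) = Q *v x" for x
      proof -
        have "R *v (R *v x) = R' *v (R' *v x) + (l * (v \<bullet> x)) *\<^sub>R v"
          using l0 vv R'v vR'
          by (simp add: R matrix_vector_right_distrib matrix_vector_mult_scaleR inner_add_right)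
        also have "R' *v (R' *v x) = Q' *v x" using R'(2) by (simp add: matrix_vector_mul_assoc)
        finally show ?thesis by (simp add: Q')
      qed
      then show ?thesis by (simp add: matrix_eq matrix_vector_mul_assoc)
    qed
    ultimately show ?thesis by blast
  qed
qed

text \<open>A definite description says nothing by itself; existence and uniqueness of the root are
  what make \<open>psd_sqrt\<close> usable.\<close>

lemma psd_sqrt_square:
  fixes Q :: "real^'n^'n"
  assumes "psd Q"
  shows "transpose (psd_sqrt Q) = psd_sqrt Q" "psd_sqrt Q ** psd_sqrt Q = Q"
proof -
  obtain R where R: "psd R" "R ** R = Q" using psd_sqrt_exists[OF assms] by blast
  have "psd_sqrt Q = (THE R. psd R \<and> R ** R = Q)"
    by (simp add: psd_sqrt_def psd_def conj_assoc)
  also have "\<dots> = R"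
  proof (rule the_equality)
    show "R' = R" if "psd R' \<and> R' ** R' = Q" for R'
      using that R psd_sqrt_unique[of R' R] by simp
  qed (use R in simp)
  finally show "transpose (psd_sqrt Q) = psd_sqrt Q" "psd_sqrt Q ** psd_sqrt Q = Q"
    using R by (simp_all add: psd_def)
qed

text \<open>The quadratic form of the integral at \<open>x\<close> is the integral of the squared
  norm of \<open>transpose (\<sigma> a) *v x\<close>.\<close>

lemma psd_integral_mult_transpose:
  fixes \<sigma> :: "'a \<Rightarrow> real^'m^'n"
  assumes int: "integrable N (\<lambda>a. \<sigma> a ** transpose (\<sigma> a))"
  shows "psd (\<integral>a. \<sigma> a ** transpose (\<sigma> a) \<partial>N)"
  unfolding psd_def
proof (intro conjI allI)
  have comp: "(\<integral>a. \<sigma> a ** transpose (\<sigma> a) \<partial>N) $ i $ j = (\<integral>a. (\<sigma> a ** transpose (\<sigma> a)) $ i $ j \<partial>N)" for i j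
    by (rule integral_bounded_linear[symmetric, OF _ int])
       (intro bounded_linear_compose[OF bounded_linear_vec_nth] bounded_linear_vec_nth)
  have sym: "(\<sigma> a ** transpose (\<sigma> a)) $ i $ j = (\<sigma> a ** transpose (\<sigma> a)) $ j $ i" for a i j
    by (simp add: matrix_matrix_mult_def transpose_def mult.commute)
  show "transpose (\<integral>a. \<sigma> a ** transpose (\<sigma> a) \<partial>N) = (\<integral>a. \<sigma> a ** transpose (\<sigma> a) \<partial>N)"
  proof -
    have "transpose X $ i $ j = X $ j $ i" for X :: "real^'n^'n" and i j by (simp add: transpose_def)
    then show ?thesis unfolding vec_eq_iff using sym by (simp only: comp simp_thms)
  qed
  fix x :: "real^'n"
  have "bounded_linear (\<lambda>Q::real^'n^'n. x \<bullet> (Q *v x))"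
    by (rule linear_conv_bounded_linear[THEN iffD1])
       (auto intro!: linearI simp: matrix_vector_mult_add_rdistrib scaleR_matrix_vector_assoc[symmetric] inner_add_right)
  then have "x \<bullet> ((\<integral>a. \<sigma> a ** transpose (\<sigma> a) \<partial>N) *v x) = (\<integral>a. x \<bullet> ((\<sigma> a ** transpose (\<sigma> a)) *v x) \<partial>N)"
    by (rule integral_bounded_linear[symmetric, OF _ int])
  also have "\<dots> = (\<integral>a. (norm (transpose (\<sigma> a) *v x))\<^sup>2 \<partial>N)"
  proof -
    have "x \<bullet> ((\<sigma> a ** transpose (\<sigma> a)) *v x) = (norm (transpose (\<sigma> a) *v x))\<^sup>2" for a
      using dot_lmul_matrix[of x "\<sigma> a" "transpose (\<sigma> a) *v x"]
      by (simp add: matrix_vector_mul_assoc[symmetric] power2_norm_eq_inner)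
    then show ?thesis by simp
  qed
  also have "0 \<le> \<dots>" by (intro integral_nonneg_AE AE_I2) simp
  finally show "0 \<le> x \<bullet> ((\<integral>a. \<sigma> a ** transpose (\<sigma> a) \<partial>N) *v x)" .
qed

section \<open>Increments of Brownian motion\<close>

lemma borel_measurable_vec_nth [measurable (raw)]:
  fixes f :: "'a \<Rightarrow> 'b::{second_countable_topology, topological_space}^'n"
  assumes "f \<in> borel_measurable N"
  shows "(\<lambda>x. f x $ i) \<in> borel_measurable N"
  by (rule measurable_compose[OF assms borel_measurable_continuous_onI]) (intro continuous_intros)

lemma borel_measurable_vecI:
  fixes f :: "'a \<Rightarrow> real^'n"
  assumes "\<And>i. (\<lambda>x. f x $ i) \<in> borel_measurable N"
  shows "f \<in> borel_measurable N"
  using assms by (subst borel_measurable_euclidean_space) (auto simp: Basis_vec_def inner_axis)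

locale brownian_space =
  fixes M :: "'w measure" and F :: "real \<Rightarrow> 'w measure" and B :: "real \<Rightarrow> 'w \<Rightarrow> real^'m"
  assumes filtered: "filtered_prob_space M F" and brownian: "brownian_motion M F B"
begin

sublocale prob_space M
  using filtered by (simp add: filtered_prob_space_def)

lemma space_F: "space (F r) = space M"
  using filtered by (simp add: filtered_prob_space_def subalgebra_def)

lemma sets_F: "sets (F r) \<subseteq> sets M"
  using filtered by (simp add: filtered_prob_space_def subalgebra_def)

lemma sets_F_mono: "r \<le> u \<Longrightarrow> sets (F r) \<subseteq> sets (F u)"
  using filtered by (simp add: filtered_prob_space_def filtration_def)

lemma measurable_F_mono: "f \<in> measurable (F r) N \<Longrightarrow> r \<le> u \<Longrightarrow> f \<in> measurable (F u) N"
  using sets_F_mono[of r u] by (auto simp: measurable_def space_F)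

lemma measurable_F: "f \<in> measurable (F r) N \<Longrightarrow> f \<in> measurable M N"
  using sets_F[of r] by (auto simp: measurable_def space_F)

lemma B_adapted: "0 \<le> r \<Longrightarrow> r \<le> u \<Longrightarrow> B r \<in> borel_measurable (F u)"
  using brownian measurable_F_mono[of "B r" r] by (auto simp: brownian_motion_def)

lemma B_measurable [measurable]: "0 \<le> r \<Longrightarrow> B r \<in> borel_measurable M"
  using B_adapted[of r r] measurable_F by auto

text \<open>Bridges two notions of independence: Brownian motion is specified by families of events,
  whereas \<open>indep_var\<close> speaks of generated sigma-algebras. The preimage families lie
  inside the given ones and are stable under intersection, so independence extends to what they
  generate.\<close>

lemma indep_var_increment:
  fixes Y :: "'w \<Rightarrow> real" and f :: "real^'m \<Rightarrow> real"
  assumes "0 \<le> r" "r < u" "Y \<in> borel_measurable (F r)" and [measurable]: "f \<in> borel_measurable borel"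
  shows "indep_var borel Y borel (\<lambda>\<omega>. f (B u \<omega> - B r \<omega>))"
proof -
  let ?D = "\<lambda>\<omega>. B u \<omega> - B r \<omega>"
  let ?E = "{?D -` D \<inter> space M | D. D \<in> sets borel}"
  have ind: "indep_set (sets (F r)) ?E"
    using brownian assms by (auto simp: brownian_motion_def)
  have [measurable]: "?D \<in> borel_measurable M"
    using assms by (intro borel_measurable_diff B_measurable) auto
  have [measurable]: "Y \<in> borel_measurable M" using assms(3) by (rule measurable_F)
  have Y: "{Y -` A \<inter> space M |A. A \<in> sets borel} \<subseteq> sets (F r)"
    using assms(3) by (auto simp: space_F[of r, symmetric])
  have f: "{(\<lambda>\<omega>. f (?D \<omega>)) -` A \<inter> space M |A. A \<in> sets borel} \<subseteq> ?E"
  proof clarify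
    fix A :: "real set" assume "A \<in> sets borel"
    then have "f -` A \<in> sets borel" using measurable_sets[OF assms(4)] by simp
    then show "\<exists>D. (\<lambda>\<omega>. f (?D \<omega>)) -` A \<inter> space M = ?D -` D \<inter> space M \<and> D \<in> sets borel"
      by (intro exI[of _ "f -` A"]) auto
  qed
  have stable: "Int_stable {g -` A \<inter> space M |A. A \<in> sets borel}" for g :: "'w \<Rightarrow> real"
  proof (rule Int_stableI, clarify)
    fix A A' :: "real set" assume "A \<in> sets borel" "A' \<in> sets borel"
    then show "\<exists>A''. (g -` A \<inter> space M) \<inter> (g -` A' \<inter> space M) = g -` A'' \<inter> space M \<and> A'' \<in> sets borel"
      by (intro exI[of _ "A \<inter> A'"]) auto
  qed
  have "indep_set {Y -` A \<inter> space M |A. A \<in> sets borel} {(\<lambda>\<omega>. f (?D \<omega>)) -` A \<inter> space M |A. A \<in> sets borel}"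
    unfolding indep_sets2_eq
  proof (intro conjI ballI)
    show "{Y -` A \<inter> space M |A. A \<in> sets borel} \<subseteq> events"
      using Y sets_F by blast
    show "{(\<lambda>\<omega>. f (?D \<omega>)) -` A \<inter> space M |A. A \<in> sets borel} \<subseteq> events"
      using f ind unfolding indep_sets2_eq by (meson order_trans)
    fix a b assume "a \<in> {Y -` A \<inter> space M |A. A \<in> sets borel}"
      and "b \<in> {(\<lambda>\<omega>. f (?D \<omega>)) -` A \<inter> space M |A. A \<in> sets borel}"
    with Y f have "a \<in> sets (F r)" "b \<in> ?E" by (metis (no_types, lifting) subsetD)+
    with ind show "prob (a \<inter> b) = prob a * prob b" unfolding indep_sets2_eq by blast
  qed
  then have "indep_set (sigma_sets (space M) {Y -` A \<inter> space M |A. A \<in> sets borel})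
     (sigma_sets (space M) {(\<lambda>\<omega>. f (?D \<omega>)) -` A \<inter> space M |A. A \<in> sets borel})"
    by (rule indep_set_sigma_sets) (rule stable)+
  then show ?thesis unfolding indep_var_eq by simp
qed

lemma increment_distributed:
  assumes "0 \<le> r" "r < u"
  shows "distributed M lborel (\<lambda>\<omega>. (B u \<omega> - B r \<omega>) $ k) (normal_density 0 (sqrt (u - r)))"
  using brownian assms by (auto simp: brownian_motion_def)

lemma increment_moments:
  assumes "0 \<le> r" "r \<le> u"
  shows "integrable M (\<lambda>\<omega>. (B u \<omega> - B r \<omega>) $ k)"
    and "expectation (\<lambda>\<omega>. (B u \<omega> - B r \<omega>) $ k) = 0"
    and "integrable M (\<lambda>\<omega>. (B u \<omega> - B r \<omega>) $ k * (B u \<omega> - B r \<omega>) $ l)"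
    and "expectation (\<lambda>\<omega>. (B u \<omega> - B r \<omega>) $ k * (B u \<omega> - B r \<omega>) $ l) = (if k = l then u - r else 0)"
proof -
  let ?D = "\<lambda>k \<omega>. (B u \<omega> - B r \<omega>) $ k"
  have "integrable M (?D k) \<and> expectation (?D k) = 0 \<and> integrable M (\<lambda>\<omega>. ?D k \<omega> * ?D l \<omega>) \<and>
     expectation (\<lambda>\<omega>. ?D k \<omega> * ?D l \<omega>) = (if k = l then u - r else 0)"
  \<comment> \<open>Partition points may coincide, so \<open>r = u\<close> must be allowed, but the
    normal density is available only for \<open>r < u\<close>.\<close>
  proof (cases "r = u")
    case False
    then have ru: "r < u" using assms by simp
    note D = increment_distributed[OF assms(1) ru]
    have I: "integrable M (?D k)" for k
      using integrable_normal_moment_nz_1[of "sqrt (u - r)" 0] ru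
        distributed_integrable[OF D[of k], of "\<lambda>x. x"] by simp
    have E: "expectation (?D k) = 0" for k
      using integral_normal_moment_nz_1[of "sqrt (u - r)" 0] ru
        distributed_integral[OF D[of k], of "\<lambda>x. x"] by simp
    have I2: "integrable M (\<lambda>\<omega>. ?D k \<omega> * ?D k \<omega>)" for k
      using integrable_normal_moment[of "sqrt (u - r)" 0 2] ru
        distributed_integrable[OF D[of k], of "\<lambda>x. x * x"] by (simp add: power2_eq_square)
    have E2: "expectation (\<lambda>\<omega>. ?D k \<omega> * ?D k \<omega>) = u - r" for k
      using integral_normal_moment_even[of "sqrt (u - r)" 0 1] ru
        distributed_integral[OF D[of k], of "\<lambda>x. x * x"] by (simp add: power2_eq_square)
    show ?thesis
    proof (cases "k = l")
      case True
      then show ?thesis using I E I2 E2 by simp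
    next
      case False
      have "indep_vars (\<lambda>_. borel) ?D UNIV" using brownian assms ru by (auto simp: brownian_motion_def)
      \<comment> \<open>Independence of a pair is extracted from independence of one coordinate and
        the sum over the singleton \<open>{l}\<close>.\<close>
      then have "indep_var borel (?D k) borel (?D l)"
        using indep_vars_sum[of "{l}" k ?D] indep_vars_subset[of "\<lambda>_. borel" ?D UNIV "{k, l}"] False by simp
      from indep_var_integrable[OF this I I] indep_var_lebesgue_integral[OF this I I]
      show ?thesis using I E False by simp
    qed
  qed simp
  then show "integrable M (\<lambda>\<omega>. (B u \<omega> - B r \<omega>) $ k)"
    and "expectation (\<lambda>\<omega>. (B u \<omega> - B r \<omega>) $ k) = 0"
    and "integrable M (\<lambda>\<omega>. (B u \<omega> - B r \<omega>) $ k * (B u \<omega> - B r \<omega>) $ l)"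
    and "expectation (\<lambda>\<omega>. (B u \<omega> - B r \<omega>) $ k * (B u \<omega> - B r \<omega>) $ l) = (if k = l then u - r else 0)"
    by auto
qed

text \<open>Takes the place of conditional expectations given \<open>F r\<close>: a weight
  \<open>Y\<close> known at time \<open>r\<close> is independent of the increment, so each
  expectation factors.\<close>

lemma increment_expectation:
  assumes "0 \<le> r" "r \<le> u" "Y \<in> borel_measurable (F r)" "integrable M Y"
  shows "integrable M (\<lambda>\<omega>. Y \<omega> * (B u \<omega> - B r \<omega>) $ k)"
    and "expectation (\<lambda>\<omega>. Y \<omega> * (B u \<omega> - B r \<omega>) $ k) = 0"
    and "integrable M (\<lambda>\<omega>. Y \<omega> * ((B u \<omega> - B r \<omega>) $ k * (B u \<omega> - B r \<omega>) $ l))"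
    and "expectation (\<lambda>\<omega>. Y \<omega> * ((B u \<omega> - B r \<omega>) $ k * (B u \<omega> - B r \<omega>) $ l)) =
      expectation Y * (if k = l then u - r else 0)"
proof -
  let ?D = "\<lambda>k \<omega>. (B u \<omega> - B r \<omega>) $ k"
  have "integrable M (\<lambda>\<omega>. Y \<omega> * ?D k \<omega>) \<and> expectation (\<lambda>\<omega>. Y \<omega> * ?D k \<omega>) = 0 \<and>
      integrable M (\<lambda>\<omega>. Y \<omega> * (?D k \<omega> * ?D l \<omega>)) \<and>
     expectation (\<lambda>\<omega>. Y \<omega> * (?D k \<omega> * ?D l \<omega>)) = expectation Y * (if k = l then u - r else 0)"
  proof (cases "r = u")
    case False
    then have ru: "r < u" using assms by simp
    note m = increment_moments[OF assms(1,2)]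
    have i1: "indep_var borel Y borel (?D k)"
      using indep_var_increment[OF assms(1) ru assms(3), of "\<lambda>x. x $ k"] by simp
    have i2: "indep_var borel Y borel (\<lambda>\<omega>. ?D k \<omega> * ?D l \<omega>)"
      using indep_var_increment[OF assms(1) ru assms(3), of "\<lambda>x. x $ k * x $ l"] by simp
    show ?thesis
      using indep_var_integrable[OF i1 assms(4) m(1)] indep_var_lebesgue_integral[OF i1 assms(4) m(1)]
        indep_var_integrable[OF i2 assms(4) m(3)] indep_var_lebesgue_integral[OF i2 assms(4) m(3)] m(2,4)
      by simp
  qed simp
  then show "integrable M (\<lambda>\<omega>. Y \<omega> * (B u \<omega> - B r \<omega>) $ k)"
    and "expectation (\<lambda>\<omega>. Y \<omega> * (B u \<omega> - B r \<omega>) $ k) = 0"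
    and "integrable M (\<lambda>\<omega>. Y \<omega> * ((B u \<omega> - B r \<omega>) $ k * (B u \<omega> - B r \<omega>) $ l))"
    and "expectation (\<lambda>\<omega>. Y \<omega> * ((B u \<omega> - B r \<omega>) $ k * (B u \<omega> - B r \<omega>) $ l)) =
      expectation Y * (if k = l then u - r else 0)"
    by auto
qed

text \<open>One time step of a discrete stochastic integral. With \<open>Y\<close> the sum over
  earlier steps, the vanishing expectation is the orthogonality of martingale increments; with
  \<open>Y = 1\<close> it is the mean of the step. The second moment is one summand of the
  isometry.\<close>

lemma inner_increment:
  fixes \<eta> :: "'w \<Rightarrow> real^'m"
  assumes ru: "0 \<le> r" "r \<le> u" and \<eta>: "\<eta> \<in> borel_measurable (F r)" "\<And>\<omega>. \<omega> \<in> space M \<Longrightarrow> norm (\<eta> \<omega>) \<le> C"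
    and Y: "Y \<in> borel_measurable (F r)" "integrable M Y"
  shows "integrable M (\<lambda>\<omega>. Y \<omega> * (\<eta> \<omega> \<bullet> (B u \<omega> - B r \<omega>)))"
    and "expectation (\<lambda>\<omega>. Y \<omega> * (\<eta> \<omega> \<bullet> (B u \<omega> - B r \<omega>))) = 0"
    and "integrable M (\<lambda>\<omega>. (\<eta> \<omega> \<bullet> (B u \<omega> - B r \<omega>))\<^sup>2)"
    and "expectation (\<lambda>\<omega>. (\<eta> \<omega> \<bullet> (B u \<omega> - B r \<omega>))\<^sup>2) = (u - r) * expectation (\<lambda>\<omega>. (norm (\<eta> \<omega>))\<^sup>2)"
proof -
  let ?D = "\<lambda>k \<omega>. (B u \<omega> - B r \<omega>) $ k"
  have [measurable]: "\<eta> \<in> borel_measurable M" "Y \<in> borel_measurable M"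
    using \<eta> Y measurable_F by auto
  have bnd: "\<bar>\<eta> \<omega> $ k\<bar> \<le> C" if "\<omega> \<in> space M" for \<omega> k
    using \<eta>(2)[OF that] component_le_norm_cart[of "\<eta> \<omega>" k] by simp
  have Y\<eta>: "integrable M (\<lambda>\<omega>. Y \<omega> * \<eta> \<omega> $ k)" for k
  proof (rule Bochner_Integration.integrable_bound[OF integrable_mult_right[OF Y(2), of C]])
    show "AE \<omega> in M. norm (Y \<omega> * \<eta> \<omega> $ k) \<le> norm (C * Y \<omega>)"
    proof (rule AE_I2)
      fix \<omega> assume "\<omega> \<in> space M"
      from bnd[OF this, of k] have "\<bar>\<eta> \<omega> $ k\<bar> * \<bar>Y \<omega>\<bar> \<le> \<bar>C\<bar> * \<bar>Y \<omega>\<bar>"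
        by (intro mult_right_mono) auto
      then show "norm (Y \<omega> * \<eta> \<omega> $ k) \<le> norm (C * Y \<omega>)" by (simp add: abs_mult mult.commute)
    qed
  qed simp
  have Y\<eta>F: "(\<lambda>\<omega>. Y \<omega> * \<eta> \<omega> $ k) \<in> borel_measurable (F r)" for k
    using Y(1) \<eta>(1) by simp
  have eq1: "Y \<omega> * (\<eta> \<omega> \<bullet> (B u \<omega> - B r \<omega>)) = (\<Sum>k\<in>UNIV. (Y \<omega> * \<eta> \<omega> $ k) * ?D k \<omega>)" for \<omega>
    by (simp add: inner_vec_def sum_distrib_left mult.assoc)
  note e1 = increment_expectation(1,2)[OF ru Y\<eta>F Y\<eta>]
  show "integrable M (\<lambda>\<omega>. Y \<omega> * (\<eta> \<omega> \<bullet> (B u \<omega> - B r \<omega>)))"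
    unfolding eq1 by (intro Bochner_Integration.integrable_sum e1)
  show "expectation (\<lambda>\<omega>. Y \<omega> * (\<eta> \<omega> \<bullet> (B u \<omega> - B r \<omega>))) = 0"
    unfolding eq1 by (subst Bochner_Integration.integral_sum) (use e1 in auto)
  have \<eta>\<eta>: "integrable M (\<lambda>\<omega>. \<eta> \<omega> $ k * \<eta> \<omega> $ l)" for k l
  proof (rule integrable_const_bound[of _ "C * C"])
    show "AE \<omega> in M. norm (\<eta> \<omega> $ k * \<eta> \<omega> $ l) \<le> C * C"
    proof (rule AE_I2)
      fix \<omega> assume "\<omega> \<in> space M"
      from bnd[OF this, of k] bnd[OF this, of l] show "norm (\<eta> \<omega> $ k * \<eta> \<omega> $ l) \<le> C * C"
        by (simp add: abs_mult mult_mono')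
    qed
  qed simp
  have \<eta>\<eta>F: "(\<lambda>\<omega>. \<eta> \<omega> $ k * \<eta> \<omega> $ l) \<in> borel_measurable (F r)" for k l
    using \<eta>(1) by simp
  have eq2: "(\<eta> \<omega> \<bullet> (B u \<omega> - B r \<omega>))\<^sup>2 =
    (\<Sum>k\<in>UNIV. \<Sum>l\<in>UNIV. (\<eta> \<omega> $ k * \<eta> \<omega> $ l) * (?D k \<omega> * ?D l \<omega>))" for \<omega>
    by (simp add: inner_vec_def power2_eq_square sum_product algebra_simps)
  note e2 = increment_expectation(3,4)[OF ru \<eta>\<eta>F \<eta>\<eta>]
  show "integrable M (\<lambda>\<omega>. (\<eta> \<omega> \<bullet> (B u \<omega> - B r \<omega>))\<^sup>2)"
    unfolding eq2 by (intro Bochner_Integration.integrable_sum e2)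
  have "expectation (\<lambda>\<omega>. (\<eta> \<omega> \<bullet> (B u \<omega> - B r \<omega>))\<^sup>2) =
     (\<Sum>k\<in>UNIV. \<Sum>l\<in>UNIV. expectation (\<lambda>\<omega>. \<eta> \<omega> $ k * \<eta> \<omega> $ l) * (if k = l then u - r else 0))"
    unfolding eq2
    by (subst Bochner_Integration.integral_sum, intro Bochner_Integration.integrable_sum e2)
       (intro sum.cong refl, subst Bochner_Integration.integral_sum, (intro e2 sum.cong refl)+)
  also have "\<dots> = (u - r) * (\<Sum>k\<in>UNIV. expectation (\<lambda>\<omega>. \<eta> \<omega> $ k * \<eta> \<omega> $ k))"
    by (simp add: if_distrib cong: if_cong) (simp add: sum_distrib_left mult.commute)
  also have "(\<Sum>k\<in>UNIV. expectation (\<lambda>\<omega>. \<eta> \<omega> $ k * \<eta> \<omega> $ k)) = expectation (\<lambda>\<omega>. (norm (\<eta> \<omega>))\<^sup>2)"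
    by (simp add: power2_norm_eq_inner inner_vec_def Bochner_Integration.integral_sum \<eta>\<eta>)
  finally show "expectation (\<lambda>\<omega>. (\<eta> \<omega> \<bullet> (B u \<omega> - B r \<omega>))\<^sup>2) = (u - r) * expectation (\<lambda>\<omega>. (norm (\<eta> \<omega>))\<^sup>2)" .
qed

text \<open>Squaring the sum leaves only the diagonal, because each new step is orthogonal to the
  past. Nonnegativity of \<open>p k\<close> and measurability with respect to \<open>F (p k)\<close>
  are carried along because the next step of the induction needs them.\<close>

lemma martingale_transform_moments:
  fixes \<eta> :: "nat \<Rightarrow> 'w \<Rightarrow> real^'m"
  assumes "0 \<le> p 0" "\<And>i. i < k \<Longrightarrow> p i \<le> p (Suc i)"
    and "\<And>i. i < k \<Longrightarrow> \<eta> i \<in> borel_measurable (F (p i))"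
    and "\<And>i \<omega>. i < k \<Longrightarrow> \<omega> \<in> space M \<Longrightarrow> norm (\<eta> i \<omega>) \<le> C"
  shows "0 \<le> p k \<and>
    (\<lambda>\<omega>. \<Sum>i<k. \<eta> i \<omega> \<bullet> (B (p (Suc i)) \<omega> - B (p i) \<omega>)) \<in> borel_measurable (F (p k)) \<and>
    integrable M (\<lambda>\<omega>. \<Sum>i<k. \<eta> i \<omega> \<bullet> (B (p (Suc i)) \<omega> - B (p i) \<omega>)) \<and>
    expectation (\<lambda>\<omega>. \<Sum>i<k. \<eta> i \<omega> \<bullet> (B (p (Suc i)) \<omega> - B (p i) \<omega>)) = 0 \<and>
    integrable M (\<lambda>\<omega>. (\<Sum>i<k. \<eta> i \<omega> \<bullet> (B (p (Suc i)) \<omega> - B (p i) \<omega>))\<^sup>2) \<and>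
    expectation (\<lambda>\<omega>. (\<Sum>i<k. \<eta> i \<omega> \<bullet> (B (p (Suc i)) \<omega> - B (p i) \<omega>))\<^sup>2) =
      (\<Sum>i<k. (p (Suc i) - p i) * expectation (\<lambda>\<omega>. (norm (\<eta> i \<omega>))\<^sup>2))"
  using assms
proof (induction k)
  case 0
  then show ?case by simp
next
  case (Suc k)
  define X where "X \<omega> = (\<Sum>i<k. \<eta> i \<omega> \<bullet> (B (p (Suc i)) \<omega> - B (p i) \<omega>))" for \<omega>
  define N where "N \<omega> = \<eta> k \<omega> \<bullet> (B (p (Suc k)) \<omega> - B (p k) \<omega>)" for \<omega>
  have IH: "0 \<le> p k" "X \<in> borel_measurable (F (p k))" "integrable M X" "expectation X = 0"
    "integrable M (\<lambda>\<omega>. (X \<omega>)\<^sup>2)"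
    "expectation (\<lambda>\<omega>. (X \<omega>)\<^sup>2) = (\<Sum>i<k. (p (Suc i) - p i) * expectation (\<lambda>\<omega>. (norm (\<eta> i \<omega>))\<^sup>2))"
    using Suc unfolding X_def by auto
  have pk: "p k \<le> p (Suc k)" using Suc by simp
  have \<eta>: "\<eta> k \<in> borel_measurable (F (p k))" "\<And>\<omega>. \<omega> \<in> space M \<Longrightarrow> norm (\<eta> k \<omega>) \<le> C" using Suc by auto
  have "N \<in> borel_measurable (F (p (Suc k)))"
    unfolding N_def using measurable_F_mono[OF \<eta>(1) pk] B_adapted[of "p k" "p (Suc k)"] B_adapted[of "p (Suc k)" "p (Suc k)"] IH(1) pk
    by simp
  moreover have "X \<in> borel_measurable (F (p (Suc k)))" using measurable_F_mono[OF IH(2) pk] .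
  ultimately have m: "(\<lambda>\<omega>. X \<omega> + N \<omega>) \<in> borel_measurable (F (p (Suc k)))" by simp
  note XN = inner_increment[OF IH(1) pk \<eta> IH(2,3), folded N_def]
  have N: "integrable M N" "expectation N = 0"
    using inner_increment(1,2)[OF IH(1) pk \<eta> borel_measurable_const integrable_const, of 1]
    by (simp_all only: N_def[abs_def] mult_1)
  have sq: "(X \<omega> + N \<omega>)\<^sup>2 = (X \<omega>)\<^sup>2 + (2 * (X \<omega> * N \<omega>) + (N \<omega>)\<^sup>2)" for \<omega> by (simp add: power2_sum)
  have "integrable M (\<lambda>\<omega>. X \<omega> + N \<omega>)" "expectation (\<lambda>\<omega>. X \<omega> + N \<omega>) = 0"
    using IH N by auto
  moreover have "integrable M (\<lambda>\<omega>. (X \<omega> + N \<omega>)\<^sup>2)"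
    unfolding sq using IH XN by simp
  moreover have "expectation (\<lambda>\<omega>. (X \<omega> + N \<omega>)\<^sup>2) =
      (\<Sum>i<Suc k. (p (Suc i) - p i) * expectation (\<lambda>\<omega>. (norm (\<eta> i \<omega>))\<^sup>2))"
    unfolding sq using IH XN by (simp add: Bochner_Integration.integral_add)
  ultimately show ?case
    using IH(1) pk m by (simp add: X_def N_def)
qed

text \<open>The Ito isometry for simple integrands, proved row by row. The norm on matrices is the
  Frobenius norm, so the contributions of the rows add up exactly.\<close>

lemma simple_ito_integral_moments:
  assumes si: "simple_integrand M F a b k p \<xi>" and a: "0 \<le> a"
  shows "simple_ito_integral B k p \<xi> \<in> borel_measurable M"
    and "integrable M (\<lambda>\<omega>. simple_ito_integral B k p \<xi> \<omega> $ i)"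
    and "expectation (\<lambda>\<omega>. simple_ito_integral B k p \<xi> \<omega> $ i) = 0"
    and "integrable M (\<lambda>\<omega>. (norm (simple_ito_integral B k p \<xi> \<omega>))\<^sup>2)"
    and "expectation (\<lambda>\<omega>. (norm (simple_ito_integral B k p \<xi> \<omega>))\<^sup>2) =
      expectation (\<lambda>\<omega>. \<Sum>i<k. (p (Suc i) - p i) * (norm (\<xi> i \<omega>))\<^sup>2)"
proof -
  obtain C where C: "\<And>i \<omega>. i < k \<Longrightarrow> \<omega> \<in> space M \<Longrightarrow> norm (\<xi> i \<omega>) \<le> C"
    using si unfolding simple_integrand_def by metis
  have C': "norm (\<xi> i \<omega> $ j) \<le> C" if "i < k" "\<omega> \<in> space M" for i \<omega> j
    using C[OF that] Finite_Cartesian_Product.norm_nth_le[of "\<xi> i \<omega>" j] by simp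
  have \<xi>F: "\<And>i. i < k \<Longrightarrow> \<xi> i \<in> borel_measurable (F (p i))"
    using si unfolding simple_integrand_def by auto
  have \<xi>M: "\<And>i. i < k \<Longrightarrow> \<xi> i \<in> borel_measurable M" using \<xi>F measurable_F by blast
  have p: "0 \<le> p 0" "\<And>i. i < k \<Longrightarrow> p i \<le> p (Suc i)"
    using si a unfolding simple_integrand_def by auto
  have comp: "simple_ito_integral B k p \<xi> \<omega> $ j = (\<Sum>i<k. (\<xi> i \<omega> $ j) \<bullet> (B (p (Suc i)) \<omega> - B (p i) \<omega>))" for j \<omega>
    by (simp add: simple_ito_integral_def matrix_vector_mul_component)
  have m: "integrable M (\<lambda>\<omega>. simple_ito_integral B k p \<xi> \<omega> $ j) \<and>
    expectation (\<lambda>\<omega>. simple_ito_integral B k p \<xi> \<omega> $ j) = 0 \<and>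
    integrable M (\<lambda>\<omega>. (simple_ito_integral B k p \<xi> \<omega> $ j)\<^sup>2) \<and>
    expectation (\<lambda>\<omega>. (simple_ito_integral B k p \<xi> \<omega> $ j)\<^sup>2) =
      (\<Sum>i<k. (p (Suc i) - p i) * expectation (\<lambda>\<omega>. (norm (\<xi> i \<omega> $ j))\<^sup>2))" for j
    unfolding comp
    by (rule martingale_transform_moments[THEN conjunct2, THEN conjunct2, of p k "\<lambda>i \<omega>. \<xi> i \<omega> $ j" C])
       (rule p C' borel_measurable_vec_nth[OF \<xi>F]; assumption)+
  have nm: "(norm (simple_ito_integral B k p \<xi> \<omega>))\<^sup>2 = (\<Sum>j\<in>UNIV. (simple_ito_integral B k p \<xi> \<omega> $ j)\<^sup>2)" for \<omega>
    unfolding power2_norm_eq_inner by (simp add: inner_vec_def power2_eq_square)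
  show "integrable M (\<lambda>\<omega>. simple_ito_integral B k p \<xi> \<omega> $ i)"
    and "expectation (\<lambda>\<omega>. simple_ito_integral B k p \<xi> \<omega> $ i) = 0" by (simp_all add: m)
  show "simple_ito_integral B k p \<xi> \<in> borel_measurable M"
    by (intro borel_measurable_vecI borel_measurable_integrable) (simp add: m)
  show "integrable M (\<lambda>\<omega>. (norm (simple_ito_integral B k p \<xi> \<omega>))\<^sup>2)"
    unfolding nm by (intro Bochner_Integration.integrable_sum) (simp add: m)
  have int: "integrable M (\<lambda>\<omega>. (norm (\<xi> i \<omega> $ j))\<^sup>2)" if "i < k" for i j
  proof (rule integrable_const_bound[of _ "C\<^sup>2"])
    show "AE \<omega> in M. norm ((norm (\<xi> i \<omega> $ j))\<^sup>2) \<le> C\<^sup>2"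
      using C'[OF that] by (auto intro!: AE_I2 power_mono)
    show "(\<lambda>\<omega>. (norm (\<xi> i \<omega> $ j))\<^sup>2) \<in> borel_measurable M"
      using \<xi>M[OF that] by simp
  qed
  have "expectation (\<lambda>\<omega>. (norm (simple_ito_integral B k p \<xi> \<omega>))\<^sup>2) =
     (\<Sum>j\<in>UNIV. expectation (\<lambda>\<omega>. (simple_ito_integral B k p \<xi> \<omega> $ j)\<^sup>2))"
    unfolding nm by (subst Bochner_Integration.integral_sum) (simp_all add: m)
  also have "\<dots> = (\<Sum>j\<in>UNIV. \<Sum>i<k. (p (Suc i) - p i) * expectation (\<lambda>\<omega>. (norm (\<xi> i \<omega> $ j))\<^sup>2))"
    by (simp add: m)
  also have "\<dots> = (\<Sum>i<k. (p (Suc i) - p i) * expectation (\<lambda>\<omega>. \<Sum>j\<in>UNIV. (norm (\<xi> i \<omega> $ j))\<^sup>2))"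
    using int by (subst sum.swap) (simp add: Bochner_Integration.integral_sum sum_distrib_left)
  also have "\<dots> = expectation (\<lambda>\<omega>. \<Sum>i<k. (p (Suc i) - p i) * (\<Sum>j\<in>UNIV. (norm (\<xi> i \<omega> $ j))\<^sup>2))"
    using int by (subst Bochner_Integration.integral_sum) auto
  also have "\<dots> = expectation (\<lambda>\<omega>. \<Sum>i<k. (p (Suc i) - p i) * (norm (\<xi> i \<omega>))\<^sup>2)"
    by (simp add: power2_norm_eq_inner inner_vec_def)
  finally show "expectation (\<lambda>\<omega>. (norm (simple_ito_integral B k p \<xi> \<omega>))\<^sup>2) =
      expectation (\<lambda>\<omega>. \<Sum>i<k. (p (Suc i) - p i) * (norm (\<xi> i \<omega>))\<^sup>2)" .
qed

end

section \<open>Convergence of expectations\<close>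

text \<open>Fatou's lemma in the form used throughout: second-moment bounds survive almost sure
  limits, and the limit only has to be dominated by the lower limit, which leaves room for indicator
  functions.\<close>

lemma nn_integral_fatou_bound:
  fixes f :: "'a \<Rightarrow> ennreal"
  assumes "\<And>n. f' n \<in> borel_measurable N" "AE x in N. f x \<le> liminf (\<lambda>n. f' n x)"
    and "\<And>n. (\<integral>\<^sup>+x. f' n x \<partial>N) \<le> c n" "c \<longlonglongrightarrow> L"
  shows "(\<integral>\<^sup>+x. f x \<partial>N) \<le> L"
proof -
  have "(\<integral>\<^sup>+x. f x \<partial>N) \<le> (\<integral>\<^sup>+x. liminf (\<lambda>n. f' n x) \<partial>N)"
    using assms(2) by (rule nn_integral_mono_AE)
  also have "\<dots> \<le> liminf (\<lambda>n. \<integral>\<^sup>+x. f' n x \<partial>N)"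
    using assms(1) by (rule nn_integral_liminf)
  also have "\<dots> \<le> liminf c"
    using assms(3) by (intro Liminf_mono always_eventually) auto
  also have "\<dots> = L"
    using assms(4) by (intro lim_imp_Liminf) auto
  finally show ?thesis .
qed

text \<open>Borel-Cantelli: \<open>s j\<close> is chosen so that the \<open>j\<close>-th exceptional
  event has measure below \<open>(1/2)^j\<close>. This turns convergence in probability into almost
  sure convergence along a subsequence.\<close>

lemma (in finite_measure) almost_surely_avoiding_subsequence:
  fixes A :: "nat \<Rightarrow> nat \<Rightarrow> 'a set"
  assumes "\<And>j n. A j n \<in> sets M" "\<And>j. (\<lambda>n. measure M (A j n)) \<longlonglongrightarrow> 0"
  shows "\<exists>s. AE x in M. eventually (\<lambda>j. x \<notin> A j (s j)) sequentially"
proof -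
  have "\<exists>n. measure M (A j n) < (1/2)^j" for j
    using order_tendstoD(2)[OF assms(2), of "(1/2)^j" j] by (auto simp: eventually_sequentially)
  then obtain s where s: "\<And>j. measure M (A j (s j)) < (1/2)^j" by metis
  have "summable (\<lambda>j. measure M (A j (s j)))"
    by (rule summable_comparison_test'[of "\<lambda>j. (1/2)^j" 0])
       (use s in \<open>auto intro: less_imp_le simp: summable_geometric\<close>)
  then have "AE x in M. eventually (\<lambda>j. x \<in> space M - A j (s j)) sequentially"
    using assms(1) by (intro borel_cantelli_AE1) (auto simp: emeasure_eq_measure)
  then have "AE x in M. eventually (\<lambda>j. x \<notin> A j (s j)) sequentially"
    by eventually_elim (auto elim: eventually_mono)
  then show ?thesis by blast
qed

lemma (in finite_measure) square_nn_integral_finite: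
  fixes f :: "'a \<Rightarrow> real"
  assumes [measurable]: "f \<in> borel_measurable M" and "(\<integral>\<^sup>+x. ennreal ((f x)\<^sup>2) \<partial>M) < \<infinity>"
  shows "integrable M (\<lambda>x. (f x)\<^sup>2)" "integrable M f"
proof -
  show "integrable M (\<lambda>x. (f x)\<^sup>2)"
    using assms(2) by (intro integrableI_bounded) auto
  then show "integrable M f" by (rule square_integrable_imp_integrable[rotated]) simp
qed

text \<open>Boundedness in \<open>L\<^sup>2\<close> gives the uniform integrability needed to pass to the limit in the mean.\<close>

lemma (in prob_space) expectation_zero_limit:
  fixes f :: "'a \<Rightarrow> real"
  assumes [measurable]: "\<And>n. f' n \<in> borel_measurable M" "f \<in> borel_measurable M"
    and lim: "AE x in M. (\<lambda>n. f' n x) \<longlonglongrightarrow> f x"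
    and bnd: "\<And>n. (\<integral>\<^sup>+x. ennreal ((f' n x)\<^sup>2) \<partial>M) \<le> ennreal D"
    and zero: "\<And>n. expectation (f' n) = 0"
  shows "integrable M f" "expectation f = 0"
proof -
  have fin': "(\<integral>\<^sup>+x. ennreal ((f' n x)\<^sup>2) \<partial>M) < \<infinity>" for n
    using bnd[of n] by (simp add: order_le_less_trans)
  have lim2: "AE x in M. ennreal ((f x)\<^sup>2) \<le> liminf (\<lambda>n. ennreal ((f' n x)\<^sup>2))"
    using lim
  proof eventually_elim
    case (elim x)
    then have "(\<lambda>n. ennreal ((f' n x)\<^sup>2)) \<longlonglongrightarrow> ennreal ((f x)\<^sup>2)"
      by (intro tendsto_ennrealI tendsto_intros)
    then show ?case by (intro eq_refl lim_imp_Liminf[symmetric]) auto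
  qed
  have bndf: "(\<integral>\<^sup>+x. ennreal ((f x)\<^sup>2) \<partial>M) \<le> ennreal D"
    by (rule nn_integral_fatou_bound[where f'="\<lambda>n x. ennreal ((f' n x)\<^sup>2)" and c="\<lambda>_. ennreal D", OF _ lim2 bnd]) auto
  then have fin: "(\<integral>\<^sup>+x. ennreal ((f x)\<^sup>2) \<partial>M) < \<infinity>" by (simp add: order_le_less_trans)
  note f = square_nn_integral_finite[OF assms(2) fin] and f' = square_nn_integral_finite[OF assms(1) fin']
  show int: "integrable M f" using f by simp
  have D': "expectation (\<lambda>x. (f x)\<^sup>2) \<le> max D 0" "expectation (\<lambda>x. (f' n x)\<^sup>2) \<le> max D 0" for n
    using bndf bnd[of n] f f' by (auto simp: nn_integral_eq_integral ennreal_le_iff2 le_max_iff_disj)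
  \<comment> \<open>Cut the difference \<open>\<bar>f' n - f\<bar>\<close> at height
    \<open>R\<close>. The part below converges to 0 in mean by dominated convergence; above
    \<open>R\<close> the difference is at most its square divided by \<open>R\<close>, which the
    second moments bound uniformly in \<open>n\<close>.\<close>
  have le: "\<bar>expectation f\<bar> \<le> 4 * max D 0 / R" if R: "R > 0" for R
  proof -
    let ?h = "\<lambda>n x. min \<bar>f' n x - f x\<bar> R"
    have hI: "integrable M (?h n)" for n
      by (rule integrable_const_bound[of _ R]) (use R in auto)
    have "(\<lambda>n. expectation (?h n)) \<longlonglongrightarrow> expectation (\<lambda>x. 0)"
    proof (rule integral_dominated_convergence[where w="\<lambda>_. R"])
      show "AE x in M. (\<lambda>n. ?h n x) \<longlonglongrightarrow> 0"
        using lim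
      proof eventually_elim
        case (elim x)
        have "(\<lambda>n. ?h n x) \<longlonglongrightarrow> min \<bar>f x - f x\<bar> R"
          by (intro tendsto_intros elim)
        then show ?case using R by simp
      qed
    qed (use R in auto)
    then have h0: "(\<lambda>n. expectation (?h n) + 4 * max D 0 / R) \<longlonglongrightarrow> 4 * max D 0 / R"
      using tendsto_add[of "\<lambda>n. expectation (?h n)" 0 sequentially "\<lambda>_. 4 * max D 0 / R"] by auto
    have "\<bar>expectation f\<bar> \<le> expectation (?h n) + 4 * max D 0 / R" for n
    proof -
      have pw: "\<bar>f' n x - f x\<bar> \<le> ?h n x + 2 * ((f' n x)\<^sup>2 + (f x)\<^sup>2) / R" for x
      proof (cases "\<bar>f' n x - f x\<bar> \<le> R")
        case True then show ?thesis using R by simp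
      next
        case False
        then have "\<bar>f' n x - f x\<bar> * R \<le> \<bar>f' n x - f x\<bar> * \<bar>f' n x - f x\<bar>"
          by (intro mult_left_mono) auto
        also have "\<dots> = (f' n x - f x)\<^sup>2" by (simp add: power2_eq_square)
        also have "\<dots> \<le> 2 * ((f' n x)\<^sup>2 + (f x)\<^sup>2)"
          using zero_le_power2[of "f' n x + f x"] by (simp add: power2_eq_square algebra_simps)
        finally have "\<bar>f' n x - f x\<bar> \<le> 2 * ((f' n x)\<^sup>2 + (f x)\<^sup>2) / R"
          using R by (simp add: field_simps)
        then show ?thesis using R by simp
      qed
      have "\<bar>expectation f\<bar> = \<bar>expectation (\<lambda>x. f' n x - f x)\<bar>"
        using f f' zero by simp
      also have "\<dots> \<le> expectation (\<lambda>x. \<bar>f' n x - f x\<bar>)"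
        by (rule integral_abs_bound)
      also have "\<dots> \<le> expectation (\<lambda>x. ?h n x + 2 * ((f' n x)\<^sup>2 + (f x)\<^sup>2) / R)"
        by (intro integral_mono pw) (use f f' hI in auto)
      also have "\<dots> = expectation (?h n) + 2 * (expectation (\<lambda>x. (f' n x)\<^sup>2) + expectation (\<lambda>x. (f x)\<^sup>2)) / R"
        using f f' hI by simp
      also have "\<dots> \<le> expectation (?h n) + 4 * max D 0 / R"
        using D'(1) D'(2)[of n] R by (intro add_left_mono divide_right_mono) auto
      finally show ?thesis .
    qed
    then show ?thesis using LIMSEQ_le_const[OF h0] by blast
  qed
  have "\<bar>expectation f\<bar> \<le> 0"
  proof (rule field_le_epsilon)
    fix e :: real assume e: "e > 0"
    \<comment> \<open>The summand 1 keeps \<open>R\<close> positive when the second moments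
      vanish.\<close>
    have "\<bar>expectation f\<bar> \<le> 4 * max D 0 / ((4 * max D 0 + 1) / e)"
      using e by (intro le) (auto intro!: divide_pos_pos add_nonneg_pos)
    also have "\<dots> \<le> 0 + e" using e by (simp add: field_simps)
    finally show "\<bar>expectation f\<bar> \<le> 0 + e" .
  qed
  then show "expectation f = 0" by simp
qed

text \<open>Nonnegativity of the variance, that is, Cauchy-Schwarz against the constant 1.\<close>

lemma (in prob_space) expectation_abs_le_sqrt:
  fixes f :: "'a \<Rightarrow> real"
  assumes "integrable M f" "integrable M (\<lambda>x. (f x)\<^sup>2)" "expectation (\<lambda>x. (f x)\<^sup>2) \<le> c"
  shows "\<bar>expectation f\<bar> \<le> sqrt c"
proof -
  have "0 \<le> variance f" by (rule variance_positive)
  then have "(expectation f)\<^sup>2 \<le> expectation (\<lambda>x. (f x)\<^sup>2)"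
    using variance_eq[OF assms(1,2)] by simp
  then have "(expectation f)\<^sup>2 \<le> c" using assms(3) by simp
  then show ?thesis using real_sqrt_le_mono[of "(expectation f)\<^sup>2" c] by simp
qed

lemma (in prob_space) expectation_square_component_le:
  fixes f :: "'a \<Rightarrow> real^'n"
  assumes [measurable]: "f \<in> borel_measurable M" and le: "(\<integral>\<^sup>+x. ennreal ((norm (f x))\<^sup>2) \<partial>M) \<le> ennreal c" and c: "0 \<le> c"
  shows "integrable M (\<lambda>x. (norm (f x))\<^sup>2)" "expectation (\<lambda>x. (norm (f x))\<^sup>2) \<le> c"
    and "integrable M (\<lambda>x. f x $ i * f x $ j)" "integrable M (\<lambda>x. f x $ i)"
proof -
  have "(\<integral>\<^sup>+x. ennreal ((norm (f x))\<^sup>2) \<partial>M) < \<infinity>" using le by (simp add: le_less_trans)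
  from square_nn_integral_finite(1)[OF _ this] show int: "integrable M (\<lambda>x. (norm (f x))\<^sup>2)" by simp
  have "(\<integral>\<^sup>+x. ennreal ((norm (f x))\<^sup>2) \<partial>M) = ennreal (expectation (\<lambda>x. (norm (f x))\<^sup>2))"
    using int by (intro nn_integral_eq_integral) auto
  then show "expectation (\<lambda>x. (norm (f x))\<^sup>2) \<le> c" using le c by simp
  have prod: "integrable M (\<lambda>x. f x $ i * f x $ j)" for i j
  proof (rule Bochner_Integration.integrable_bound[OF int _ AE_I2])
    fix x
    have "\<bar>f x $ i\<bar> * \<bar>f x $ j\<bar> \<le> norm (f x) * norm (f x)"
      by (intro mult_mono component_le_norm_cart) auto
    then show "norm (f x $ i * f x $ j) \<le> norm ((norm (f x))\<^sup>2)"
      by (simp add: abs_mult power2_eq_square)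
  qed measurable
  then show "integrable M (\<lambda>x. f x $ i * f x $ j)" .
  show "integrable M (\<lambda>x. f x $ i)"
  proof (rule square_integrable_imp_integrable)
    show "integrable M (\<lambda>x. (f x $ i)\<^sup>2)" using prod[of i i] by (simp add: power2_eq_square)
  qed measurable
qed

section \<open>Truncation of simple integrands\<close>

text \<open>For a simple integrand this is the pathwise time integral of the squared norm of its
  process; see \<open>nn_integral_simple_process\<close>.\<close>

definition energy :: "nat \<Rightarrow> (nat \<Rightarrow> real) \<Rightarrow> (nat \<Rightarrow> 'w \<Rightarrow> real^'m^'n) \<Rightarrow> 'w \<Rightarrow> real" where
  "energy k p \<xi> \<omega> = (\<Sum>i<k. (p (Suc i) - p i) * (norm (\<xi> i \<omega>))\<^sup>2)"

text \<open>
  The values are cut off at the first partition point where the energy exceeds \<open>C\<close>. Since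
  \<open>\<xi> i\<close> is known at the left end point \<open>p i\<close>, so is the energy accumulated up to \<open>p (Suc i)\<close>; hence the
  truncation is again a simple integrand, with no stopping times in continuous time involved.
\<close>

definition truncate_energy ::
  "real \<Rightarrow> (nat \<Rightarrow> real) \<Rightarrow> (nat \<Rightarrow> 'w \<Rightarrow> real^'m^'n) \<Rightarrow> nat \<Rightarrow> 'w \<Rightarrow> real^'m^'n" where
  "truncate_energy C p \<xi> i \<omega> = (if energy (Suc i) p \<xi> \<omega> \<le> C then \<xi> i \<omega> else 0)"

lemma energy_mono:
  assumes "\<And>i. i < k \<Longrightarrow> p i \<le> p (Suc i)" "j \<le> k"
  shows "energy j p \<xi> \<omega> \<le> energy k p \<xi> \<omega>"
  unfolding energy_def using assms by (intro sum_mono2) auto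

text \<open>If the last value is kept, then the whole energy up to it was at most \<open>C\<close>;
  if it is dropped, the claim is the one for the shorter partition.\<close>

lemma energy_truncate_le:
  assumes "\<And>i. i < k \<Longrightarrow> p i \<le> p (Suc i)" "0 \<le> C"
  shows "energy k p (truncate_energy C p \<xi>) \<omega> \<le> min C (energy k p \<xi> \<omega>)"
proof -
  have "energy k p (truncate_energy C p \<xi>) \<omega> \<le> energy k p \<xi> \<omega>"
    unfolding energy_def truncate_energy_def using assms by (intro sum_mono mult_left_mono) auto
  moreover have "energy k p (truncate_energy C p \<xi>) \<omega> \<le> C"
    using assms
  proof (induction k)
    case 0
    then show ?case by (simp add: energy_def)
  next
    case (Suc k)
    show ?case
    proof (cases "energy (Suc k) p \<xi> \<omega> \<le> C")
      case True
      have "energy (Suc k) p (truncate_energy C p \<xi>) \<omega> \<le> energy (Suc k) p \<xi> \<omega>"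
        unfolding energy_def truncate_energy_def using Suc.prems by (intro sum_mono mult_left_mono) auto
      then show ?thesis using True by simp
    next
      case False
      then have "energy (Suc k) p (truncate_energy C p \<xi>) \<omega> = energy k p (truncate_energy C p \<xi>) \<omega>"
        by (simp add: energy_def[of "Suc k" p "truncate_energy C p \<xi>"]
            energy_def[of k p "truncate_energy C p \<xi>"] truncate_energy_def[of C p \<xi> k])
      then show ?thesis using Suc by simp
    qed
  qed
  ultimately show ?thesis by simp
qed

text \<open>Running energies never exceed the total, so on a path of total energy at most
  \<open>C\<close> nothing is cut. Through this, bounds for truncated integrals become bounds for
  the original ones.\<close>

lemma simple_ito_integral_truncate:
  assumes "\<And>i. i < k \<Longrightarrow> p i \<le> p (Suc i)" "energy k p \<xi> \<omega> \<le> C"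
  shows "simple_ito_integral B k p (truncate_energy C p \<xi>) \<omega> = simple_ito_integral B k p \<xi> \<omega>"
  unfolding simple_ito_integral_def
proof (intro sum.cong refl)
  fix i assume "i \<in> {..<k}"
  then have "energy (Suc i) p \<xi> \<omega> \<le> energy k p \<xi> \<omega>" using assms(1) by (intro energy_mono) auto
  then show "truncate_energy C p \<xi> i \<omega> *v (B (p (Suc i)) \<omega> - B (p i) \<omega>) = \<xi> i \<omega> *v (B (p (Suc i)) \<omega> - B (p i) \<omega>)"
    using assms(2) by (simp add: truncate_energy_def)
qed

text \<open>No two of the half-open intervals meet, so the square of the sum has no mixed terms. The
  first conjunct makes the induction work: all earlier summands vanish on the newly added
  interval.\<close>

lemma simple_process_norm:
  assumes "\<And>i. i < k \<Longrightarrow> p i \<le> p (Suc i)"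
  shows "(p k < r \<longrightarrow> simple_process k p \<xi> r \<omega> = 0) \<and>
    (norm (simple_process k p \<xi> r \<omega>))\<^sup>2 = (\<Sum>i<k. indicator {p i<..p (Suc i)} r * (norm (\<xi> i \<omega>))\<^sup>2)"
  using assms
proof (induction k)
  case 0
  then show ?case by (simp add: simple_process_def)
next
  case (Suc k)
  have IH: "p k < r \<Longrightarrow> simple_process k p \<xi> r \<omega> = 0"
    "(norm (simple_process k p \<xi> r \<omega>))\<^sup>2 = (\<Sum>i<k. indicator {p i<..p (Suc i)} r * (norm (\<xi> i \<omega>))\<^sup>2)"
    using Suc by auto
  have eq: "simple_process (Suc k) p \<xi> r \<omega> =
      simple_process k p \<xi> r \<omega> + indicator {p k<..p (Suc k)} r *\<^sub>R \<xi> k \<omega>"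
    by (simp add: simple_process_def)
  have pk: "p k \<le> p (Suc k)" using Suc.prems by simp
  show ?case
  proof (cases "r \<in> {p k<..p (Suc k)}")
    case True
    then have z: "simple_process k p \<xi> r \<omega> = 0" using IH by simp
    then have "(\<Sum>i<k. indicator {p i<..p (Suc i)} r * (norm (\<xi> i \<omega>))\<^sup>2) = 0" using IH(2) by simp
    then show ?thesis using True z by (simp add: eq)
  next
    case False
    then show ?thesis using IH pk by (simp add: eq)
  qed
qed

lemma nn_integral_simple_process:
  assumes si: "simple_integrand M F a b k p \<xi>"
  shows "(\<integral>\<^sup>+r\<in>{a..b}. ennreal ((norm (simple_process k p \<xi> r \<omega>))\<^sup>2) \<partial>lborel) = ennreal (energy k p \<xi> \<omega>)"
proof -
  have p: "\<And>i. i < k \<Longrightarrow> p i \<le> p (Suc i)" "a \<le> p 0" "p k \<le> b"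
    using si by (auto simp: simple_integrand_def)
  have mono: "p i \<le> p j" if "i \<le> j" "j \<le> k" for i j
    using that(1,2)
  proof (induction rule: dec_induct)
    case (step n)
    then show ?case using p(1)[of n] by simp
  qed simp
  have "(\<integral>\<^sup>+r\<in>{a..b}. ennreal ((norm (simple_process k p \<xi> r \<omega>))\<^sup>2) \<partial>lborel) =
      (\<integral>\<^sup>+r. (\<Sum>i<k. ennreal ((norm (\<xi> i \<omega>))\<^sup>2) * indicator {p i<..p (Suc i)} r) \<partial>lborel)"
  proof (intro nn_integral_cong)
    fix r
    have nn: "(norm (simple_process k p \<xi> r \<omega>))\<^sup>2 = (\<Sum>i<k. indicator {p i<..p (Suc i)} r * (norm (\<xi> i \<omega>))\<^sup>2)"
      using simple_process_norm[of k p r \<xi> \<omega>] p(1) by blast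
    have "ennreal ((norm (simple_process k p \<xi> r \<omega>))\<^sup>2) * indicator {a..b} r =
      (\<Sum>i<k. ennreal (indicator {p i<..p (Suc i)} r * (norm (\<xi> i \<omega>))\<^sup>2) * indicator {a..b} r)"
      unfolding nn sum_distrib_right[symmetric] by (subst sum_ennreal) (simp, rule refl)
    also have "\<dots> = (\<Sum>i<k. ennreal ((norm (\<xi> i \<omega>))\<^sup>2) * indicator {p i<..p (Suc i)} r)"
    proof (intro sum.cong refl)
      fix i assume "i \<in> {..<k}"
      then have "a \<le> p i" "p (Suc i) \<le> b" using mono[of 0 i] mono[of "Suc i" k] p by auto
      then show "ennreal (indicator {p i<..p (Suc i)} r * (norm (\<xi> i \<omega>))\<^sup>2) * indicator {a..b} r =
         ennreal ((norm (\<xi> i \<omega>))\<^sup>2) * indicator {p i<..p (Suc i)} r"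
        by (auto simp: indicator_def)
    qed
    finally show "ennreal ((norm (simple_process k p \<xi> r \<omega>))\<^sup>2) * indicator {a..b} r =
      (\<Sum>i<k. ennreal ((norm (\<xi> i \<omega>))\<^sup>2) * indicator {p i<..p (Suc i)} r)" .
  qed
  also have "\<dots> = (\<Sum>i<k. ennreal ((norm (\<xi> i \<omega>))\<^sup>2) * emeasure lborel {p i<..p (Suc i)})"
    by (subst nn_integral_sum) (simp_all add: nn_integral_cmult_indicator)
  also have "\<dots> = (\<Sum>i<k. ennreal ((p (Suc i) - p i) * (norm (\<xi> i \<omega>))\<^sup>2))"
    using p by (intro sum.cong refl) (simp add: ennreal_mult mult.commute)
  also have "\<dots> = ennreal (energy k p \<xi> \<omega>)"
    unfolding energy_def using p by (intro sum_ennreal) auto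
  finally show ?thesis .
qed

section \<open>Moments of Ito integrals\<close>

abbreviation sq_int :: "real \<Rightarrow> real \<Rightarrow> (real \<Rightarrow> 'b::real_normed_vector) \<Rightarrow> ennreal" where
  "sq_int a b f \<equiv> \<integral>\<^sup>+r\<in>{a..b}. ennreal ((norm (f r))\<^sup>2) \<partial>lborel"

lemma norm_square_triangle:
  fixes x y :: "'a::real_normed_vector"
  shows "(norm (x + y))\<^sup>2 \<le> 2 * (norm x)\<^sup>2 + 2 * (norm y)\<^sup>2"
proof -
  have "(norm (x + y))\<^sup>2 \<le> (norm x + norm y)\<^sup>2" by (intro power_mono norm_triangle_ineq) auto
  also have "\<dots> \<le> 2 * (norm x)\<^sup>2 + 2 * (norm y)\<^sup>2"
    using zero_le_power2[of "norm x - norm y"] by (simp add: power2_eq_square algebra_simps)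
  finally show ?thesis .
qed

lemma progressive_diff_const:
  fixes f :: "real \<Rightarrow> 'w \<Rightarrow> 'z::{second_countable_topology, real_normed_vector}"
  assumes "progressive F a f"
  shows "progressive F a (\<lambda>r \<omega>. f r \<omega> - c)"
proof -
  have "(\<lambda>(r, \<omega>). f r \<omega> - c) = (\<lambda>x. (case x of (r, \<omega>) \<Rightarrow> f r \<omega>) - c)" by auto
  then show ?thesis using assms unfolding progressive_def by (auto intro!: borel_measurable_diff)
qed

section \<open>Progressive integrands and their simple approximations\<close>

context brownian_space
begin

text \<open>Progressive measurability concerns the strip \<open>{a..u}\<close> and the smaller
  sigma-algebra \<open>F u\<close>. Extending by 0 gives a function on the full product space with
  \<open>M\<close>, the form in which Fubini's theorem can be applied.\<close>

lemma progressive_measurable: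
  fixes g :: "real \<Rightarrow> 'w \<Rightarrow> 'b::real_normed_vector"
  assumes "progressive F a g" "a \<le> u"
  shows "(\<lambda>(r, \<omega>). indicator {a..u} r *\<^sub>R g r \<omega>) \<in> borel_measurable (borel \<Otimes>\<^sub>M M)"
proof -
  let ?R = "restrict_space (borel \<Otimes>\<^sub>M M) ({a..u} \<times> space M)"
  have sets: "{a..u} \<times> space M \<inter> space (borel \<Otimes>\<^sub>M M) \<in> sets (borel \<Otimes>\<^sub>M M)"
    by (intro sets.Int pair_measureI) auto
  have fst: "fst \<in> ?R \<rightarrow>\<^sub>M restrict_space borel {a..u}"
    by (intro measurable_restrict_space2 measurable_restrict_space1) (auto simp: space_restrict_space)
  have snd: "snd \<in> ?R \<rightarrow>\<^sub>M F u"
  proof (rule measurableI)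
    fix A assume A: "A \<in> sets (F u)"
    have "snd \<in> ?R \<rightarrow>\<^sub>M M" by (intro measurable_restrict_space1) simp
    from measurable_sets[OF this, of A] A sets_F show "snd -` A \<inter> space ?R \<in> sets ?R" by blast
  qed (auto simp: space_restrict_space space_pair_measure space_F)
  have "(\<lambda>(r, \<omega>). g r \<omega>) \<in> borel_measurable (restrict_space borel {a..u} \<Otimes>\<^sub>M F u)"
    using assms by (simp add: progressive_def)
  from measurable_compose[OF measurable_Pair[OF fst snd] this]
  have "(\<lambda>z. g (fst z) (snd z)) \<in> borel_measurable ?R" by (simp add: case_prod_beta)
  then have "(\<lambda>z. indicator ({a..u} \<times> space M) z *\<^sub>R g (fst z) (snd z)) \<in> borel_measurable (borel \<Otimes>\<^sub>M M)"
    by (subst (asm) borel_measurable_restrict_space_iff[OF sets])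
  then show ?thesis
    by (rule measurable_cong[THEN iffD1, rotated])
       (auto simp: space_pair_measure indicator_def)
qed

lemma progressive_square_integral_measurable:
  fixes g :: "real \<Rightarrow> 'w \<Rightarrow> 'b::real_normed_vector"
  assumes "progressive F a g" "a \<le> u"
  shows "(\<lambda>\<omega>. sq_int a u (\<lambda>r. g r \<omega>)) \<in> borel_measurable M"
proof -
  have [measurable]: "(\<lambda>(r, \<omega>). indicator {a..u} r *\<^sub>R g r \<omega>) \<in> borel_measurable (borel \<Otimes>\<^sub>M M)"
    using assms by (rule progressive_measurable)
  have "(\<lambda>\<omega>. \<integral>\<^sup>+r. ennreal ((norm (indicator {a..u} r *\<^sub>R g r \<omega>))\<^sup>2) \<partial>lborel) \<in> borel_measurable M"
    by measurable
  also have "(\<lambda>\<omega>. \<integral>\<^sup>+r. ennreal ((norm (indicator {a..u} r *\<^sub>R g r \<omega>))\<^sup>2) \<partial>lborel) =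
     (\<lambda>\<omega>. sq_int a u (\<lambda>r. g r \<omega>))"
    by (intro ext nn_integral_cong) (auto simp: indicator_def)
  finally show ?thesis .
qed

lemma simple_integrand_truncate:
  fixes \<xi> :: "nat \<Rightarrow> 'w \<Rightarrow> real^'m^'n"
  assumes si: "simple_integrand M F a b k p \<xi>"
  shows "simple_integrand M F a b k p (truncate_energy C p \<xi>)"
proof -
  have p: "\<And>i. i < k \<Longrightarrow> p i \<le> p (Suc i)"
    and \<xi>: "\<And>i. i < k \<Longrightarrow> \<xi> i \<in> borel_measurable (F (p i))"
    using si by (auto simp: simple_integrand_def)
  have mono: "p j \<le> p i" if "j \<le> i" "i < k" for i j
    using that
  proof (induction rule: dec_induct)
    case (step n)
    then show ?case using p[of n] by simp
  qed simp
  have "truncate_energy C p \<xi> i \<in> borel_measurable (F (p i))" if i: "i < k" for i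
  proof -
    have "(\<lambda>\<omega>. energy (Suc i) p \<xi> \<omega>) \<in> borel_measurable (F (p i))"
      unfolding energy_def
    proof (intro borel_measurable_sum)
      fix j assume "j \<in> {..<Suc i}"
      then have "\<xi> j \<in> borel_measurable (F (p i))"
        using i mono[of j i] by (intro measurable_F_mono[OF \<xi>]) auto
      then show "(\<lambda>\<omega>. (p (Suc j) - p j) * (norm (\<xi> j \<omega>))\<^sup>2) \<in> borel_measurable (F (p i))" by simp
    qed
    then show ?thesis unfolding truncate_energy_def using \<xi>[OF i] by simp
  qed
  moreover obtain K where "\<And>i \<omega>. i < k \<Longrightarrow> \<omega> \<in> space M \<Longrightarrow> norm (\<xi> i \<omega>) \<le> K"
    using si unfolding simple_integrand_def by metis
  then have "\<forall>i<k. \<forall>\<omega>\<in>space M. norm (truncate_energy C p \<xi> i \<omega>) \<le> max K 0"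
    by (auto simp: truncate_energy_def intro: max.coboundedI1)
  ultimately show ?thesis using si unfolding simple_integrand_def by blast
qed

lemma simple_process_measurable:
  fixes \<xi> :: "nat \<Rightarrow> 'w \<Rightarrow> real^'m^'n"
  assumes si: "simple_integrand M F a b k p \<xi>"
  shows "(\<lambda>(r, \<omega>). simple_process k p \<xi> r \<omega>) \<in> borel_measurable (borel \<Otimes>\<^sub>M M)"
proof -
  have \<xi>: "\<And>i. i < k \<Longrightarrow> \<xi> i \<in> borel_measurable M"
    using si measurable_F unfolding simple_integrand_def by blast
  show ?thesis
    unfolding simple_process_def case_prod_beta
  proof (intro borel_measurable_sum borel_measurable_scaleR)
    fix i assume "i \<in> {..<k}"
    then have [measurable]: "\<xi> i \<in> borel_measurable M" using \<xi> by simp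
    show "(\<lambda>x. \<xi> i (snd x)) \<in> borel_measurable (borel \<Otimes>\<^sub>M M)" by measurable
    show "(\<lambda>x. indicator {p i<..p (Suc i)} (fst x) :: real) \<in> borel_measurable (borel \<Otimes>\<^sub>M M)" by measurable
  qed
qed

lemma simple_error_measurable:
  fixes \<xi> :: "nat \<Rightarrow> 'w \<Rightarrow> real^'m^'n"
  assumes si: "simple_integrand M F a b k p \<xi>" and g: "progressive F a g" "a \<le> b"
  shows "(\<lambda>\<omega>. sq_int a b (\<lambda>r. simple_process k p \<xi> r \<omega> - g r \<omega>)) \<in> borel_measurable M"
proof -
  have [measurable]: "(\<lambda>(r, \<omega>). indicator {a..b} r *\<^sub>R g r \<omega>) \<in> borel_measurable (borel \<Otimes>\<^sub>M M)"
    using g by (rule progressive_measurable)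
  note simple_process_measurable[OF si, measurable]
  have "(\<lambda>\<omega>. sq_int a b (\<lambda>r. simple_process k p \<xi> r \<omega> - indicator {a..b} r *\<^sub>R g r \<omega>))
     \<in> borel_measurable M"
    by measurable
  also have "(\<lambda>\<omega>. sq_int a b (\<lambda>r. simple_process k p \<xi> r \<omega> - indicator {a..b} r *\<^sub>R g r \<omega>)) =
     (\<lambda>\<omega>. sq_int a b (\<lambda>r. simple_process k p \<xi> r \<omega> - g r \<omega>))"
    by (intro ext nn_integral_cong) (auto simp: indicator_def)
  finally show ?thesis .
qed

text \<open>Fatou arguments need almost sure convergence, and they need it for the integrands and
  the integrals along the same subsequence; hence both errors are put into one exceptional
  event.\<close>

lemma ito_integral_AE_approximation:
  fixes g :: "real \<Rightarrow> 'w \<Rightarrow> real^'m^'n"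
  assumes ito: "is_ito_integral M F B a b g I" and ab: "0 \<le> a" "a \<le> b"
  obtains k p \<xi> where "\<And>n. simple_integrand M F a b (k n) (p n) (\<xi> n)"
    "AE \<omega> in M. (\<lambda>n. sq_int a b (\<lambda>r. simple_process (k n) (p n) (\<xi> n) r \<omega> - g r \<omega>)) \<longlonglongrightarrow> 0"
    "AE \<omega> in M. (\<lambda>n. simple_ito_integral B (k n) (p n) (\<xi> n) \<omega>) \<longlonglongrightarrow> I \<omega>"
proof -
  have prog: "progressive F a g" and [measurable]: "I \<in> borel_measurable M"
    using ito by (auto simp: is_ito_integral_def)
  obtain k p \<xi> where *: "\<forall>n::nat. simple_integrand M F a b (k n) (p n) (\<xi> n)"
    "\<forall>\<epsilon>>0. (\<lambda>n. measure M {\<omega> \<in> space M. ennreal \<epsilon> <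
           sq_int a b (\<lambda>r. simple_process (k n) (p n) (\<xi> n) r \<omega> - g r \<omega>)})
           \<longlonglongrightarrow> 0"
    "\<forall>\<epsilon>>0. (\<lambda>n. measure M {\<omega> \<in> space M. \<epsilon> <
           norm (simple_ito_integral B (k n) (p n) (\<xi> n) \<omega> - I \<omega>)}) \<longlonglongrightarrow> 0"
    using ito unfolding is_ito_integral_def by (elim conjE exE) (rule that; assumption)
  note si = *(1)[rule_format] and d0 = *(2)[rule_format] and i0 = *(3)[rule_format]
  define d where "d n \<omega> = sq_int a b (\<lambda>r. simple_process (k n) (p n) (\<xi> n) r \<omega> - g r \<omega>)" for n \<omega>
  define J where "J n \<omega> = simple_ito_integral B (k n) (p n) (\<xi> n) \<omega>" for n \<omega>
  have d [measurable]: "d n \<in> borel_measurable M" for n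
    unfolding d_def using simple_error_measurable[OF si prog ab(2)] .
  have J [measurable]: "J n \<in> borel_measurable M" for n
    unfolding J_def using simple_ito_integral_moments(1)[OF si ab(1)] .
  define e :: "nat \<Rightarrow> real" where "e j = inverse (real (Suc j))" for j
  have e: "e j > 0" for j by (simp add: e_def)
  \<comment> \<open>At least one of the two errors exceeds \<open>1 / (j + 1)\<close>. Avoiding
    \<open>A j (s j)\<close> for all large \<open>j\<close> therefore forces both errors to
    0.\<close>
  define A where "A j n = {\<omega> \<in> space M. ennreal (e j) < d n \<omega>} \<union> {\<omega> \<in> space M. e j < norm (J n \<omega> - I \<omega>)}" for j n
  have "\<exists>s. AE x in M. eventually (\<lambda>j. x \<notin> A j (s j)) sequentially"
  proof (rule almost_surely_avoiding_subsequence)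
    show "A j n \<in> sets M" for j n unfolding A_def by measurable
    show "(\<lambda>n. measure M (A j n)) \<longlonglongrightarrow> 0" for j
    proof (rule tendsto_sandwich[OF _ _ tendsto_const])
      show "(\<lambda>n. measure M {\<omega> \<in> space M. ennreal (e j) < d n \<omega>} + measure M {\<omega> \<in> space M. e j < norm (J n \<omega> - I \<omega>)}) \<longlonglongrightarrow> 0"
        using tendsto_add[OF d0[OF e] i0[OF e]] by (simp add: d_def J_def)
      show "\<forall>\<^sub>F n in sequentially. measure M (A j n) \<le>
         measure M {\<omega> \<in> space M. ennreal (e j) < d n \<omega>} + measure M {\<omega> \<in> space M. e j < norm (J n \<omega> - I \<omega>)}"
        unfolding A_def by (intro always_eventually allI measure_Un_le) measurable
    qed simp
  qed
  then obtain s where s: "AE \<omega> in M. eventually (\<lambda>j. \<omega> \<notin> A j (s j)) sequentially" by blast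
  have e0: "e \<longlonglongrightarrow> 0" unfolding e_def by (rule LIMSEQ_inverse_real_of_nat)
  show thesis
  proof (rule that[of "\<lambda>j. k (s j)" "\<lambda>j. p (s j)" "\<lambda>j. \<xi> (s j)"])
    show "simple_integrand M F a b (k (s n)) (p (s n)) (\<xi> (s n))" for n by (rule si)
    show "AE \<omega> in M. (\<lambda>n. sq_int a b (\<lambda>r. simple_process (k (s n)) (p (s n)) (\<xi> (s n)) r \<omega> - g r \<omega>)) \<longlonglongrightarrow> 0"
      using s AE_space
    proof eventually_elim
      case (elim \<omega>)
      have "(\<lambda>n. d (s n) \<omega>) \<longlonglongrightarrow> 0"
      proof (rule tendsto_sandwich[OF _ _ tendsto_const])
        show "\<forall>\<^sub>F n in sequentially. d (s n) \<omega> \<le> ennreal (e n)"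
          using elim(1) by eventually_elim (use elim(2) in \<open>auto simp: A_def not_less\<close>)
        show "(\<lambda>n. ennreal (e n)) \<longlonglongrightarrow> 0" using tendsto_ennrealI[OF e0] by simp
      qed simp
      then show ?case by (simp add: d_def)
    qed
    show "AE \<omega> in M. (\<lambda>n. simple_ito_integral B (k (s n)) (p (s n)) (\<xi> (s n)) \<omega>) \<longlonglongrightarrow> I \<omega>"
      using s AE_space
    proof eventually_elim
      case (elim \<omega>)
      have "(\<lambda>n. J (s n) \<omega> - I \<omega>) \<longlonglongrightarrow> 0"
      proof (rule Lim_null_comparison[OF _ e0])
        show "\<forall>\<^sub>F n in sequentially. norm (J (s n) \<omega> - I \<omega>) \<le> e n"
          using elim(1) by eventually_elim (use elim(2) in \<open>auto simp: A_def not_less\<close>)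
      qed
      then show ?case by (simp add: J_def LIM_zero_iff)
    qed
  qed
qed

text \<open>
  The factor 2 comes from \<open>\<bar>\<phi>\<bar>\<^sup>2 \<le> 2 \<bar>g\<bar>\<^sup>2 + 2 \<bar>\<phi> - g\<bar>\<^sup>2\<close>. It is harmless below, where only
  the order of magnitude of the error terms matters.
\<close>

lemma energy_le:
  fixes \<xi> :: "nat \<Rightarrow> 'w \<Rightarrow> real^'m^'n"
  assumes si: "simple_integrand M F a b k p \<xi>" and g: "progressive F a g" "a \<le> b" and \<omega>: "\<omega> \<in> space M"
  shows "ennreal (energy k p \<xi> \<omega>) \<le> 2 * sq_int a b (\<lambda>r. g r \<omega>) +
     2 * sq_int a b (\<lambda>r. simple_process k p \<xi> r \<omega> - g r \<omega>)"
proof -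
  \<comment> \<open>Measurability of a path of \<open>g\<close> is available only on
    \<open>{a..b}\<close>, so the computation is carried out with the path extended by 0.\<close>
  let ?g = "\<lambda>r. indicator {a..b} r *\<^sub>R g r \<omega>"
  have [measurable]: "?g \<in> borel_measurable borel"
    using measurable_compose[OF measurable_Pair2' progressive_measurable[OF g], OF \<omega>] by simp
  have [measurable]: "(\<lambda>r. simple_process k p \<xi> r \<omega>) \<in> borel_measurable borel"
    unfolding simple_process_def by measurable
  have sq: "(norm x)\<^sup>2 \<le> 2 * (norm y)\<^sup>2 + 2 * (norm (x - y))\<^sup>2" for x y :: "real^'m^'n"
    using norm_square_triangle[of y "x - y"] by simp
  have "ennreal (energy k p \<xi> \<omega>) = sq_int a b (\<lambda>r. simple_process k p \<xi> r \<omega>)"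
    using nn_integral_simple_process[OF si] by simp
  also have "\<dots> \<le> (\<integral>\<^sup>+r. 2 * (ennreal ((norm (?g r))\<^sup>2) * indicator {a..b} r) +
      2 * (ennreal ((norm (simple_process k p \<xi> r \<omega> - ?g r))\<^sup>2) * indicator {a..b} r) \<partial>lborel)"
  proof (rule nn_integral_mono)
    fix r
    have "ennreal ((norm (simple_process k p \<xi> r \<omega>))\<^sup>2) \<le>
        ennreal (2 * (norm (?g r))\<^sup>2 + 2 * (norm (simple_process k p \<xi> r \<omega> - ?g r))\<^sup>2)"
      by (intro ennreal_leI sq)
    also have "\<dots> = 2 * ennreal ((norm (?g r))\<^sup>2) + 2 * ennreal ((norm (simple_process k p \<xi> r \<omega> - ?g r))\<^sup>2)"
      by (simp add: ennreal_plus ennreal_mult)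
    finally show "ennreal ((norm (simple_process k p \<xi> r \<omega>))\<^sup>2) * indicator {a..b} r \<le>
      2 * (ennreal ((norm (?g r))\<^sup>2) * indicator {a..b} r) +
      2 * (ennreal ((norm (simple_process k p \<xi> r \<omega> - ?g r))\<^sup>2) * indicator {a..b} r)"
      by (cases "r \<in> {a..b}") auto
  qed
  also have "\<dots> = 2 * sq_int a b ?g +
     2 * sq_int a b (\<lambda>r. simple_process k p \<xi> r \<omega> - ?g r)"
  proof -
    have m: "(\<lambda>r. ennreal ((norm (?g r))\<^sup>2) * indicator {a..b} r) \<in> borel_measurable lborel"
      "(\<lambda>r. ennreal ((norm (simple_process k p \<xi> r \<omega> - ?g r))\<^sup>2) * indicator {a..b} r) \<in> borel_measurable lborel"
      by measurable
    note m2 = borel_measurable_times_ennreal[OF borel_measurable_const m(1), of 2]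
      borel_measurable_times_ennreal[OF borel_measurable_const m(2), of 2]
    show ?thesis by (simp only: nn_integral_add[OF m2] nn_integral_cmult[OF m(1)] nn_integral_cmult[OF m(2)])
  qed
  also have "sq_int a b ?g = sq_int a b (\<lambda>r. g r \<omega>)"
    by (intro nn_integral_cong) (auto simp: indicator_def)
  also have "sq_int a b (\<lambda>r. simple_process k p \<xi> r \<omega> - ?g r) =
     sq_int a b (\<lambda>r. simple_process k p \<xi> r \<omega> - g r \<omega>)"
    by (intro nn_integral_cong) (auto simp: indicator_def)
  finally show ?thesis .
qed


text \<open>By the isometry the second moment is the mean energy of the truncation, which is at most
  both \<open>C\<close> and the untruncated energy. Splitting the minimum keeps the cutoff in both
  summands: in the first it gives the localized bound, in the second it makes the approximation
  error vanish in mean.\<close>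

lemma truncated_ito_integral_bound:
  fixes \<xi> :: "nat \<Rightarrow> 'w \<Rightarrow> real^'m^'n"
  assumes si: "simple_integrand M F a b k p \<xi>" and g: "progressive F a g" "0 \<le> a" "a \<le> b" and C: "0 \<le> C"
  shows "(\<integral>\<^sup>+\<omega>. ennreal ((norm (simple_ito_integral B k p (truncate_energy C p \<xi>) \<omega>))\<^sup>2) \<partial>M) \<le>
    (\<integral>\<^sup>+\<omega>. min (ennreal C) (2 * sq_int a b (\<lambda>r. g r \<omega>)) \<partial>M) +
    (\<integral>\<^sup>+\<omega>. min (ennreal C) (2 * sq_int a b (\<lambda>r. simple_process k p \<xi> r \<omega> - g r \<omega>)) \<partial>M)"
proof -
  let ?\<xi> = "truncate_energy C p \<xi>"
  define G where "G \<omega> = sq_int a b (\<lambda>r. g r \<omega>)" for \<omega>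
  define d where "d \<omega> = sq_int a b (\<lambda>r. simple_process k p \<xi> r \<omega> - g r \<omega>)" for \<omega>
  have [measurable]: "G \<in> borel_measurable M"
    unfolding G_def using g(1,3) by (rule progressive_square_integral_measurable)
  have [measurable]: "d \<in> borel_measurable M"
    unfolding d_def using si g(1,3) by (rule simple_error_measurable)
  have p: "\<And>i. i < k \<Longrightarrow> p i \<le> p (Suc i)" using si by (auto simp: simple_integrand_def)
  have si': "simple_integrand M F a b k p ?\<xi>" using si by (rule simple_integrand_truncate)
  note m = simple_ito_integral_moments[OF si' g(2), folded energy_def]
  have \<xi>: "\<And>i. i < k \<Longrightarrow> ?\<xi> i \<in> borel_measurable M"
    using si' measurable_F unfolding simple_integrand_def by blast
  have e0: "0 \<le> energy k p ?\<xi> \<omega>" for \<omega>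
    unfolding energy_def using p by (intro sum_nonneg) auto
  have eI: "integrable M (energy k p ?\<xi>)"
  proof (rule integrable_const_bound[of _ C])
    show "AE \<omega> in M. norm (energy k p ?\<xi> \<omega>) \<le> C"
      using energy_truncate_le[of k p C \<xi>, OF p C] e0 by (intro AE_I2) simp
    show "energy k p ?\<xi> \<in> borel_measurable M"
      unfolding energy_def[abs_def]
    proof (intro borel_measurable_sum)
      fix i assume "i \<in> {..<k}"
      then have "?\<xi> i \<in> borel_measurable M" using \<xi> by simp
      then show "(\<lambda>\<omega>. (p (Suc i) - p i) * (norm (?\<xi> i \<omega>))\<^sup>2) \<in> borel_measurable M" by simp
    qed
  qed
  have "(\<integral>\<^sup>+\<omega>. ennreal ((norm (simple_ito_integral B k p ?\<xi> \<omega>))\<^sup>2) \<partial>M) =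
      ennreal (expectation (\<lambda>\<omega>. (norm (simple_ito_integral B k p ?\<xi> \<omega>))\<^sup>2))"
    using m(4) by (intro nn_integral_eq_integral) auto
  also have "\<dots> = (\<integral>\<^sup>+\<omega>. ennreal (energy k p ?\<xi> \<omega>) \<partial>M)"
    unfolding m(5) using eI e0 by (intro nn_integral_eq_integral[symmetric]) auto
  also have "\<dots> \<le> (\<integral>\<^sup>+\<omega>. min (ennreal C) (2 * G \<omega>) + min (ennreal C) (2 * d \<omega>) \<partial>M)"
  proof (rule nn_integral_mono)
    fix \<omega> assume \<omega>: "\<omega> \<in> space M"
    have "ennreal (energy k p ?\<xi> \<omega>) \<le> min (ennreal C) (ennreal (energy k p \<xi> \<omega>))"
      using energy_truncate_le[of k p C \<xi>, OF p C] by (auto intro: ennreal_leI)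
    also have "\<dots> \<le> min (ennreal C) (2 * G \<omega> + 2 * d \<omega>)"
      using energy_le[OF si g(1,3) \<omega>] unfolding G_def d_def by (intro min.mono order_refl)
    also have "\<dots> \<le> min (ennreal C) (2 * G \<omega>) + min (ennreal C) (2 * d \<omega>)"
      by (simp add: min_def add_increasing add_increasing2)
    finally show "ennreal (energy k p ?\<xi> \<omega>) \<le> min (ennreal C) (2 * G \<omega>) + min (ennreal C) (2 * d \<omega>)" .
  qed
  also have "\<dots> = (\<integral>\<^sup>+\<omega>. min (ennreal C) (2 * G \<omega>) \<partial>M) + (\<integral>\<^sup>+\<omega>. min (ennreal C) (2 * d \<omega>) \<partial>M)"
    by (intro nn_integral_add) measurable
  finally show ?thesis unfolding G_def d_def .
qed

text \<open>The cutoff \<open>C\<close> itself serves as the dominating function, so almost sure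
  convergence is enough.\<close>

lemma truncated_error_tendsto:
  fixes d :: "nat \<Rightarrow> 'w \<Rightarrow> ennreal"
  assumes [measurable]: "\<And>n. d n \<in> borel_measurable M" and "AE \<omega> in M. (\<lambda>n. d n \<omega>) \<longlonglongrightarrow> 0"
  shows "(\<lambda>n. \<integral>\<^sup>+\<omega>. min (ennreal C) (2 * d n \<omega>) \<partial>M) \<longlonglongrightarrow> 0"
proof -
  have "(\<lambda>n. \<integral>\<^sup>+\<omega>. min (ennreal C) (2 * d n \<omega>) \<partial>M) \<longlonglongrightarrow> (\<integral>\<^sup>+\<omega>. 0 \<partial>M)"
  proof (rule nn_integral_dominated_convergence[where w="\<lambda>_. ennreal C"])
    show "AE \<omega> in M. (\<lambda>n. min (ennreal C) (2 * d n \<omega>)) \<longlonglongrightarrow> 0"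
      using assms(2)
    proof eventually_elim
      case (elim \<omega>)
      have "(\<lambda>n. 2 * d n \<omega>) \<longlonglongrightarrow> 2 * 0"
        by (intro ennreal_tendsto_cmult elim) simp
      then have "(\<lambda>n. min (ennreal C) (2 * d n \<omega>)) \<longlonglongrightarrow> min (ennreal C) 0"
        by (intro tendsto_intros) simp
      then show ?case by simp
    qed
  qed (auto simp: emeasure_space_1)
  then show ?thesis by simp
qed

text \<open>The energy of the approximants is at most \<open>2 * G\<close> plus an error that tends
  to 0. Where \<open>2 * G < C\<close> holds strictly, it is eventually below \<open>C\<close>, so
  truncation eventually changes nothing and the truncated integrals converge to \<open>I\<close>.
  Elsewhere the left side is 0, and Fatou's lemma concludes.\<close>

lemma ito_integral_localized_bound:
  fixes g :: "real \<Rightarrow> 'w \<Rightarrow> real^'m^'n"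
  assumes ito: "is_ito_integral M F B a b g I" and ab: "0 \<le> a" "a \<le> b" and C: "0 \<le> C"
  defines "G \<equiv> \<lambda>\<omega>. sq_int a b (\<lambda>r. g r \<omega>)"
  shows "(\<integral>\<^sup>+\<omega>. ennreal ((norm (I \<omega>))\<^sup>2) * indicator {\<omega>. 2 * G \<omega> < ennreal C} \<omega> \<partial>M) \<le>
    (\<integral>\<^sup>+\<omega>. min (ennreal C) (2 * G \<omega>) \<partial>M)"
proof -
  have prog: "progressive F a g" using ito by (simp add: is_ito_integral_def)
  obtain k p \<xi> where si: "\<And>n. simple_integrand M F a b (k n) (p n) (\<xi> n)"
    and d0: "AE \<omega> in M. (\<lambda>n. sq_int a b (\<lambda>r. simple_process (k n) (p n) (\<xi> n) r \<omega> - g r \<omega>)) \<longlonglongrightarrow> 0"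
    and i0: "AE \<omega> in M. (\<lambda>n. simple_ito_integral B (k n) (p n) (\<xi> n) \<omega>) \<longlonglongrightarrow> I \<omega>"
    by (rule ito_integral_AE_approximation[OF ito ab]) (rule that; assumption)
  define d where "d n \<omega> = sq_int a b (\<lambda>r. simple_process (k n) (p n) (\<xi> n) r \<omega> - g r \<omega>)" for n \<omega>
  define \<psi> where "\<psi> n \<omega> = simple_ito_integral B (k n) (p n) (truncate_energy C (p n) (\<xi> n)) \<omega>" for n \<omega>
  have [measurable]: "d n \<in> borel_measurable M" for n
    unfolding d_def using simple_error_measurable[OF si prog ab(2)] .
  have [measurable]: "\<psi> n \<in> borel_measurable M" for n
    unfolding \<psi>_def using simple_ito_integral_moments(1)[OF simple_integrand_truncate[OF si] ab(1)] .
  have p: "\<And>n i. i < k n \<Longrightarrow> p n i \<le> p n (Suc i)" using si by (auto simp: simple_integrand_def)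
  show ?thesis
  proof (rule nn_integral_fatou_bound[where f'="\<lambda>n \<omega>. ennreal ((norm (\<psi> n \<omega>))\<^sup>2)"
        and c="\<lambda>n. (\<integral>\<^sup>+\<omega>. min (ennreal C) (2 * G \<omega>) \<partial>M) + (\<integral>\<^sup>+\<omega>. min (ennreal C) (2 * d n \<omega>) \<partial>M)"])
    show "(\<lambda>\<omega>. ennreal ((norm (\<psi> n \<omega>))\<^sup>2)) \<in> borel_measurable M" for n by measurable
    show "(\<integral>\<^sup>+\<omega>. ennreal ((norm (\<psi> n \<omega>))\<^sup>2) \<partial>M) \<le>
      (\<integral>\<^sup>+\<omega>. min (ennreal C) (2 * G \<omega>) \<partial>M) + (\<integral>\<^sup>+\<omega>. min (ennreal C) (2 * d n \<omega>) \<partial>M)" for n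
      unfolding \<psi>_def G_def d_def by (rule truncated_ito_integral_bound[OF si prog ab C])
    have "(\<lambda>n. \<integral>\<^sup>+\<omega>. min (ennreal C) (2 * d n \<omega>) \<partial>M) \<longlonglongrightarrow> 0"
      using d0 by (intro truncated_error_tendsto) (auto simp: d_def[symmetric])
    from tendsto_add[OF tendsto_const this]
    show "(\<lambda>n. (\<integral>\<^sup>+\<omega>. min (ennreal C) (2 * G \<omega>) \<partial>M) + (\<integral>\<^sup>+\<omega>. min (ennreal C) (2 * d n \<omega>) \<partial>M)) \<longlonglongrightarrow>
      (\<integral>\<^sup>+\<omega>. min (ennreal C) (2 * G \<omega>) \<partial>M)" by simp
    show "AE \<omega> in M. ennreal ((norm (I \<omega>))\<^sup>2) * indicator {\<omega>. 2 * G \<omega> < ennreal C} \<omega> \<le> liminf (\<lambda>n. ennreal ((norm (\<psi> n \<omega>))\<^sup>2))"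
      using d0 i0 AE_space
    proof eventually_elim
      case (elim \<omega>)
      show ?case
      proof (cases "2 * G \<omega> < ennreal C")
        case True
        have "(\<lambda>n. 2 * d n \<omega>) \<longlonglongrightarrow> 2 * 0"
          using elim(1) by (intro ennreal_tendsto_cmult) (auto simp: d_def)
        from tendsto_add[OF tendsto_const[of "2 * G \<omega>"] this]
        have "(\<lambda>n. 2 * G \<omega> + 2 * d n \<omega>) \<longlonglongrightarrow> 2 * G \<omega>" by simp
        from order_tendstoD(2)[OF this True]
        have "\<forall>\<^sub>F n in sequentially. \<psi> n \<omega> = simple_ito_integral B (k n) (p n) (\<xi> n) \<omega>"
        proof eventually_elim
          case (elim n)
          have "ennreal (energy (k n) (p n) (\<xi> n) \<omega>) \<le> 2 * G \<omega> + 2 * d n \<omega>"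
            unfolding G_def d_def using energy_le[OF si prog ab(2) \<open>\<omega> \<in> space M\<close>] .
          also note elim
          finally have "energy (k n) (p n) (\<xi> n) \<omega> \<le> C"
            by (meson ennreal_leI leD le_cases)
          then show ?case unfolding \<psi>_def using p by (intro simple_ito_integral_truncate)
        qed
        then have "(\<lambda>n. \<psi> n \<omega>) \<longlonglongrightarrow> I \<omega>"
          using elim(2) by (simp add: tendsto_cong)
        then have "(\<lambda>n. ennreal ((norm (\<psi> n \<omega>))\<^sup>2)) \<longlonglongrightarrow> ennreal ((norm (I \<omega>))\<^sup>2)"
          by (intro tendsto_ennrealI tendsto_intros)
        then have "liminf (\<lambda>n. ennreal ((norm (\<psi> n \<omega>))\<^sup>2)) = ennreal ((norm (I \<omega>))\<^sup>2)"
          by (intro lim_imp_Liminf) auto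
        then show ?thesis using True by simp
      qed simp
    qed
  qed
qed

text \<open>The localized bound along integer cutoffs \<open>C = n\<close>: since \<open>G\<close>
  is almost surely finite, the indicators are eventually 1, and Fatou's lemma removes them.\<close>

lemma ito_integral_bound:
  fixes g :: "real \<Rightarrow> 'w \<Rightarrow> real^'m^'n"
  assumes ito: "is_ito_integral M F B a b g I" and ab: "0 \<le> a" "a \<le> b"
  defines "G \<equiv> \<lambda>\<omega>. sq_int a b (\<lambda>r. g r \<omega>)"
  assumes fin: "(\<integral>\<^sup>+\<omega>. G \<omega> \<partial>M) < \<infinity>"
  shows "(\<integral>\<^sup>+\<omega>. ennreal ((norm (I \<omega>))\<^sup>2) \<partial>M) \<le> 2 * (\<integral>\<^sup>+\<omega>. G \<omega> \<partial>M)"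
proof -
  have prog: "progressive F a g" and [measurable]: "I \<in> borel_measurable M"
    using ito by (simp_all add: is_ito_integral_def)
  have G [measurable]: "G \<in> borel_measurable M"
    unfolding G_def using prog ab(2) by (rule progressive_square_integral_measurable)
  show ?thesis
  proof (rule nn_integral_fatou_bound[where
        f'="\<lambda>n \<omega>. ennreal ((norm (I \<omega>))\<^sup>2) * indicator {\<omega>. 2 * G \<omega> < ennreal (real n)} \<omega>"
        and c="\<lambda>n. 2 * (\<integral>\<^sup>+\<omega>. G \<omega> \<partial>M)"])
    have "Measurable.pred M (\<lambda>\<omega>. 2 * G \<omega> < ennreal (real n))" for n by measurable
    then show "(\<lambda>\<omega>. ennreal ((norm (I \<omega>))\<^sup>2) * indicator {\<omega>. 2 * G \<omega> < ennreal (real n)} \<omega>) \<in> borel_measurable M" for n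
      by measurable
    show "(\<integral>\<^sup>+\<omega>. ennreal ((norm (I \<omega>))\<^sup>2) * indicator {\<omega>. 2 * G \<omega> < ennreal (real n)} \<omega> \<partial>M) \<le> 2 * (\<integral>\<^sup>+\<omega>. G \<omega> \<partial>M)" for n
    proof -
      have "(\<integral>\<^sup>+\<omega>. ennreal ((norm (I \<omega>))\<^sup>2) * indicator {\<omega>. 2 * G \<omega> < ennreal (real n)} \<omega> \<partial>M) \<le>
          (\<integral>\<^sup>+\<omega>. min (ennreal (real n)) (2 * G \<omega>) \<partial>M)"
        unfolding G_def by (rule ito_integral_localized_bound[OF ito ab]) simp
      also have "\<dots> \<le> (\<integral>\<^sup>+\<omega>. 2 * G \<omega> \<partial>M)" by (intro nn_integral_mono) simp
      also have "\<dots> = 2 * (\<integral>\<^sup>+\<omega>. G \<omega> \<partial>M)" by (rule nn_integral_cmult[OF G])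
      finally show ?thesis .
    qed
    have "AE \<omega> in M. G \<omega> \<noteq> \<infinity>" using fin by (intro nn_integral_PInf_AE[OF G]) simp
    then show "AE \<omega> in M. ennreal ((norm (I \<omega>))\<^sup>2) \<le>
      liminf (\<lambda>n. ennreal ((norm (I \<omega>))\<^sup>2) * indicator {\<omega>. 2 * G \<omega> < ennreal (real n)} \<omega>)"
    proof eventually_elim
      case (elim \<omega>)
      then have "2 * G \<omega> < top" by (simp add: ennreal_mult_less_top less_top)
      then obtain N where N: "2 * G \<omega> < of_nat N" using ennreal_Ex_less_of_nat by blast
      have "\<forall>\<^sub>F n in sequentially. ennreal ((norm (I \<omega>))\<^sup>2) \<le>
         ennreal ((norm (I \<omega>))\<^sup>2) * indicator {\<omega>. 2 * G \<omega> < ennreal (real n)} \<omega>"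
        using eventually_ge_at_top[of N]
      proof eventually_elim
        case (elim n)
        then have "2 * G \<omega> < of_nat n" using N by (meson of_nat_mono order_less_le_trans)
        then show ?case by (simp add: ennreal_of_nat_eq_real_of_nat)
      qed
      then show ?case by (rule Liminf_bounded)
    qed
  qed simp
qed

text \<open>Restricting \<open>I\<close> to the event \<open>2 * G < C\<close> would destroy the
  zero mean. Instead \<open>I\<close> is an almost sure limit of truncated simple integrals with
  cutoffs tending to infinity; each has mean 0, and together they are bounded in L2.\<close>

lemma ito_integral_mean_zero:
  fixes g :: "real \<Rightarrow> 'w \<Rightarrow> real^'m^'n"
  assumes ito: "is_ito_integral M F B a b g I" and ab: "0 \<le> a" "a \<le> b"
  defines "G \<equiv> \<lambda>\<omega>. sq_int a b (\<lambda>r. g r \<omega>)"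
  assumes fin: "(\<integral>\<^sup>+\<omega>. G \<omega> \<partial>M) < \<infinity>"
  shows "integrable M (\<lambda>\<omega>. I \<omega> $ i)" "expectation (\<lambda>\<omega>. I \<omega> $ i) = 0"
proof -
  have prog: "progressive F a g" and [measurable]: "I \<in> borel_measurable M"
    using ito by (simp_all add: is_ito_integral_def)
  have G [measurable]: "G \<in> borel_measurable M"
    unfolding G_def using prog ab(2) by (rule progressive_square_integral_measurable)
  obtain k p \<xi> where si: "\<And>n. simple_integrand M F a b (k n) (p n) (\<xi> n)"
    and d0: "AE \<omega> in M. (\<lambda>n. sq_int a b (\<lambda>r. simple_process (k n) (p n) (\<xi> n) r \<omega> - g r \<omega>)) \<longlonglongrightarrow> 0"
    and i0: "AE \<omega> in M. (\<lambda>n. simple_ito_integral B (k n) (p n) (\<xi> n) \<omega>) \<longlonglongrightarrow> I \<omega>"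
    by (rule ito_integral_AE_approximation[OF ito ab]) (rule that; assumption)
  define d where "d n \<omega> = sq_int a b (\<lambda>r. simple_process (k n) (p n) (\<xi> n) r \<omega> - g r \<omega>)" for n \<omega>
  have d [measurable]: "d n \<in> borel_measurable M" for n
    unfolding d_def using simple_error_measurable[OF si prog ab(2)] .
  have d0': "AE \<omega> in M. (\<lambda>n. d n \<omega>) \<longlonglongrightarrow> 0" using d0 by (simp add: d_def)
  have p: "\<And>n i. i < k n \<Longrightarrow> p n i \<le> p n (Suc i)" using si by (auto simp: simple_integrand_def)
  \<comment> \<open>Diagonal choice: for cutoff \<open>c\<close> an approximant is taken so late
    that its truncated error has mean below 1, which keeps the second moments bounded uniformly. The
    condition \<open>n \<ge> c\<close> preserves convergence along the chosen indices.\<close>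
  have "\<exists>n\<ge>c. (\<integral>\<^sup>+\<omega>. min (ennreal (real c)) (2 * d n \<omega>) \<partial>M) < 1" for c :: nat
    using eventually_happens[OF eventually_conj[OF eventually_ge_at_top[of c]
          order_tendstoD(2)[OF truncated_error_tendsto[OF d d0', of "real c"], of 1]]] by auto
  then obtain s where s: "\<And>c. s c \<ge> c"
    and s1: "\<And>c. (\<integral>\<^sup>+\<omega>. min (ennreal (real c)) (2 * d (s c) \<omega>) \<partial>M) < 1" by metis
  have s_top: "filterlim s at_top sequentially"
    using s by (intro filterlim_at_top_mono[OF filterlim_ident]) auto
  define \<psi> where "\<psi> c \<omega> = simple_ito_integral B (k (s c)) (p (s c)) (truncate_energy (real c) (p (s c)) (\<xi> (s c))) \<omega>" for c \<omega>
  note m = simple_ito_integral_moments[OF simple_integrand_truncate[OF si] ab(1)]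
  have [measurable]: "\<psi> c \<in> borel_measurable M" for c unfolding \<psi>_def by (rule m(1))
  have conv: "AE \<omega> in M. (\<lambda>c. \<psi> c \<omega>) \<longlonglongrightarrow> I \<omega>"
  proof -
    have "AE \<omega> in M. G \<omega> \<noteq> \<infinity>" using fin by (intro nn_integral_PInf_AE[OF G]) simp
    then show ?thesis using d0' i0 AE_space
    proof eventually_elim
      case (elim \<omega>)
      \<comment> \<open>The summand 2 absorbs twice the approximation error once that error is below
        1; cutoffs from \<open>N\<close> on then leave this path untouched.\<close>
      then have "2 * G \<omega> + 2 < top" by (simp add: ennreal_mult_less_top less_top)
      then obtain N where N: "2 * G \<omega> + 2 < of_nat N" using ennreal_Ex_less_of_nat by blast
      have "\<forall>\<^sub>F n in sequentially. d n \<omega> < 1" using order_tendstoD(2)[OF elim(2), of 1] by simp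
      then have "\<forall>\<^sub>F c in sequentially. d (s c) \<omega> < 1" using s_top by (rule eventually_compose_filterlim)
      then have "\<forall>\<^sub>F c in sequentially. \<psi> c \<omega> = simple_ito_integral B (k (s c)) (p (s c)) (\<xi> (s c)) \<omega>"
        using eventually_ge_at_top[of N]
      proof eventually_elim
        case (elim c)
        have "ennreal (energy (k (s c)) (p (s c)) (\<xi> (s c)) \<omega>) \<le> 2 * G \<omega> + 2 * d (s c) \<omega>"
          unfolding G_def d_def using energy_le[OF si prog ab(2) \<open>\<omega> \<in> space M\<close>] .
        also have "\<dots> \<le> 2 * G \<omega> + 2 * 1" using elim by (intro add_left_mono mult_left_mono) auto
        also have "\<dots> \<le> of_nat N" using N by simp
        also have "\<dots> \<le> of_nat c" using elim by (intro of_nat_mono)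
        finally have "energy (k (s c)) (p (s c)) (\<xi> (s c)) \<omega> \<le> real c"
          by (simp add: ennreal_of_nat_eq_real_of_nat)
        then show ?case unfolding \<psi>_def using p by (intro simple_ito_integral_truncate)
      qed
      moreover have "(\<lambda>c. simple_ito_integral B (k (s c)) (p (s c)) (\<xi> (s c)) \<omega>) \<longlonglongrightarrow> I \<omega>"
        using elim(3) s_top by (rule filterlim_compose)
      ultimately show ?case by (simp add: tendsto_cong)
    qed
  qed
  have bnd: "(\<integral>\<^sup>+\<omega>. ennreal ((\<psi> c \<omega> $ i)\<^sup>2) \<partial>M) \<le> ennreal (enn2real (2 * (\<integral>\<^sup>+\<omega>. G \<omega> \<partial>M) + 1))" for c
  proof -
    have "(\<integral>\<^sup>+\<omega>. ennreal ((\<psi> c \<omega> $ i)\<^sup>2) \<partial>M) \<le> (\<integral>\<^sup>+\<omega>. ennreal ((norm (\<psi> c \<omega>))\<^sup>2) \<partial>M)"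
    proof (intro nn_integral_mono ennreal_leI)
      fix \<omega> show "(\<psi> c \<omega> $ i)\<^sup>2 \<le> (norm (\<psi> c \<omega>))\<^sup>2"
        using power_mono[OF component_le_norm_cart[of "\<psi> c \<omega>" i], of 2] by simp
    qed
    also have "\<dots> \<le> (\<integral>\<^sup>+\<omega>. min (ennreal (real c)) (2 * G \<omega>) \<partial>M) + (\<integral>\<^sup>+\<omega>. min (ennreal (real c)) (2 * d (s c) \<omega>) \<partial>M)"
      unfolding \<psi>_def G_def d_def by (rule truncated_ito_integral_bound[OF si prog ab]) simp
    also have "\<dots> \<le> (\<integral>\<^sup>+\<omega>. 2 * G \<omega> \<partial>M) + 1"
      using s1[of c] by (intro add_mono nn_integral_mono) auto
    also have "\<dots> = 2 * (\<integral>\<^sup>+\<omega>. G \<omega> \<partial>M) + 1" by (simp add: nn_integral_cmult)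
    also have "\<dots> = ennreal (enn2real (2 * (\<integral>\<^sup>+\<omega>. G \<omega> \<partial>M) + 1))"
      using fin by (simp add: ennreal_mult_less_top)
    finally show ?thesis .
  qed
  have lim: "AE \<omega> in M. (\<lambda>c. \<psi> c \<omega> $ i) \<longlonglongrightarrow> I \<omega> $ i"
    using conv by eventually_elim (rule tendsto_vec_nth)
  have zero: "expectation (\<lambda>\<omega>. \<psi> c \<omega> $ i) = 0" for c unfolding \<psi>_def by (rule m(3))
  show "integrable M (\<lambda>\<omega>. I \<omega> $ i)" "expectation (\<lambda>\<omega>. I \<omega> $ i) = 0"
    using expectation_zero_limit[OF _ _ lim bnd zero] by auto
qed

end

section \<open>Subtracting a constant matrix from the integrand\<close>

lemma sum_indicator_partition:
  assumes "\<And>i. i < k \<Longrightarrow> p i \<le> p (Suc i)"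
  shows "p 0 \<le> p k \<and> (\<Sum>i<k. indicator {p i<..p (Suc i)} r) = (indicator {p 0<..p k} (r::real) :: real)"
  using assms
proof (induction k)
  case (Suc k)
  then have "p 0 \<le> p k" "p k \<le> p (Suc k)"
    "(\<Sum>i<k. indicator {p i<..p (Suc i)} r) = (indicator {p 0<..p k} r :: real)" by auto
  then show ?case by (auto simp: indicator_def)
qed simp

text \<open>
  Subtracting a constant \<open>c\<close> from a simple integrand requires the partition to cover all of \<open>{a..b}\<close>.
\<close>

definition pad_partition :: "real \<Rightarrow> real \<Rightarrow> nat \<Rightarrow> (nat \<Rightarrow> real) \<Rightarrow> nat \<Rightarrow> real" where
  "pad_partition a b k p = case_nat a (\<lambda>i. if i \<le> k then p i else b)"

text \<open>Index 0 belongs to the added interval before \<open>p 0\<close>, index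
  \<open>k + 1\<close> to the one after \<open>p k\<close>. The original process is 0 on both,
  whence the value \<open>- c\<close>.\<close>

definition pad_values :: "nat \<Rightarrow> real^'m^'n \<Rightarrow> (nat \<Rightarrow> 'w \<Rightarrow> real^'m^'n) \<Rightarrow> nat \<Rightarrow> 'w \<Rightarrow> real^'m^'n" where
  "pad_values k c \<xi> = case_nat (\<lambda>_. - c) (\<lambda>i \<omega>. if i < k then \<xi> i \<omega> - c else - c)"

text \<open>The summand \<open>f\<close> is left arbitrary so that a single index shift serves both
  the simple process and its integral.\<close>

lemma sum_pad:
  "(\<Sum>i<Suc (Suc k). f (pad_partition a b k p i) (pad_partition a b k p (Suc i)) (pad_values k c \<xi> i \<omega>)) =
    f a (p 0) (- c) + (\<Sum>i<k. f (p i) (p (Suc i)) (\<xi> i \<omega> - c)) + f (p k) b (- c)"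
proof -
  have "(\<Sum>i<Suc (Suc k). f (pad_partition a b k p i) (pad_partition a b k p (Suc i)) (pad_values k c \<xi> i \<omega>)) =
     f a (p 0) (- c) + (\<Sum>i<Suc k. f (pad_partition a b k p (Suc i)) (pad_partition a b k p (Suc (Suc i))) (pad_values k c \<xi> (Suc i) \<omega>))"
    unfolding sum.lessThan_Suc_shift[of _ "Suc k"] by (simp add: pad_partition_def pad_values_def)
  also have "(\<Sum>i<Suc k. f (pad_partition a b k p (Suc i)) (pad_partition a b k p (Suc (Suc i))) (pad_values k c \<xi> (Suc i) \<omega>)) =
     (\<Sum>i<k. f (p i) (p (Suc i)) (\<xi> i \<omega> - c)) + f (p k) b (- c)"
    by (simp add: pad_partition_def pad_values_def)
  finally show ?thesis by (simp add: add.assoc)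
qed

lemma simple_process_pad:
  assumes "\<And>i. i < k \<Longrightarrow> p i \<le> p (Suc i)" "a \<le> p 0" "p k \<le> b"
  shows "simple_process (Suc (Suc k)) (pad_partition a b k p) (pad_values k c \<xi>) r \<omega> =
    simple_process k p \<xi> r \<omega> - indicator {a<..b} r *\<^sub>R c"
proof -
  have part: "p 0 \<le> p k" "(\<Sum>i<k. indicator {p i<..p (Suc i)} r) = (indicator {p 0<..p k} r :: real)"
    using sum_indicator_partition[of k p] assms(1) by auto
  have "simple_process (Suc (Suc k)) (pad_partition a b k p) (pad_values k c \<xi>) r \<omega> =
    - (indicator {a<..p 0} r *\<^sub>R c) + (\<Sum>i<k. indicator {p i<..p (Suc i)} r *\<^sub>R (\<xi> i \<omega> - c)) - indicator {p k<..b} r *\<^sub>R c"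
    unfolding simple_process_def sum_pad[of "\<lambda>x y z. indicator {x<..y} r *\<^sub>R z"] by simp
  also have "(\<Sum>i<k. indicator {p i<..p (Suc i)} r *\<^sub>R (\<xi> i \<omega> - c)) =
      simple_process k p \<xi> r \<omega> - (\<Sum>i<k. indicator {p i<..p (Suc i)} r) *\<^sub>R c"
    by (simp add: simple_process_def scaleR_diff_right sum_subtractf scaleR_sum_left)
  finally show ?thesis
    unfolding part(2) using part(1) assms(2,3) by (auto simp: indicator_def)
qed

lemma simple_ito_integral_pad:
  "simple_ito_integral B (Suc (Suc k)) (pad_partition a b k p) (pad_values k c \<xi>) \<omega> =
    simple_ito_integral B k p \<xi> \<omega> - c *v (B b \<omega> - B a \<omega>)"
proof -
  have "simple_ito_integral B (Suc (Suc k)) (pad_partition a b k p) (pad_values k c \<xi>) \<omega> =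
    (- c) *v (B (p 0) \<omega> - B a \<omega>) + (\<Sum>i<k. (\<xi> i \<omega> - c) *v (B (p (Suc i)) \<omega> - B (p i) \<omega>)) + (- c) *v (B b \<omega> - B (p k) \<omega>)"
    unfolding simple_ito_integral_def sum_pad[of "\<lambda>x y z. z *v (B y \<omega> - B x \<omega>)"] by simp
  also have "(\<Sum>i<k. (\<xi> i \<omega> - c) *v (B (p (Suc i)) \<omega> - B (p i) \<omega>)) =
      simple_ito_integral B k p \<xi> \<omega> - (\<Sum>i<k. c *v (B (p (Suc i)) \<omega> - B (p i) \<omega>))"
    by (simp add: simple_ito_integral_def matrix_vector_mult_diff_rdistrib sum_subtractf)
  also have "(\<Sum>i<k. c *v (B (p (Suc i)) \<omega> - B (p i) \<omega>)) = c *v B (p k) \<omega> - c *v B (p 0) \<omega>"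
    using sum_lessThan_telescope[of "\<lambda>i. c *v B (p i) \<omega>" k] by (simp add: matrix_vector_mult_diff_distrib)
  finally show ?thesis
    using matrix_vector_mult_diff_rdistrib[of 0 c] by (simp add: matrix_vector_mult_diff_distrib)
qed

text \<open>Padding and shifting the approximants leaves both errors unchanged: the constant cancels
  in the integrands, and the Brownian increment over the whole interval cancels in the integrals.
  The given convergences can therefore be reused verbatim.\<close>

lemma (in brownian_space) is_ito_integral_shift:
  fixes g :: "real \<Rightarrow> 'w \<Rightarrow> real^'m^'n"
  assumes ito: "is_ito_integral M F B a b g I" and ab: "0 \<le> a" "a \<le> b"
  shows "is_ito_integral M F B a b (\<lambda>r \<omega>. g r \<omega> - c) (\<lambda>\<omega>. I \<omega> - c *v (B b \<omega> - B a \<omega>))"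
proof -
  have prog: "progressive F a g" and int: "AE \<omega> in M. set_integrable lborel {a..b} (\<lambda>r. (norm (g r \<omega>))\<^sup>2)"
    and I [measurable]: "I \<in> borel_measurable M"
    using ito by (simp_all add: is_ito_integral_def)
  obtain k p \<xi> where *: "\<forall>n::nat. simple_integrand M F a b (k n) (p n) (\<xi> n)"
    "\<forall>\<epsilon>>0. (\<lambda>n. measure M {\<omega> \<in> space M. ennreal \<epsilon> <
           sq_int a b (\<lambda>r. simple_process (k n) (p n) (\<xi> n) r \<omega> - g r \<omega>)})
           \<longlonglongrightarrow> 0"
    "\<forall>\<epsilon>>0. (\<lambda>n. measure M {\<omega> \<in> space M. \<epsilon> <
           norm (simple_ito_integral B (k n) (p n) (\<xi> n) \<omega> - I \<omega>)}) \<longlonglongrightarrow> 0"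
    using ito unfolding is_ito_integral_def by (elim conjE exE) (rule that; assumption)
  note si = *(1)[rule_format]
  define k' where "k' n = Suc (Suc (k n))" for n
  define p' where "p' n = pad_partition a b (k n) (p n)" for n
  define \<xi>' where "\<xi>' n = pad_values (k n) c (\<xi> n)" for n
  have prog': "progressive F a (\<lambda>r \<omega>. g r \<omega> - c)"
    using prog by (rule progressive_diff_const)
  have int': "AE \<omega> in M. set_integrable lborel {a..b} (\<lambda>r. (norm (g r \<omega> - c))\<^sup>2)"
    using int AE_space
  proof eventually_elim
    case (elim \<omega>)
    have [measurable]: "(\<lambda>r. indicator {a..b} r *\<^sub>R (g r \<omega> - c)) \<in> borel_measurable borel"
      using measurable_compose[OF measurable_Pair2' progressive_measurable[OF prog' ab(2)], OF elim(2)] by simp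
    have "(\<lambda>r. (norm (indicator {a..b} r *\<^sub>R (g r \<omega> - c)))\<^sup>2) \<in> borel_measurable lborel" by measurable
    also have "(\<lambda>r. (norm (indicator {a..b} r *\<^sub>R (g r \<omega> - c)))\<^sup>2) = (\<lambda>r. indicator {a..b} r *\<^sub>R (norm (g r \<omega> - c))\<^sup>2)"
      by (auto simp: indicator_def)
    finally have m: "(\<lambda>r. indicator {a..b} r *\<^sub>R (norm (g r \<omega> - c))\<^sup>2) \<in> borel_measurable lborel" .
    have "set_integrable lborel {a..b} (\<lambda>r. 2 * (norm (g r \<omega>))\<^sup>2 + 2 * (norm c)\<^sup>2)"
      using elim(1) integrable_real_indicator[of "{a..b}" lborel]
      by (intro set_integral_add set_integrable_mult_right) (auto simp: set_integrable_def emeasure_lborel_Icc_eq)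
    then show ?case
      unfolding set_integrable_def
    proof (rule Bochner_Integration.integrable_bound[OF _ m], intro AE_I2)
      fix r
      show "norm (indicat_real {a..b} r *\<^sub>R (norm (g r \<omega> - c))\<^sup>2) \<le>
         norm (indicat_real {a..b} r *\<^sub>R (2 * (norm (g r \<omega>))\<^sup>2 + 2 * (norm c)\<^sup>2))"
        using norm_square_triangle[of "g r \<omega>" "- c"] by (simp add: indicator_def)
    qed
  qed
  have si': "simple_integrand M F a b (k' n) (p' n) (\<xi>' n)" for n
  proof -
    obtain C where C: "\<And>i \<omega>. i < k n \<Longrightarrow> \<omega> \<in> space M \<Longrightarrow> norm (\<xi> n i \<omega>) \<le> C"
      using si[of n] unfolding simple_integrand_def by metis
    have p: "a \<le> p n 0" "p n (k n) \<le> b" "\<And>i. i < k n \<Longrightarrow> p n i \<le> p n (Suc i)"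
      and m: "\<And>i. i < k n \<Longrightarrow> \<xi> n i \<in> borel_measurable (F (p n i))"
      using si[of n] unfolding simple_integrand_def by auto
    have "norm (\<xi>' n i \<omega>) \<le> max C 0 + norm c" if "\<omega> \<in> space M" for i \<omega>
    proof (cases i)
      case (Suc j)
      have "norm (\<xi> n j \<omega> - c) \<le> max C 0 + norm c" if "j < k n"
        using norm_triangle_ineq4[of "\<xi> n j \<omega>" c] C[OF that \<open>\<omega> \<in> space M\<close>] by simp
      then show ?thesis using Suc by (simp add: \<xi>'_def pad_values_def add_increasing)
    qed (simp add: \<xi>'_def pad_values_def)
    moreover have "p' n i \<le> p' n (Suc i)" if "i < k' n" for i
      using that p by (cases i) (auto simp: p'_def k'_def pad_partition_def not_le less_Suc_eq le_less_Suc_eq)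
    moreover have "\<xi>' n i \<in> borel_measurable (F (p' n i))" if "i < k' n" for i
    proof (cases i)
      case (Suc j)
      show ?thesis
      proof (cases "j < k n")
        case True
        then show ?thesis using Suc m[OF True] by (simp add: \<xi>'_def p'_def pad_values_def pad_partition_def)
      qed (simp add: Suc \<xi>'_def pad_values_def)
    qed (simp add: \<xi>'_def pad_values_def)
    ultimately show ?thesis
      unfolding simple_integrand_def by (auto simp: p'_def k'_def pad_partition_def)
  qed
  have err: "sq_int a b (\<lambda>r. simple_process (k' n) (p' n) (\<xi>' n) r \<omega> - (g r \<omega> - c)) =
     sq_int a b (\<lambda>r. simple_process (k n) (p n) (\<xi> n) r \<omega> - g r \<omega>)" for n \<omega>
  proof (rule nn_integral_cong_AE)
    have p: "\<And>i. i < k n \<Longrightarrow> p n i \<le> p n (Suc i)" "a \<le> p n 0" "p n (k n) \<le> b"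
      using si[of n] unfolding simple_integrand_def by auto
    \<comment> \<open>The padded process subtracts \<open>c\<close> only on \<open>{a<..b}\<close>,
      so the integrands may differ at the single time \<open>a\<close>.\<close>
    show "AE r in lborel. ennreal ((norm (simple_process (k' n) (p' n) (\<xi>' n) r \<omega> - (g r \<omega> - c)))\<^sup>2) * indicator {a..b} r =
       ennreal ((norm (simple_process (k n) (p n) (\<xi> n) r \<omega> - g r \<omega>))\<^sup>2) * indicator {a..b} r"
      using AE_lborel_singleton[of a]
    proof eventually_elim
      case (elim r)
      show ?case
        using elim simple_process_pad[of "k n" "p n" a b c "\<xi> n" r \<omega>, OF p, folded k'_def p'_def \<xi>'_def]
        by (cases "r \<in> {a..b}") (auto simp: indicator_def)
    qed
  qed
  have ito': "simple_ito_integral B (k' n) (p' n) (\<xi>' n) \<omega> - (I \<omega> - c *v (B b \<omega> - B a \<omega>)) =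
      simple_ito_integral B (k n) (p n) (\<xi> n) \<omega> - I \<omega>" for n \<omega>
    unfolding k'_def p'_def \<xi>'_def simple_ito_integral_pad by simp
  have BM: "B b \<in> borel_measurable M" "B a \<in> borel_measurable M" using ab by auto
  have "(\<lambda>\<omega>. c *v (B b \<omega> - B a \<omega>)) \<in> borel_measurable M"
    using measurable_compose[OF borel_measurable_diff[OF BM] borel_measurable_continuous_onI[of "\<lambda>x. c *v x"]]
    by (simp add: linear_continuous_on)
  then have "(\<lambda>\<omega>. I \<omega> - c *v (B b \<omega> - B a \<omega>)) \<in> borel_measurable M" by simp
  then show ?thesis
    unfolding is_ito_integral_def
    using prog' int' *(2,3) si'
    by (intro conjI exI[of _ k'] exI[of _ p'] exI[of _ \<xi>']) (simp_all only: err ito' simp_thms)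
qed

section \<open>Moment bounds for diffusions with Lipschitz coefficients\<close>

text \<open>Bootstrapping from the crude bound \<open>C\<close>. The exponential weight grows at
  twice the rate \<beta>, so inserting a bound \<open>m exp (2 \<beta> (r - t))\<close> into the
  inequality returns it with \<open>m\<close> halved. Each round also adds at most
  \<open>\<alpha> (T - t)\<close>, and under repeated halving these additions stay below
  \<open>2 \<alpha> (T - t)\<close>.\<close>

lemma gronwall:
  fixes f :: "real \<Rightarrow> ennreal"
  assumes bnd: "\<And>u. u \<in> {t..T} \<Longrightarrow> f u \<le> ennreal C"
    and le: "\<And>u. u \<in> {t..T} \<Longrightarrow> f u \<le> (\<integral>\<^sup>+r\<in>{t..u}. (ennreal \<alpha> + ennreal \<beta> * f r) \<partial>lborel)"
    and pos: "0 \<le> \<alpha>" "0 < \<beta>" "0 \<le> C" "t \<le> T" and u: "u \<in> {t..T}"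
  shows "f u \<le> ennreal (2 * \<alpha> * (T - t) * exp (2 * \<beta> * (T - t)))"
proof -
  have it: "u \<in> {t..T} \<Longrightarrow> f u \<le> ennreal ((2 * \<alpha> * (T - t) + C / 2^k) * exp (2 * \<beta> * (u - t)))" for k u
  proof (induction k arbitrary: u)
    case 0
    have "C \<le> (2 * \<alpha> * (T - t) + C) * exp (2 * \<beta> * (u - t))"
    proof -
      have "1 \<le> exp (2 * \<beta> * (u - t))" using 0 pos by simp
      then have "(2 * \<alpha> * (T - t) + C) * 1 \<le> (2 * \<alpha> * (T - t) + C) * exp (2 * \<beta> * (u - t))"
        using pos by (intro mult_left_mono) auto
      then show ?thesis using pos by (smt (verit) mult_nonneg_nonneg)
    qed
    then show ?case using bnd[OF 0] by (simp add: order_trans ennreal_leI)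
  next
    case (Suc k)
    define m where "m = 2 * \<alpha> * (T - t) + C / 2^k"
    have m: "m \<ge> 0" using pos by (simp add: m_def)
    have "f u \<le> (\<integral>\<^sup>+r\<in>{t..u}. (ennreal \<alpha> + ennreal \<beta> * f r) \<partial>lborel)" using Suc.prems by (rule le)
    also have "\<dots> \<le> (\<integral>\<^sup>+r\<in>{t..u}. ennreal (\<alpha> + \<beta> * (m * exp (2 * \<beta> * (r - t)))) \<partial>lborel)"
    proof (rule nn_integral_mono)
      fix r
      show "(ennreal \<alpha> + ennreal \<beta> * f r) * indicator {t..u} r \<le>
         ennreal (\<alpha> + \<beta> * (m * exp (2 * \<beta> * (r - t)))) * indicator {t..u} r"
      proof (cases "r \<in> {t..u}")
        case True
        then have "f r \<le> ennreal (m * exp (2 * \<beta> * (r - t)))"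
          using Suc.IH[of r] Suc.prems by (simp add: m_def)
        then have "ennreal \<alpha> + ennreal \<beta> * f r \<le> ennreal \<alpha> + ennreal \<beta> * ennreal (m * exp (2 * \<beta> * (r - t)))"
          by (intro add_left_mono mult_left_mono) auto
        also have "\<dots> = ennreal (\<alpha> + \<beta> * (m * exp (2 * \<beta> * (r - t))))"
          using pos m by (simp add: ennreal_mult[symmetric] ennreal_plus[symmetric] del: ennreal_plus)
        finally show ?thesis using True by simp
      qed simp
    qed
    also have "\<dots> = ennreal ((\<alpha> * u + m / 2 * exp (2 * \<beta> * (u - t))) - (\<alpha> * t + m / 2 * exp (2 * \<beta> * (t - t))))"
      using pos m Suc.prems
      by (intro nn_integral_FTC_Icc) (auto intro!: derivative_eq_intros)
    also have "\<dots> \<le> ennreal ((2 * \<alpha> * (T - t) + C / 2^Suc k) * exp (2 * \<beta> * (u - t)))"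
    proof (rule ennreal_leI)
      have e1: "1 \<le> exp (2 * \<beta> * (u - t))" using Suc.prems pos by simp
      have "\<alpha> * (u - t) \<le> \<alpha> * (T - t)" using Suc.prems pos by (intro mult_left_mono) auto
      also have "\<dots> \<le> \<alpha> * (T - t) * exp (2 * \<beta> * (u - t))"
        using pos mult_left_mono[OF e1, of "\<alpha> * (T - t)"] by simp
      finally have "\<alpha> * (u - t) \<le> \<alpha> * (T - t) * exp (2 * \<beta> * (u - t))" .
      moreover have "(2 * \<alpha> * (T - t) + C / 2^Suc k) * exp (2 * \<beta> * (u - t)) =
         \<alpha> * (T - t) * exp (2 * \<beta> * (u - t)) + m / 2 * exp (2 * \<beta> * (u - t))"
      proof -
        have "(2 * A + c / 2) * e = A * e + (2 * A + c) / 2 * e" for A c e :: real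
          by (simp add: field_simps)
        from this[of "\<alpha> * (T - t)" "C / 2^k"] show ?thesis by (simp add: m_def mult.assoc mult.commute[of 2 "2^k"])
      qed
      ultimately show "(\<alpha> * u + m / 2 * exp (2 * \<beta> * (u - t))) - (\<alpha> * t + m / 2 * exp (2 * \<beta> * (t - t))) \<le>
         (2 * \<alpha> * (T - t) + C / 2^Suc k) * exp (2 * \<beta> * (u - t))"
        using m by (simp add: right_diff_distrib)
    qed
    finally show ?case .
  qed
  have "(\<lambda>k. ennreal ((2 * \<alpha> * (T - t) + C / 2^k) * exp (2 * \<beta> * (u - t)))) \<longlonglongrightarrow>
     ennreal ((2 * \<alpha> * (T - t) + 0) * exp (2 * \<beta> * (u - t)))"
  proof (intro tendsto_ennrealI tendsto_intros)
    show "(\<lambda>k. C / 2^k) \<longlonglongrightarrow> 0"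
      using tendsto_mult[OF tendsto_const[of C] LIMSEQ_inverse_realpow_zero[of 2]] by (simp add: field_simps)
  qed
  then have "f u \<le> ennreal ((2 * \<alpha> * (T - t) + 0) * exp (2 * \<beta> * (u - t)))"
    using it[OF u] by (intro LIMSEQ_le_const) auto
  also have "\<dots> \<le> ennreal (2 * \<alpha> * (T - t) * exp (2 * \<beta> * (T - t)))"
    using pos u by (intro ennreal_leI mult_mono) auto
  finally show ?thesis .
qed

text \<open>Let \<tau> be the first time at which the running integral reaches \<open>C\<close>. By
  continuity it is at least \<open>C\<close> at \<tau>, and all of this was accumulated while it was
  still below \<open>C\<close>. This is a pathwise substitute for evaluating a process at a hitting
  time.\<close>

lemma min_nn_integral_le_stopped:
  fixes f :: "real \<Rightarrow> ennreal"
  assumes [measurable]: "f \<in> borel_measurable borel" and fin: "(\<integral>\<^sup>+x\<in>{a..u}. f x \<partial>lborel) < \<infinity>" and au: "a \<le> u"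
  shows "min C (\<integral>\<^sup>+x\<in>{a..u}. f x \<partial>lborel) \<le>
    (\<integral>\<^sup>+r\<in>{a..u}. f r * indicator {r. (\<integral>\<^sup>+x\<in>{a..r}. f x \<partial>lborel) < C} r \<partial>lborel)"
proof -
  define A where "A r = (\<integral>\<^sup>+x\<in>{a..r}. f x \<partial>lborel)" for r
  have A_mono: "A r \<le> A r'" if "r \<le> r'" for r r'
    unfolding A_def using that by (intro nn_integral_mono) (auto simp: indicator_def)
  show ?thesis
  proof (cases "A u < C")
    case True
    then have "A r < C" if "r \<le> u" for r using A_mono[OF that] by (rule le_less_trans[rotated])
    then have "A u = (\<integral>\<^sup>+r\<in>{a..u}. f r * indicator {r. A r < C} r \<partial>lborel)"
      unfolding A_def[of u] by (intro nn_integral_cong) (auto simp: indicator_def)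
    then show ?thesis unfolding A_def by simp
  next
    case False
    define T where "T = {r \<in> {a..u}. C \<le> A r}"
    define \<tau> where "\<tau> = Inf T"
    have uT: "u \<in> T" using False au by (simp add: T_def)
    have bdd: "bdd_below T" unfolding T_def by (rule bdd_belowI[of _ a]) auto
    have \<tau>u: "\<tau> \<le> u" unfolding \<tau>_def using uT bdd by (rule cInf_lower)
    have before: "A r < C" if "r \<in> {a..<\<tau>}" for r
    proof (rule ccontr)
      assume "\<not> A r < C"
      then have "r \<in> T" using that \<tau>u by (auto simp: T_def)
      then have "\<tau> \<le> r" unfolding \<tau>_def using bdd by (intro cInf_lower)
      then show False using that by simp
    qed
    \<comment> \<open>An infimum need not belong to its set, so the running integral is evaluated at
      times decreasing to \<tau>, capped at \<open>u\<close> to stay in the interval, and right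
      continuity gives its value at \<tau>.\<close>
    define \<rho> where "\<rho> n = min u (\<tau> + inverse (real (Suc n)))" for n
    have \<rho>: "C \<le> A (\<rho> n)" for n
    proof (cases "\<tau> + inverse (real (Suc n)) \<le> u")
      case True
      have "\<exists>r\<in>T. r < \<tau> + inverse (real (Suc n))"
        using uT bdd unfolding \<tau>_def by (subst cInf_less_iff[symmetric]) auto
      then obtain r where "r \<in> T" "r < \<tau> + inverse (real (Suc n))" by blast
      then show ?thesis using A_mono[of r "\<rho> n"] True by (auto simp: T_def \<rho>_def)
    next
      case False
      then show ?thesis using uT by (simp add: T_def \<rho>_def min_def)
    qed
    have "(\<lambda>n. A (\<rho> n)) \<longlonglongrightarrow> A \<tau>"
      unfolding A_def
    proof (rule nn_integral_dominated_convergence[where w="\<lambda>x. f x * indicator {a..u} x"])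
      show "AE x in lborel. f x * indicator {a..\<rho> j} x \<le> f x * indicator {a..u} x" for j
        by (intro AE_I2) (auto simp: indicator_def \<rho>_def)
      show "AE x in lborel. (\<lambda>n. f x * indicator {a..\<rho> n} x) \<longlonglongrightarrow> f x * indicator {a..\<tau>} x"
      proof (intro AE_I2)
        fix x
        show "(\<lambda>n. f x * indicator {a..\<rho> n} x) \<longlonglongrightarrow> f x * indicator {a..\<tau>} x"
        proof (cases "x \<le> \<tau>")
          case True
          then have "x \<le> \<rho> n" for n using \<tau>u by (auto simp: \<rho>_def add_increasing2)
          then show ?thesis using True by (simp add: indicator_def)
        next
          case False
          have "(\<lambda>n. \<tau> + inverse (real (Suc n))) \<longlonglongrightarrow> \<tau> + 0"
            by (intro tendsto_intros LIMSEQ_inverse_real_of_nat)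
          then have "\<forall>\<^sub>F n in sequentially. \<tau> + inverse (real (Suc n)) < x"
            using False by (intro order_tendstoD) auto
          then have "\<forall>\<^sub>F n in sequentially. f x * indicator {a..\<rho> n} x = f x * indicator {a..\<tau>} x"
            by eventually_elim (use False in \<open>auto simp: indicator_def \<rho>_def\<close>)
          then show ?thesis by (rule tendsto_eventually)
        qed
      qed
    qed (use fin in auto)
    then have "C \<le> A \<tau>" using \<rho> by (intro LIMSEQ_le_const) auto
    \<comment> \<open>On \<open>{a..<\<tau>}\<close> the indicator on the right is 1; the point
      \<tau> itself is a null set.\<close>
    also have "A \<tau> \<le> (\<integral>\<^sup>+r\<in>{a..u}. f r * indicator {r. A r < C} r \<partial>lborel)"
      unfolding A_def[of \<tau>]
    proof (rule nn_integral_mono_AE)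
      show "AE x in lborel. f x * indicator {a..\<tau>} x \<le> f x * indicator {r. A r < C} x * indicator {a..u} x"
        using AE_lborel_singleton[of \<tau>]
        by eventually_elim (use before \<tau>u in \<open>auto simp: indicator_def\<close>)
    qed
    finally show ?thesis unfolding A_def by (rule min.coboundedI1)
  qed
qed

text \<open>Cauchy-Schwarz in time. The factor \<open>b - a\<close> is the source of the additional
  power of \<open>h\<close> in the drift error.\<close>

lemma norm_set_integral_square_le:
  fixes f :: "real \<Rightarrow> 'b::{banach, second_countable_topology}"
  assumes int: "set_integrable lborel {a..b} f" and ab: "a \<le> b"
  shows "ennreal ((norm (LINT r:{a..b}|lborel. f r))\<^sup>2) \<le>
    ennreal (b - a) * sq_int a b f"
proof -
  let ?f = "\<lambda>r. indicator {a..b} r *\<^sub>R f r"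
  have [measurable]: "?f \<in> borel_measurable lborel" using int unfolding set_integrable_def by auto
  have "ennreal (norm (LINT r:{a..b}|lborel. f r)) \<le> (\<integral>\<^sup>+r. ennreal (norm (?f r)) \<partial>lborel)"
    unfolding set_lebesgue_integral_def using int
    by (intro integral_norm_bound_ennreal) (simp add: set_integrable_def)
  also have "\<dots> = (\<integral>\<^sup>+r. ennreal (norm (?f r)) * indicator {a..b} r \<partial>lborel)"
    by (intro nn_integral_cong) (auto simp: indicator_def)
  finally have "(ennreal (norm (LINT r:{a..b}|lborel. f r)))\<^sup>2 \<le> (\<integral>\<^sup>+r. ennreal (norm (?f r)) * indicator {a..b} r \<partial>lborel)\<^sup>2"
    by (intro power_mono) auto
  also have "\<dots> \<le> (\<integral>\<^sup>+r. (ennreal (norm (?f r)))\<^sup>2 \<partial>lborel) * (\<integral>\<^sup>+r. (indicator {a..b} r)\<^sup>2 \<partial>lborel)"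
    by (rule Cauchy_Schwarz_nn_integral) measurable
  also have "(\<integral>\<^sup>+r. (ennreal (norm (?f r)))\<^sup>2 \<partial>lborel) = sq_int a b f"
    by (intro nn_integral_cong) (auto simp: indicator_def ennreal_power)
  also have "(\<integral>\<^sup>+r. (indicator {a..b} r)\<^sup>2 \<partial>lborel) = (\<integral>\<^sup>+r. indicator {a..b} r \<partial>lborel)"
    by (intro nn_integral_cong) (auto simp: indicator_def)
  also have "\<dots> = ennreal (b - a)" using ab by simp
  finally show ?thesis by (simp add: ennreal_power mult.commute)
qed

section \<open>Localized second moments of a Lipschitz diffusion\<close>

locale lipschitz_diffusion = brownian_space M F B
  for M :: "'w measure" and F :: "real \<Rightarrow> 'w measure" and B :: "real \<Rightarrow> 'w \<Rightarrow> real^'m" +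
  fixes D :: "(real^'n) set" and \<beta> :: "real^'n \<Rightarrow> real^'n" and \<gamma> :: "real^'n \<Rightarrow> real^'m^'n"
    and t :: real and x0 :: "real^'n" and X :: "real \<Rightarrow> 'w \<Rightarrow> real^'n" and L :: real
  assumes t_nonneg: "0 \<le> t" and x0: "x0 \<in> D"
    and ito_process: "ito_process M F B t x0 (\<lambda>u \<omega>. \<beta> (X u \<omega>)) (\<lambda>u \<omega>. \<gamma> (X u \<omega>)) X"
    and X_in: "\<And>u \<omega>. t \<le> u \<Longrightarrow> \<omega> \<in> space M \<Longrightarrow> X u \<omega> \<in> D"
    and lipschitz_\<beta>: "L-lipschitz_on D \<beta>" and lipschitz_\<gamma>: "L-lipschitz_on D \<gamma>"
begin

lemma L_nonneg: "0 \<le> L"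
  using lipschitz_\<beta> by (rule lipschitz_on_nonneg)

lemma lipschitz_norm:
  assumes "x \<in> D"
  shows "norm (\<beta> x - \<beta> x0) \<le> L * norm (x - x0)" "norm (\<gamma> x - \<gamma> x0) \<le> L * norm (x - x0)"
  using lipschitz_onD[OF lipschitz_\<beta> assms x0] lipschitz_onD[OF lipschitz_\<gamma> assms x0]
  by (simp_all add: dist_norm)

lemma X_measurable [measurable]: "t \<le> u \<Longrightarrow> X u \<in> borel_measurable M"
  using ito_process measurable_F unfolding ito_process_def by blast

lemma progressive_\<beta>: "progressive F t (\<lambda>u \<omega>. \<beta> (X u \<omega>))"
  using ito_process by (simp add: ito_process_def)

lemma ito_representation:
  assumes "t \<le> u"
  obtains I where "is_ito_integral M F B t u (\<lambda>r \<omega>. \<gamma> (X r \<omega>)) I"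
    "AE \<omega> in M. set_integrable lborel {t..u} (\<lambda>r. \<beta> (X r \<omega>))"
    "AE \<omega> in M. X u \<omega> = x0 + (LINT r:{t..u}|lborel. \<beta> (X r \<omega>)) + I \<omega>"
  using ito_process assms unfolding ito_process_def by blast

lemma progressive_\<gamma>: "progressive F t (\<lambda>u \<omega>. \<gamma> (X u \<omega>))"
  using ito_representation[of t] unfolding is_ito_integral_def by auto

text \<open>Adding the squared coefficients lets one localizing event control drift and noise at
  once.\<close>

definition q :: "real \<Rightarrow> 'w \<Rightarrow> real" where
  "q r \<omega> = (norm (\<beta> (X r \<omega>)))\<^sup>2 + (norm (\<gamma> (X r \<omega>)))\<^sup>2"

text \<open>The factor 2 matches the one in \<open>ito_integral_localized_bound\<close>: it makes
  \<open>Q u \<omega> < C\<close> imply the localizing condition there for \<gamma>.\<close>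

definition Q :: "real \<Rightarrow> 'w \<Rightarrow> ennreal" where
  "Q u \<omega> = (\<integral>\<^sup>+r\<in>{t..u}. ennreal (2 * q r \<omega>) \<partial>lborel)"

text \<open>Linear growth centred at \<open>x0\<close>: each coefficient is compared with its value
  at \<open>x0\<close> by \<open>(a + b)^2 \<le> 2 a^2 + 2 b^2\<close> and the Lipschitz bound. The
  constant part and the factor of the squared displacement are then added, so that one number serves
  for both.\<close>

definition \<kappa> :: real where
  "\<kappa> = 2 * (norm (\<beta> x0))\<^sup>2 + 2 * (norm (\<gamma> x0))\<^sup>2 + 4 * L\<^sup>2"

lemma \<kappa>_nonneg: "0 \<le> \<kappa>" by (simp add: \<kappa>_def)

lemma q_nonneg: "0 \<le> q r \<omega>" by (simp add: q_def)

lemma q_le: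
  assumes "t \<le> r" "\<omega> \<in> space M"
  shows "q r \<omega> \<le> \<kappa> * (1 + (norm (X r \<omega> - x0))\<^sup>2)"
proof -
  let ?x = "X r \<omega>"
  have x: "?x \<in> D" using assms by (rule X_in)
  have "(norm (\<beta> ?x - \<beta> x0))\<^sup>2 \<le> (L * norm (?x - x0))\<^sup>2" "(norm (\<gamma> ?x - \<gamma> x0))\<^sup>2 \<le> (L * norm (?x - x0))\<^sup>2"
    using lipschitz_norm[OF x] by (intro power_mono; simp)+
  then have "q r \<omega> \<le> 2 * (norm (\<beta> x0))\<^sup>2 + 2 * (norm (\<gamma> x0))\<^sup>2 + 4 * (L\<^sup>2 * (norm (?x - x0))\<^sup>2)"
    using norm_square_triangle[of "\<beta> x0" "\<beta> ?x - \<beta> x0"] norm_square_triangle[of "\<gamma> x0" "\<gamma> ?x - \<gamma> x0"]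
    by (simp add: q_def power_mult_distrib)
  also have "\<dots> \<le> \<kappa> * (1 + (norm (?x - x0))\<^sup>2)"
    by (simp add: \<kappa>_def algebra_simps)
  finally show ?thesis .
qed

lemma q_measurable:
  assumes "t \<le> u"
  shows "(\<lambda>(r, \<omega>). indicator {t..u} r * q r \<omega>) \<in> borel_measurable (borel \<Otimes>\<^sub>M M)"
proof -
  note progressive_measurable[OF progressive_\<beta> assms, measurable] progressive_measurable[OF progressive_\<gamma> assms, measurable]
  have "(\<lambda>(r, \<omega>). (norm (indicator {t..u} r *\<^sub>R \<beta> (X r \<omega>)))\<^sup>2 + (norm (indicator {t..u} r *\<^sub>R \<gamma> (X r \<omega>)))\<^sup>2)
      \<in> borel_measurable (borel \<Otimes>\<^sub>M M)"
    by measurable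
  also have "(\<lambda>(r, \<omega>). (norm (indicator {t..u} r *\<^sub>R \<beta> (X r \<omega>)))\<^sup>2 + (norm (indicator {t..u} r *\<^sub>R \<gamma> (X r \<omega>)))\<^sup>2) =
     (\<lambda>(r, \<omega>). indicator {t..u} r * q r \<omega>)"
    by (intro ext) (auto simp: q_def indicator_def)
  finally show ?thesis .
qed

lemma Q_eq: "u \<le> T \<Longrightarrow> Q u \<omega> = (\<integral>\<^sup>+r. ennreal (2 * (indicator {t..T} r * q r \<omega>)) * indicator {t..u} r \<partial>lborel)"
  unfolding Q_def by (intro nn_integral_cong) (auto simp: indicator_def)

lemma Q_measurable [measurable]: "Q u \<in> borel_measurable M"
proof (cases "t \<le> u")
  case True
  note q_measurable[OF True, measurable]
  have "(\<lambda>\<omega>. \<integral>\<^sup>+r. ennreal (2 * (indicator {t..u} r * q r \<omega>)) * indicator {t..u} r \<partial>lborel) \<in> borel_measurable M"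
    by measurable
  then show ?thesis by (simp add: Q_eq[OF order_refl, symmetric])
next
  case False
  then have "Q u = (\<lambda>_. 0)" by (auto simp: Q_def)
  then show ?thesis by simp
qed

text \<open>Lipschitz coefficients are bounded along a continuous path over a compact time interval.
  The bound depends on the path, so this yields no moments.\<close>

lemma Q_finite: "AE \<omega> in M. Q u \<omega> < \<infinity>"
proof -
  have "AE \<omega> in M. continuous_on {t..} (\<lambda>u. X u \<omega>)"
    using ito_process by (simp add: ito_process_def)
  then show ?thesis
    using AE_space
  proof eventually_elim
    case (elim \<omega>)
    have c: "continuous_on {t..u} (\<lambda>u. X u \<omega>)" using elim(1) by (rule continuous_on_subset) auto
    have sub: "(\<lambda>u. X u \<omega>) ` {t..u} \<subseteq> D" using X_in elim(2) by auto
    have "continuous_on {t..u} (\<lambda>u. \<beta> (X u \<omega>))" "continuous_on {t..u} (\<lambda>u. \<gamma> (X u \<omega>))"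
      using continuous_on_compose2[OF lipschitz_on_continuous_on[OF lipschitz_\<beta>] c sub]
        continuous_on_compose2[OF lipschitz_on_continuous_on[OF lipschitz_\<gamma>] c sub] by auto
    then have "continuous_on {t..u} (\<lambda>r. 2 * q r \<omega>)"
      unfolding q_def by (intro continuous_intros)
    then have "bounded ((\<lambda>r. 2 * q r \<omega>) ` {t..u})"
      by (intro compact_imp_bounded compact_continuous_image compact_Icc)
    then obtain c where "\<forall>x\<in>(\<lambda>r. 2 * q r \<omega>) ` {t..u}. norm x \<le> c" unfolding bounded_iff by blast
    then have c: "2 * q r \<omega> \<le> c" if "r \<in> {t..u}" for r using that by force
    have "Q u \<omega> \<le> (\<integral>\<^sup>+r\<in>{t..u}. ennreal c \<partial>lborel)"
      unfolding Q_def using c by (intro nn_integral_mono) (auto simp: indicator_def intro!: ennreal_leI)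
    also have "\<dots> < \<infinity>" by (simp add: nn_integral_cmult_indicator ennreal_mult_less_top emeasure_lborel_Icc_eq)
    finally show ?case .
  qed
qed

lemma square_integral_le_Q_dominated:
  fixes f :: "real \<Rightarrow> 'w \<Rightarrow> 'z::real_normed_vector"
  assumes f: "progressive F t f" "\<And>r. (norm (f r \<omega>))\<^sup>2 \<le> q r \<omega>" and tu: "t \<le> u" and \<omega>: "\<omega> \<in> space M"
  shows "2 * sq_int t u (\<lambda>r. f r \<omega>) \<le> Q u \<omega>"
proof -
  have [measurable]: "(\<lambda>r. indicator {t..u} r *\<^sub>R f r \<omega>) \<in> borel_measurable borel"
    using measurable_compose[OF measurable_Pair2' progressive_measurable[OF f(1) tu], OF \<omega>] by simp
  have eq: "sq_int t u (\<lambda>r. f r \<omega>) = (\<integral>\<^sup>+r. ennreal ((norm (indicator {t..u} r *\<^sub>R f r \<omega>))\<^sup>2) \<partial>lborel)"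
    by (intro nn_integral_cong) (auto simp: indicator_def)
  have "(\<lambda>r. ennreal ((norm (indicator {t..u} r *\<^sub>R f r \<omega>))\<^sup>2)) \<in> borel_measurable lborel" by measurable
  from nn_integral_cmult[OF this, of 2]
  have "2 * sq_int t u (\<lambda>r. f r \<omega>) =
     (\<integral>\<^sup>+r. 2 * ennreal ((norm (indicator {t..u} r *\<^sub>R f r \<omega>))\<^sup>2) \<partial>lborel)" unfolding eq by (rule sym)
  also have "\<dots> \<le> Q u \<omega>"
    unfolding Q_def
  proof (intro nn_integral_mono)
    fix r
    have "2 * ennreal ((norm (f r \<omega>))\<^sup>2) \<le> ennreal (2 * q r \<omega>)"
      using f(2)[of r] q_nonneg by (simp add: ennreal_mult ennreal_leI mult_left_mono)
    then show "2 * ennreal ((norm (indicator {t..u} r *\<^sub>R f r \<omega>))\<^sup>2) \<le> ennreal (2 * q r \<omega>) * indicator {t..u} r"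
      by (simp add: indicator_def)
  qed
  finally show ?thesis .
qed

lemma square_integral_le_Q:
  assumes "t \<le> u" "\<omega> \<in> space M"
  shows "2 * sq_int t u (\<lambda>r. \<beta> (X r \<omega>)) \<le> Q u \<omega>"
    and "2 * sq_int t u (\<lambda>r. \<gamma> (X r \<omega>)) \<le> Q u \<omega>"
  by (rule square_integral_le_Q_dominated[OF progressive_\<beta> _ assms], simp add: q_def)
     (rule square_integral_le_Q_dominated[OF progressive_\<gamma> _ assms], simp add: q_def)

text \<open>The drift is already estimated pathwise, by Cauchy-Schwarz in time; the Ito term can be
  estimated only in mean and is kept as it is.\<close>

lemma displacement_le:
  assumes tu: "t \<le> u" and I: "AE \<omega> in M. set_integrable lborel {t..u} (\<lambda>r. \<beta> (X r \<omega>))"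
    "AE \<omega> in M. X u \<omega> = x0 + (LINT r:{t..u}|lborel. \<beta> (X r \<omega>)) + I \<omega>"
  shows "AE \<omega> in M. ennreal ((norm (X u \<omega> - x0))\<^sup>2) \<le> ennreal (u - t) * Q u \<omega> + 2 * ennreal ((norm (I \<omega>))\<^sup>2)"
  using I AE_space
proof eventually_elim
  case (elim \<omega>)
  let ?J = "LINT r:{t..u}|lborel. \<beta> (X r \<omega>)"
  have "(norm (X u \<omega> - x0))\<^sup>2 \<le> 2 * (norm ?J)\<^sup>2 + 2 * (norm (I \<omega>))\<^sup>2"
    using elim(2) norm_square_triangle[of ?J "I \<omega>"] by (simp add: add.assoc)
  then have "ennreal ((norm (X u \<omega> - x0))\<^sup>2) \<le> ennreal (2 * (norm ?J)\<^sup>2 + 2 * (norm (I \<omega>))\<^sup>2)" by (rule ennreal_leI)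
  also have "\<dots> = 2 * ennreal ((norm ?J)\<^sup>2) + 2 * ennreal ((norm (I \<omega>))\<^sup>2)"
    by (simp add: ennreal_plus ennreal_mult)
  also have "\<dots> \<le> ennreal (u - t) * Q u \<omega> + 2 * ennreal ((norm (I \<omega>))\<^sup>2)"
  proof (rule add_right_mono)
    have "2 * ennreal ((norm ?J)\<^sup>2) \<le> 2 * (ennreal (u - t) * (sq_int t u (\<lambda>r. \<beta> (X r \<omega>))))"
      using norm_set_integral_square_le[OF elim(1) tu] by (intro mult_left_mono) auto
    also have "\<dots> = ennreal (u - t) * (2 * sq_int t u (\<lambda>r. \<beta> (X r \<omega>)))"
      by (simp add: mult.left_commute)
    also have "\<dots> \<le> ennreal (u - t) * Q u \<omega>"
      using square_integral_le_Q(1)[OF tu elim(3)] by (intro mult_left_mono) auto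
    finally show "2 * ennreal ((norm ?J)\<^sup>2) \<le> ennreal (u - t) * Q u \<omega>" .
  qed
  finally show ?case .
qed

text \<open>
  No moments of \<open>X\<close> are known a priori, so the Gronwall argument is run for this truncated quantity,
  which is bounded by \<open>C\<close>; the resulting bound does not depend on \<open>C\<close>.
\<close>

definition V :: "real \<Rightarrow> real \<Rightarrow> ennreal" where
  "V C u = (\<integral>\<^sup>+\<omega>. min (ennreal C) (Q u \<omega>) \<partial>M)"

text \<open>On the event \<open>Q u < C\<close> the minimum in \<open>V\<close> is
  \<open>Q u\<close> itself, and the Ito part falls under its localized bound. The weight
  \<open>u - t\<close> comes from the drift, the weight 2 from the noise.\<close>

lemma localized_displacement:
  assumes tu: "t \<le> u" and C: "0 \<le> C"
  shows "(\<integral>\<^sup>+\<omega>. ennreal ((norm (X u \<omega> - x0))\<^sup>2) * indicator {\<omega>. Q u \<omega> < ennreal C} \<omega> \<partial>M) \<le>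
    ennreal (u - t + 2) * V C u"
proof -
  obtain I where ito: "is_ito_integral M F B t u (\<lambda>r \<omega>. \<gamma> (X r \<omega>)) I"
    and I: "AE \<omega> in M. set_integrable lborel {t..u} (\<lambda>r. \<beta> (X r \<omega>))"
    "AE \<omega> in M. X u \<omega> = x0 + (LINT r:{t..u}|lborel. \<beta> (X r \<omega>)) + I \<omega>"
    by (rule ito_representation[OF tu])
  have [measurable]: "I \<in> borel_measurable M" using ito by (simp add: is_ito_integral_def)
  define G where "G \<omega> = sq_int t u (\<lambda>r. \<gamma> (X r \<omega>))" for \<omega>
  have [measurable]: "G \<in> borel_measurable M"
    unfolding G_def using progressive_\<gamma> tu by (rule progressive_square_integral_measurable)
  have GQ: "2 * G \<omega> \<le> Q u \<omega>" if "\<omega> \<in> space M" for \<omega>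
    using square_integral_le_Q(2)[OF tu that] by (simp add: G_def)
  have pred: "Measurable.pred M (\<lambda>\<omega>. 2 * G \<omega> < ennreal C)" by measurable
  have "(\<integral>\<^sup>+\<omega>. ennreal ((norm (X u \<omega> - x0))\<^sup>2) * indicator {\<omega>. Q u \<omega> < ennreal C} \<omega> \<partial>M) \<le>
     (\<integral>\<^sup>+\<omega>. ennreal (u - t) * min (ennreal C) (Q u \<omega>) + 2 * (ennreal ((norm (I \<omega>))\<^sup>2) * indicator {\<omega>. 2 * G \<omega> < ennreal C} \<omega>) \<partial>M)"
  proof (rule nn_integral_mono_AE)
    show "AE \<omega> in M. ennreal ((norm (X u \<omega> - x0))\<^sup>2) * indicator {\<omega>. Q u \<omega> < ennreal C} \<omega> \<le>
       ennreal (u - t) * min (ennreal C) (Q u \<omega>) + 2 * (ennreal ((norm (I \<omega>))\<^sup>2) * indicator {\<omega>. 2 * G \<omega> < ennreal C} \<omega>)"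
      using displacement_le[OF tu I] AE_space
    proof eventually_elim
      case (elim \<omega>)
      show ?case
      proof (cases "Q u \<omega> < ennreal C")
        case True
        then have "2 * G \<omega> < ennreal C" using GQ[OF elim(2)] by (rule le_less_trans[rotated])
        then show ?thesis using elim(1) True by (simp add: min_absorb2 less_imp_le)
      qed simp
    qed
  qed
  also have "\<dots> = ennreal (u - t) * V C u + 2 * (\<integral>\<^sup>+\<omega>. ennreal ((norm (I \<omega>))\<^sup>2) * indicator {\<omega>. 2 * G \<omega> < ennreal C} \<omega> \<partial>M)"
  proof -
    have m: "(\<lambda>\<omega>. min (ennreal C) (Q u \<omega>)) \<in> borel_measurable M"
      "(\<lambda>\<omega>. ennreal ((norm (I \<omega>))\<^sup>2) * indicator {\<omega>. 2 * G \<omega> < ennreal C} \<omega>) \<in> borel_measurable M"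
      using pred by measurable
    note m2 = borel_measurable_times_ennreal[OF borel_measurable_const m(1), of "ennreal (u - t)"]
      borel_measurable_times_ennreal[OF borel_measurable_const m(2), of 2]
    show ?thesis unfolding V_def
      by (simp only: nn_integral_add[OF m2] nn_integral_cmult[OF m(1)] nn_integral_cmult[OF m(2)])
  qed
  also have "\<dots> \<le> ennreal (u - t) * V C u + 2 * V C u"
  proof (intro add_left_mono mult_left_mono)
    have "(\<integral>\<^sup>+\<omega>. ennreal ((norm (I \<omega>))\<^sup>2) * indicator {\<omega>. 2 * G \<omega> < ennreal C} \<omega> \<partial>M) \<le>
        (\<integral>\<^sup>+\<omega>. min (ennreal C) (2 * G \<omega>) \<partial>M)"
      unfolding G_def by (rule ito_integral_localized_bound[OF ito t_nonneg tu C])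
    also have "\<dots> \<le> V C u"
      unfolding V_def using GQ by (intro nn_integral_mono min.mono order_refl)
    finally show "(\<integral>\<^sup>+\<omega>. ennreal ((norm (I \<omega>))\<^sup>2) * indicator {\<omega>. 2 * G \<omega> < ennreal C} \<omega> \<partial>M) \<le> V C u" .
  qed auto
  also have "\<dots> = ennreal (u - t + 2) * V C u"
    using tu by (simp add: distrib_right)
  finally show ?thesis .
qed

text \<open>The pathwise inequality for \<open>min C (Q u)\<close> leaves the density
  \<open>2 q r\<close> on the event \<open>Q r < C\<close>. After Fubini, \<open>q_le\<close> bounds
  the density by the squared displacement at time \<open>r\<close> on the very event on which
  \<open>localized_displacement\<close> applies, and this returns to \<open>V\<close> at time
  \<open>r\<close>.\<close>

lemma V_integral_inequality:
  assumes tu: "t \<le> u" "u \<le> T" and C: "0 \<le> C"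
  shows "V C u \<le> (\<integral>\<^sup>+r\<in>{t..u}. (ennreal (2 * \<kappa>) + ennreal (2 * \<kappa> * (T - t + 2)) * V C r) \<partial>lborel)"
proof -
  note q_measurable[OF tu(1), measurable]
  let ?f = "\<lambda>r \<omega>. ennreal (2 * (indicator {t..u} r * q r \<omega>))"
  have Qf: "Q v \<omega> = (\<integral>\<^sup>+r\<in>{t..v}. ?f r \<omega> \<partial>lborel)" if "v \<le> u" for v \<omega>
    using that by (rule Q_eq)
  \<comment> \<open>Fubini needs joint measurability of \<open>Q\<close> in time and \<omega>, which
    holds because \<open>Q\<close> is a parameter integral over the measurable region
    \<open>t \<le> r \<le> v\<close>.\<close>
  have Qm: "(\<lambda>(r, \<omega>). Q r \<omega> * indicator {t..u} r) \<in> borel_measurable (borel \<Otimes>\<^sub>M M)"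
  proof -
    have "Measurable.pred ((borel \<Otimes>\<^sub>M M) \<Otimes>\<^sub>M borel) (\<lambda>z. t \<le> snd z \<and> snd z \<le> fst (fst z))" by measurable
    then have "(\<lambda>(z, r). ?f r (snd z) * indicator {z. t \<le> snd z \<and> snd z \<le> fst (fst z)} (z, r))
      \<in> borel_measurable ((borel \<Otimes>\<^sub>M M) \<Otimes>\<^sub>M borel)"
      by measurable
    then have "(\<lambda>z. \<integral>\<^sup>+r. ?f r (snd z) * indicator {z. t \<le> snd z \<and> snd z \<le> fst (fst z)} (z, r) \<partial>lborel)
      \<in> borel_measurable (borel \<Otimes>\<^sub>M M)"
      by (intro lborel.borel_measurable_nn_integral) simp
    then have "(\<lambda>z. (\<integral>\<^sup>+r. ?f r (snd z) * indicator {z. t \<le> snd z \<and> snd z \<le> fst (fst z)} (z, r) \<partial>lborel) *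
        indicator {t..u} (fst z)) \<in> borel_measurable (borel \<Otimes>\<^sub>M M)"
      by measurable
    also have "(\<lambda>z. (\<integral>\<^sup>+r. ?f r (snd z) * indicator {z. t \<le> snd z \<and> snd z \<le> fst (fst z)} (z, r) \<partial>lborel) *
        indicator {t..u} (fst z)) = (\<lambda>(r, \<omega>). Q r \<omega> * indicator {t..u} r)"
    proof (intro ext, clarify)
      fix v \<omega>
      show "(\<integral>\<^sup>+r. ?f r (snd (v, \<omega>)) * indicator {z. t \<le> snd z \<and> snd z \<le> fst (fst z)} ((v, \<omega>), r) \<partial>lborel) *
        indicator {t..u} (fst (v, \<omega>)) = Q v \<omega> * indicator {t..u} v"
      proof (cases "v \<in> {t..u}")
        case True
        have "(\<integral>\<^sup>+r. ?f r (snd (v, \<omega>)) * indicator {z. t \<le> snd z \<and> snd z \<le> fst (fst z)} ((v, \<omega>), r) \<partial>lborel) = Q v \<omega>"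
          using True by (subst Qf) (auto intro!: nn_integral_cong simp: indicator_def)
        then show ?thesis by simp
      qed simp
    qed
    finally show ?thesis .
  qed
  note Qm [measurable]
  have pred: "Measurable.pred (borel \<Otimes>\<^sub>M M) (\<lambda>z. Q (fst z) (snd z) * indicator {t..u} (fst z) < ennreal C)"
    using Qm by (simp add: case_prod_beta) measurable
  let ?h = "\<lambda>r \<omega>. ?f r \<omega> * indicator {z. Q (fst z) (snd z) * indicator {t..u} (fst z) < ennreal C} (r, \<omega>) * indicator {t..u} r"
  have hm: "(\<lambda>(r, \<omega>). ?h r \<omega>) \<in> borel_measurable (borel \<Otimes>\<^sub>M M)"
    using pred by measurable
  have "V C u \<le> (\<integral>\<^sup>+\<omega>. (\<integral>\<^sup>+r. ?h r \<omega> \<partial>lborel) \<partial>M)"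
    unfolding V_def
  proof (rule nn_integral_mono_AE)
    show "AE \<omega> in M. min (ennreal C) (Q u \<omega>) \<le> (\<integral>\<^sup>+r. ?h r \<omega> \<partial>lborel)"
      using Q_finite[of u] AE_space
    proof eventually_elim
      case (elim \<omega>)
      have m: "(\<lambda>r. ?f r \<omega>) \<in> borel_measurable borel" using elim(2) by measurable
      have "min (ennreal C) (Q u \<omega>) \<le>
         (\<integral>\<^sup>+r\<in>{t..u}. ?f r \<omega> * indicator {r. (\<integral>\<^sup>+x\<in>{t..r}. ?f x \<omega> \<partial>lborel) < ennreal C} r \<partial>lborel)"
        unfolding Qf[OF order_refl]
        by (rule min_nn_integral_le_stopped[OF m _ tu(1)]) (use elim(1) in \<open>simp add: Qf[OF order_refl]\<close>)
      also have "\<dots> = (\<integral>\<^sup>+r. ?h r \<omega> \<partial>lborel)"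
        by (intro nn_integral_cong) (auto simp: indicator_def Qf)
      finally show ?case .
    qed
  qed
  also have "\<dots> = (\<integral>\<^sup>+r. (\<integral>\<^sup>+\<omega>. ?h r \<omega> \<partial>M) \<partial>lborel)"
  proof -
    interpret pair_sigma_finite lborel M ..
    show ?thesis using hm by (intro Fubini') simp
  qed
  also have "\<dots> \<le> (\<integral>\<^sup>+r\<in>{t..u}. (ennreal (2 * \<kappa>) + ennreal (2 * \<kappa> * (T - t + 2)) * V C r) \<partial>lborel)"
  proof (rule nn_integral_mono)
    fix r
    show "(\<integral>\<^sup>+\<omega>. ?h r \<omega> \<partial>M) \<le> (ennreal (2 * \<kappa>) + ennreal (2 * \<kappa> * (T - t + 2)) * V C r) * indicator {t..u} r"
    proof (cases "r \<in> {t..u}")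
      case True
      then have tr: "t \<le> r" by simp
      have pred: "Measurable.pred M (\<lambda>\<omega>. Q r \<omega> < ennreal C)" by measurable
      have m: "(\<lambda>\<omega>. ennreal ((norm (X r \<omega> - x0))\<^sup>2) * indicator {\<omega>. Q r \<omega> < ennreal C} \<omega>) \<in> borel_measurable M"
        using pred X_measurable[OF tr] by measurable
      have "(\<integral>\<^sup>+\<omega>. ?h r \<omega> \<partial>M) \<le> (\<integral>\<^sup>+\<omega>. ennreal (2 * \<kappa>) + ennreal (2 * \<kappa>) *
          (ennreal ((norm (X r \<omega> - x0))\<^sup>2) * indicator {\<omega>. Q r \<omega> < ennreal C} \<omega>) \<partial>M)"
      proof (rule nn_integral_mono)
        fix \<omega> assume \<omega>: "\<omega> \<in> space M"
        have "ennreal (2 * q r \<omega>) \<le> ennreal (2 * \<kappa> + 2 * \<kappa> * (norm (X r \<omega> - x0))\<^sup>2)"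
          using q_le[OF tr \<omega>] by (intro ennreal_leI) (simp add: algebra_simps)
        also have "\<dots> = ennreal (2 * \<kappa>) + ennreal (2 * \<kappa>) * ennreal ((norm (X r \<omega> - x0))\<^sup>2)"
          using \<kappa>_nonneg by (simp add: ennreal_mult)
        finally show "?h r \<omega> \<le> ennreal (2 * \<kappa>) + ennreal (2 * \<kappa>) *
          (ennreal ((norm (X r \<omega> - x0))\<^sup>2) * indicator {\<omega>. Q r \<omega> < ennreal C} \<omega>)"
          using True by (simp add: indicator_def)
      qed
      also have "\<dots> = ennreal (2 * \<kappa>) + ennreal (2 * \<kappa>) *
          (\<integral>\<^sup>+\<omega>. ennreal ((norm (X r \<omega> - x0))\<^sup>2) * indicator {\<omega>. Q r \<omega> < ennreal C} \<omega> \<partial>M)"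
        using nn_integral_add[OF borel_measurable_const borel_measurable_times_ennreal[OF borel_measurable_const m]]
          nn_integral_cmult[OF m] by (simp add: emeasure_space_1)
      also have "\<dots> \<le> ennreal (2 * \<kappa>) + ennreal (2 * \<kappa>) * (ennreal (T - t + 2) * V C r)"
      proof (intro add_left_mono mult_left_mono)
        have "(\<integral>\<^sup>+\<omega>. ennreal ((norm (X r \<omega> - x0))\<^sup>2) * indicator {\<omega>. Q r \<omega> < ennreal C} \<omega> \<partial>M) \<le> ennreal (r - t + 2) * V C r"
          using tr C by (rule localized_displacement)
        also have "\<dots> \<le> ennreal (T - t + 2) * V C r"
          using True tu by (intro mult_right_mono ennreal_leI) auto
        finally show "(\<integral>\<^sup>+\<omega>. ennreal ((norm (X r \<omega> - x0))\<^sup>2) * indicator {\<omega>. Q r \<omega> < ennreal C} \<omega> \<partial>M) \<le> ennreal (T - t + 2) * V C r" .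
      qed auto
      also have "\<dots> = ennreal (2 * \<kappa>) + ennreal (2 * \<kappa> * (T - t + 2)) * V C r"
        using \<kappa>_nonneg tu by (simp add: ennreal_mult mult.assoc)
      finally show ?thesis using True by simp
    qed simp
  qed
  finally show ?thesis .
qed

text \<open>Two passes: Gronwall's inequality gives a bound \<open>K\<close> uniform in time and
  cutoff, and inserting \<open>K\<close> into the integral inequality improves it to a bound
  proportional to \<open>u - t\<close>.\<close>

lemma V_bound:
  assumes tT: "t \<le> T"
  obtains c where "0 \<le> c" "\<And>C u. 0 \<le> C \<Longrightarrow> u \<in> {t..T} \<Longrightarrow> V C u \<le> ennreal (c * (u - t))"
proof -
  define b where "b = 2 * \<kappa> * (T - t + 2)"
  \<comment> \<open>\<open>gronwall\<close> asks for a strictly positive rate, whereas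
    \<open>b\<close> is 0 if \<kappa> is.\<close>
  define b' where "b' = b + 1"
  have b0: "0 \<le> b" using \<kappa>_nonneg tT by (simp add: b_def)
  then have b: "0 \<le> b" "0 < b'" by (auto simp: b'_def)
  define K where "K = 2 * (2 * \<kappa>) * (T - t) * exp (2 * b' * (T - t))"
  have K: "0 \<le> K" using \<kappa>_nonneg tT by (simp add: K_def)
  have VK: "V C u \<le> ennreal K" if C: "0 \<le> C" and u: "u \<in> {t..T}" for C u
    unfolding K_def
  proof (rule gronwall[where f="V C" and C=C])
    show "V C u \<le> ennreal C" for u
      unfolding V_def
      by (rule order_trans[OF nn_integral_mono[where v="\<lambda>_. ennreal C"]]) (auto simp: emeasure_space_1)
    show "V C u \<le> (\<integral>\<^sup>+r\<in>{t..u}. (ennreal (2 * \<kappa>) + ennreal b' * V C r) \<partial>lborel)" if "u \<in> {t..T}" for u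
    proof -
      have "V C u \<le> (\<integral>\<^sup>+r\<in>{t..u}. (ennreal (2 * \<kappa>) + ennreal b * V C r) \<partial>lborel)"
        unfolding b_def using that C by (intro V_integral_inequality) auto
      also have "\<dots> \<le> (\<integral>\<^sup>+r\<in>{t..u}. (ennreal (2 * \<kappa>) + ennreal b' * V C r) \<partial>lborel)"
        unfolding b'_def by (intro nn_integral_mono mult_right_mono add_left_mono ennreal_leI) auto
      finally show ?thesis .
    qed
  qed (use b \<kappa>_nonneg tT C u in auto)
  show thesis
  proof (rule that[of "2 * \<kappa> + b * K"])
    show "0 \<le> 2 * \<kappa> + b * K" using \<kappa>_nonneg b K by simp
    show "V C u \<le> ennreal ((2 * \<kappa> + b * K) * (u - t))" if "0 \<le> C" "u \<in> {t..T}" for C u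
    proof -
      have "V C u \<le> (\<integral>\<^sup>+r\<in>{t..u}. (ennreal (2 * \<kappa>) + ennreal b * V C r) \<partial>lborel)"
        unfolding b_def using that by (intro V_integral_inequality) auto
      also have "\<dots> \<le> (\<integral>\<^sup>+r\<in>{t..u}. ennreal (2 * \<kappa> + b * K) \<partial>lborel)"
      proof (rule nn_integral_mono)
        fix r
        show "(ennreal (2 * \<kappa>) + ennreal b * V C r) * indicator {t..u} r \<le> ennreal (2 * \<kappa> + b * K) * indicator {t..u} r"
        proof (cases "r \<in> {t..u}")
          case True
          then have "V C r \<le> ennreal K" using that by (intro VK) auto
          then have "ennreal (2 * \<kappa>) + ennreal b * V C r \<le> ennreal (2 * \<kappa>) + ennreal b * ennreal K"
            by (intro add_left_mono mult_left_mono) auto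
          also have "\<dots> = ennreal (2 * \<kappa> + b * K)"
            using \<kappa>_nonneg b K by (simp add: ennreal_mult)
          finally show ?thesis using True by simp
        qed simp
      qed
      also have "\<dots> = ennreal ((2 * \<kappa> + b * K) * (u - t))"
        using that \<kappa>_nonneg b K by (simp add: nn_integral_cmult_indicator ennreal_mult del: ennreal_plus)
      finally show ?thesis .
    qed
  qed
qed

text \<open>Since the bound on \<open>V\<close> is uniform in the cutoff, letting it grow bounds the
  mean of \<open>Q\<close>. With this finite the Ito bound applies without localization, and the
  displacement follows.\<close>

lemma moment_bounds:
  assumes tT: "t \<le> T"
  obtains c where "0 \<le> c"
    "\<And>u. u \<in> {t..T} \<Longrightarrow> (\<integral>\<^sup>+\<omega>. Q u \<omega> \<partial>M) \<le> ennreal (c * (u - t))"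
    "\<And>u. u \<in> {t..T} \<Longrightarrow> (\<integral>\<^sup>+\<omega>. ennreal ((norm (X u \<omega> - x0))\<^sup>2) \<partial>M) \<le> ennreal (c * (u - t))"
proof -
  obtain c where c: "0 \<le> c" "\<And>C u. 0 \<le> C \<Longrightarrow> u \<in> {t..T} \<Longrightarrow> V C u \<le> ennreal (c * (u - t))"
    using V_bound[OF tT] by blast
  have EQ: "(\<integral>\<^sup>+\<omega>. Q u \<omega> \<partial>M) \<le> ennreal (c * (u - t))" if u: "u \<in> {t..T}" for u
  proof (rule nn_integral_fatou_bound[where f'="\<lambda>n \<omega>. min (ennreal (real n)) (Q u \<omega>)" and c="\<lambda>_. ennreal (c * (u - t))"])
    show "(\<integral>\<^sup>+\<omega>. min (ennreal (real n)) (Q u \<omega>) \<partial>M) \<le> ennreal (c * (u - t))" for n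
      using c(2)[of "real n" u] u by (simp add: V_def)
    show "AE \<omega> in M. Q u \<omega> \<le> liminf (\<lambda>n. min (ennreal (real n)) (Q u \<omega>))"
      using Q_finite[of u]
    proof eventually_elim
      case (elim \<omega>)
      then obtain N where N: "Q u \<omega> < of_nat N" using ennreal_Ex_less_of_nat by auto
      have "\<forall>\<^sub>F n in sequentially. Q u \<omega> \<le> min (ennreal (real n)) (Q u \<omega>)"
        using eventually_ge_at_top[of N]
      proof eventually_elim
        case (elim n)
        then have "Q u \<omega> < of_nat n" using N by (meson of_nat_mono order_less_le_trans)
        then show ?case by (simp add: ennreal_of_nat_eq_real_of_nat less_imp_le)
      qed
      then show ?case by (rule Liminf_bounded)
    qed
  qed auto
  \<comment> \<open>The weights \<open>T - t\<close> of the drift and 2 of the noise; as their sum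
    is at least 1, \<open>c'\<close> also serves for the mean of \<open>Q\<close>.\<close>
  define c' where "c' = (T - t + 2) * c"
  have cc': "c \<le> c'" using c tT mult_right_mono[of 1 "T - t + 2" c] by (simp add: c'_def)
  show thesis
  proof (rule that[of c'])
    show "0 \<le> c'" using c cc' by simp
    show "(\<integral>\<^sup>+\<omega>. Q u \<omega> \<partial>M) \<le> ennreal (c' * (u - t))" if "u \<in> {t..T}" for u
      using EQ[OF that] by (rule order_trans) (use that cc' in \<open>auto intro!: ennreal_leI mult_right_mono\<close>)
    show "(\<integral>\<^sup>+\<omega>. ennreal ((norm (X u \<omega> - x0))\<^sup>2) \<partial>M) \<le> ennreal (c' * (u - t))" if u: "u \<in> {t..T}" for u
    proof -
      have tu: "t \<le> u" using u by simp
      obtain I where ito: "is_ito_integral M F B t u (\<lambda>r \<omega>. \<gamma> (X r \<omega>)) I"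
        and I: "AE \<omega> in M. set_integrable lborel {t..u} (\<lambda>r. \<beta> (X r \<omega>))"
        "AE \<omega> in M. X u \<omega> = x0 + (LINT r:{t..u}|lborel. \<beta> (X r \<omega>)) + I \<omega>"
        by (rule ito_representation[OF tu])
      have [measurable]: "I \<in> borel_measurable M" using ito by (simp add: is_ito_integral_def)
      let ?G = "\<lambda>\<omega>. sq_int t u (\<lambda>r. \<gamma> (X r \<omega>))"
      have Gm: "?G \<in> borel_measurable M"
        using progressive_\<gamma> tu by (rule progressive_square_integral_measurable)
      have G: "2 * (\<integral>\<^sup>+\<omega>. ?G \<omega> \<partial>M) \<le> (\<integral>\<^sup>+\<omega>. Q u \<omega> \<partial>M)"
        unfolding nn_integral_cmult[OF Gm, symmetric]
        using square_integral_le_Q(2)[OF tu] by (intro nn_integral_mono)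
      have fin: "(\<integral>\<^sup>+\<omega>. ?G \<omega> \<partial>M) < \<infinity>"
      proof -
        have "(\<integral>\<^sup>+\<omega>. ?G \<omega> \<partial>M) \<le> 2 * (\<integral>\<^sup>+\<omega>. ?G \<omega> \<partial>M)"
          using mult_right_mono[of 1 "2::ennreal" "\<integral>\<^sup>+\<omega>. ?G \<omega> \<partial>M"] by simp
        also have "\<dots> \<le> ennreal (c * (u - t))" using G EQ[OF u] by (rule order_trans)
        finally show ?thesis by (simp add: le_less_trans)
      qed
      have "(\<integral>\<^sup>+\<omega>. ennreal ((norm (X u \<omega> - x0))\<^sup>2) \<partial>M) \<le>
          (\<integral>\<^sup>+\<omega>. ennreal (u - t) * Q u \<omega> + 2 * ennreal ((norm (I \<omega>))\<^sup>2) \<partial>M)"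
        using displacement_le[OF tu I] by (rule nn_integral_mono_AE)
      also have "\<dots> = ennreal (u - t) * (\<integral>\<^sup>+\<omega>. Q u \<omega> \<partial>M) + 2 * (\<integral>\<^sup>+\<omega>. ennreal ((norm (I \<omega>))\<^sup>2) \<partial>M)"
      proof -
        have m: "(\<lambda>\<omega>. ennreal ((norm (I \<omega>))\<^sup>2)) \<in> borel_measurable M" by measurable
        show ?thesis
          by (simp only: nn_integral_cmult[OF m] nn_integral_cmult[OF Q_measurable]
              nn_integral_add[OF borel_measurable_times_ennreal[OF borel_measurable_const Q_measurable]
                borel_measurable_times_ennreal[OF borel_measurable_const m]])
      qed
      also have "\<dots> \<le> ennreal (T - t) * (\<integral>\<^sup>+\<omega>. Q u \<omega> \<partial>M) + 2 * (\<integral>\<^sup>+\<omega>. Q u \<omega> \<partial>M)"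
      proof (intro add_mono mult_left_mono mult_right_mono ennreal_leI)
        show "(\<integral>\<^sup>+\<omega>. ennreal ((norm (I \<omega>))\<^sup>2) \<partial>M) \<le> (\<integral>\<^sup>+\<omega>. Q u \<omega> \<partial>M)"
          using ito_integral_bound[OF ito t_nonneg tu fin] G by (rule order_trans)
      qed (use u in auto)
      also have "\<dots> = ennreal (T - t + 2) * (\<integral>\<^sup>+\<omega>. Q u \<omega> \<partial>M)"
        using tT by (simp add: distrib_right)
      also have "\<dots> \<le> ennreal (T - t + 2) * ennreal (c * (u - t))"
        using EQ[OF u] by (intro mult_left_mono) auto
      also have "\<dots> = ennreal (c' * (u - t))"
        using tT c u unfolding c'_def by (simp add: ennreal_mult[symmetric] mult.assoc del: ennreal_plus)
      finally show ?thesis .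
    qed
  qed
qed

end

section \<open>Short-time asymptotics\<close>

context lipschitz_diffusion
begin

text \<open>Meant for a coefficient minus its value at \<open>x0\<close>. One factor
  \<open>h\<close> is the length of the time interval, the other the mean squared
  displacement.\<close>

lemma increment_error_le:
  fixes f :: "real \<Rightarrow> 'w \<Rightarrow> 'z::real_normed_vector"
  assumes f: "progressive F t f" "\<And>r \<omega>. t \<le> r \<Longrightarrow> \<omega> \<in> space M \<Longrightarrow> norm (f r \<omega>) \<le> L * norm (X r \<omega> - x0)"
    and h: "0 \<le> h" and c: "0 \<le> c"
    and mom: "\<And>r. r \<in> {t..t + h} \<Longrightarrow> (\<integral>\<^sup>+\<omega>. ennreal ((norm (X r \<omega> - x0))\<^sup>2) \<partial>M) \<le> ennreal (c * (r - t))"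
  shows "(\<integral>\<^sup>+\<omega>. sq_int t (t + h) (\<lambda>r. f r \<omega>) \<partial>M) \<le> ennreal (L\<^sup>2 * c * h\<^sup>2)"
proof -
  have th: "t \<le> t + h" using h by simp
  note progressive_measurable[OF f(1) th, measurable]
  let ?f = "\<lambda>r \<omega>. ennreal ((norm (indicator {t..t + h} r *\<^sub>R f r \<omega>))\<^sup>2)"
  have "(\<integral>\<^sup>+\<omega>. sq_int t (t + h) (\<lambda>r. f r \<omega>) \<partial>M) = (\<integral>\<^sup>+\<omega>. (\<integral>\<^sup>+r. ?f r \<omega> \<partial>lborel) \<partial>M)"
    by (intro nn_integral_cong) (auto simp: indicator_def)
  also have "\<dots> = (\<integral>\<^sup>+r. (\<integral>\<^sup>+\<omega>. ?f r \<omega> \<partial>M) \<partial>lborel)"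
  proof -
    interpret pair_sigma_finite lborel M ..
    have "(\<lambda>(r, \<omega>). ?f r \<omega>) \<in> borel_measurable (borel \<Otimes>\<^sub>M M)" by measurable
    then show ?thesis by (intro Fubini') simp
  qed
  also have "\<dots> \<le> (\<integral>\<^sup>+r\<in>{t..t + h}. ennreal (L\<^sup>2 * c * h) \<partial>lborel)"
  proof (rule nn_integral_mono)
    fix r
    show "(\<integral>\<^sup>+\<omega>. ?f r \<omega> \<partial>M) \<le> ennreal (L\<^sup>2 * c * h) * indicator {t..t + h} r"
    proof (cases "r \<in> {t..t + h}")
      case True
      then have tr: "t \<le> r" by simp
      have m: "(\<lambda>\<omega>. ennreal ((norm (X r \<omega> - x0))\<^sup>2)) \<in> borel_measurable M"
        using X_measurable[OF tr] by measurable
      have "(\<integral>\<^sup>+\<omega>. ?f r \<omega> \<partial>M) \<le> (\<integral>\<^sup>+\<omega>. ennreal (L\<^sup>2) * ennreal ((norm (X r \<omega> - x0))\<^sup>2) \<partial>M)"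
      proof (rule nn_integral_mono)
        fix \<omega> assume "\<omega> \<in> space M"
        then have "(norm (f r \<omega>))\<^sup>2 \<le> (L * norm (X r \<omega> - x0))\<^sup>2"
          using f(2)[OF tr] by (intro power_mono) auto
        then show "?f r \<omega> \<le> ennreal (L\<^sup>2) * ennreal ((norm (X r \<omega> - x0))\<^sup>2)"
          using True by (simp add: ennreal_mult[symmetric] power_mult_distrib ennreal_leI)
      qed
      also have "\<dots> = ennreal (L\<^sup>2) * (\<integral>\<^sup>+\<omega>. ennreal ((norm (X r \<omega> - x0))\<^sup>2) \<partial>M)"
        by (rule nn_integral_cmult[OF m])
      also have "\<dots> \<le> ennreal (L\<^sup>2) * ennreal (c * (r - t))"
        using mom[OF True] by (intro mult_left_mono) auto
      also have "\<dots> = ennreal (L\<^sup>2 * (c * (r - t)))"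
        using True c by (simp add: ennreal_mult)
      also have "\<dots> \<le> ennreal (L\<^sup>2 * c * h)"
        using True c mult_left_mono[of "r - t" h "L\<^sup>2 * c"] by (intro ennreal_leI) (simp add: mult.assoc)
      finally show ?thesis using True by simp
    qed simp
  qed
  also have "\<dots> = ennreal (L\<^sup>2 * c * h\<^sup>2)"
    using h c by (simp add: nn_integral_cmult_indicator ennreal_mult[symmetric] power2_eq_square mult.assoc L_nonneg)
  finally show ?thesis .
qed

text \<open>
  Freezing the coefficients at \<open>x0\<close>: \<open>R\<close> is the drift error and \<open>J\<close> the Ito integral of
  \<open>\<gamma> (X r) - \<gamma> x0\<close>. Only \<open>J\<close> has the same order as the drift term \<open>h *\<^sub>R \<beta> x0\<close>, but its mean is 0.
\<close>

definition short_time_errors :: "real \<Rightarrow> real \<Rightarrow> ('w \<Rightarrow> real^'n) \<Rightarrow> ('w \<Rightarrow> real^'n) \<Rightarrow> bool" where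
  "short_time_errors c h R J \<longleftrightarrow>
      R \<in> borel_measurable M \<and> J \<in> borel_measurable M \<and>
      (\<forall>\<omega>. X (t + h) \<omega> - x0 = h *\<^sub>R \<beta> x0 + R \<omega> + J \<omega> + \<gamma> x0 *v (B (t + h) \<omega> - B t \<omega>)) \<and>
      (\<forall>i. expectation (\<lambda>\<omega>. J \<omega> $ i) = 0) \<and>
      (\<integral>\<^sup>+\<omega>. ennreal ((norm (J \<omega>))\<^sup>2) \<partial>M) \<le> ennreal (c * h\<^sup>2) \<and>
      (\<integral>\<^sup>+\<omega>. ennreal ((norm (R \<omega>))\<^sup>2) \<partial>M) \<le> ennreal (c * h ^ 3)"

text \<open>Both frozen coefficients have errors of mean square integral \<open>O(h^2)\<close>. The
  Ito bound passes this order on to \<open>J\<close>, while Cauchy-Schwarz in time gains another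
  factor \<open>h\<close> for \<open>R\<close>.\<close>

lemma short_time_expansion:
  obtains c where "0 \<le> c" "\<And>h. 0 < h \<Longrightarrow> h \<le> 1 \<Longrightarrow> \<exists>R J. short_time_errors c h R J"
proof -
  have t1: "t \<le> t + 1" by simp
  obtain c where c: "0 \<le> c"
    and mom: "\<And>u. u \<in> {t..t + 1} \<Longrightarrow> (\<integral>\<^sup>+\<omega>. ennreal ((norm (X u \<omega> - x0))\<^sup>2) \<partial>M) \<le> ennreal (c * (u - t))"
    by (rule moment_bounds[OF t1]) (rule that; assumption)
  show thesis
  \<comment> \<open>The 2 is the loss in \<open>ito_integral_bound\<close>; the estimate for
    \<open>R\<close> would do with half of this.\<close>
  proof (rule that[of "2 * (L\<^sup>2 * c)"])
    show "0 \<le> 2 * (L\<^sup>2 * c)" using c by simp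
    fix h :: real assume h: "0 < h" "h \<le> 1"
    let ?u = "t + h"
    have tu: "t \<le> ?u" using h by simp
    obtain I where ito: "is_ito_integral M F B t ?u (\<lambda>r \<omega>. \<gamma> (X r \<omega>)) I"
      and I: "AE \<omega> in M. set_integrable lborel {t..?u} (\<lambda>r. \<beta> (X r \<omega>))"
      "AE \<omega> in M. X ?u \<omega> = x0 + (LINT r:{t..?u}|lborel. \<beta> (X r \<omega>)) + I \<omega>"
      by (rule ito_representation[OF tu])
    have Im [measurable]: "I \<in> borel_measurable M" using ito by (simp add: is_ito_integral_def)
    note Xm [measurable] = X_measurable[OF tu]
    define J where "J \<omega> = I \<omega> - \<gamma> x0 *v (B ?u \<omega> - B t \<omega>)" for \<omega>
    \<comment> \<open>Taken as the remainder, so that the expansion holds for every \<omega>; only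
      almost surely is it the time integral of the drift error.\<close>
    define R where "R \<omega> = X ?u \<omega> - x0 - h *\<^sub>R \<beta> x0 - I \<omega>" for \<omega>
    have itoJ: "is_ito_integral M F B t ?u (\<lambda>r \<omega>. \<gamma> (X r \<omega>) - \<gamma> x0) J"
      unfolding J_def using ito t_nonneg tu by (rule is_ito_integral_shift)
    have Jm: "J \<in> borel_measurable M" using itoJ by (simp add: is_ito_integral_def)
    have Rm: "R \<in> borel_measurable M" unfolding R_def by measurable
    have mom': "\<And>r. r \<in> {t..?u} \<Longrightarrow> (\<integral>\<^sup>+\<omega>. ennreal ((norm (X r \<omega> - x0))\<^sup>2) \<partial>M) \<le> ennreal (c * (r - t))"
      using mom h by auto
    have lip: "norm (\<beta> (X r \<omega>) - \<beta> x0) \<le> L * norm (X r \<omega> - x0)" "norm (\<gamma> (X r \<omega>) - \<gamma> x0) \<le> L * norm (X r \<omega> - x0)"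
      if "t \<le> r" "\<omega> \<in> space M" for r \<omega>
      using lipschitz_norm[OF X_in[OF that]] by auto
    have E\<gamma>: "(\<integral>\<^sup>+\<omega>. sq_int t ?u (\<lambda>r. \<gamma> (X r \<omega>) - \<gamma> x0) \<partial>M) \<le> ennreal (L\<^sup>2 * c * h\<^sup>2)"
      using progressive_\<gamma> lip(2) h c mom' by (intro increment_error_le progressive_diff_const) auto
    have E\<beta>: "(\<integral>\<^sup>+\<omega>. sq_int t ?u (\<lambda>r. \<beta> (X r \<omega>) - \<beta> x0) \<partial>M) \<le> ennreal (L\<^sup>2 * c * h\<^sup>2)"
      using progressive_\<beta> lip(1) h c mom' by (intro increment_error_le progressive_diff_const) auto
    have fin: "(\<integral>\<^sup>+\<omega>. sq_int t ?u (\<lambda>r. \<gamma> (X r \<omega>) - \<gamma> x0) \<partial>M) < \<infinity>"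
      using E\<gamma> by (simp add: le_less_trans)
    have J2: "(\<integral>\<^sup>+\<omega>. ennreal ((norm (J \<omega>))\<^sup>2) \<partial>M) \<le> ennreal (2 * (L\<^sup>2 * c) * h\<^sup>2)"
    proof -
      have "(\<integral>\<^sup>+\<omega>. ennreal ((norm (J \<omega>))\<^sup>2) \<partial>M) \<le> 2 * ennreal (L\<^sup>2 * c * h\<^sup>2)"
        using ito_integral_bound[OF itoJ t_nonneg tu fin] mult_left_mono[OF E\<gamma>, of 2] by (rule order_trans) simp
      also have "\<dots> = ennreal (2 * (L\<^sup>2 * c) * h\<^sup>2)"
        using c by (simp add: ennreal_mult mult.assoc)
      finally show ?thesis .
    qed
    have R2: "(\<integral>\<^sup>+\<omega>. ennreal ((norm (R \<omega>))\<^sup>2) \<partial>M) \<le> ennreal (2 * (L\<^sup>2 * c) * h ^ 3)"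
    proof -
      have "(\<integral>\<^sup>+\<omega>. ennreal ((norm (R \<omega>))\<^sup>2) \<partial>M) \<le>
        (\<integral>\<^sup>+\<omega>. ennreal h * sq_int t ?u (\<lambda>r. \<beta> (X r \<omega>) - \<beta> x0) \<partial>M)"
      proof (rule nn_integral_mono_AE)
        show "AE \<omega> in M. ennreal ((norm (R \<omega>))\<^sup>2) \<le>
          ennreal h * sq_int t ?u (\<lambda>r. \<beta> (X r \<omega>) - \<beta> x0)"
          using I
        proof eventually_elim
          case (elim \<omega>)
          have const: "set_integrable lborel {t..?u} (\<lambda>r. \<beta> x0)"
            by (simp add: set_integrable_def emeasure_lborel_Icc_eq)
          have "R \<omega> = (LINT r:{t..?u}|lborel. \<beta> (X r \<omega>)) - (LINT r:{t..?u}|lborel. \<beta> x0)"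
            using elim(2) h by (simp add: R_def set_lebesgue_integral_def)
          also have "\<dots> = (LINT r:{t..?u}|lborel. \<beta> (X r \<omega>) - \<beta> x0)"
            using elim(1) const by (rule set_integral_diff(2)[symmetric])
          finally show ?case
            using norm_set_integral_square_le[OF set_integral_diff(1)[OF elim(1) const] tu] by simp
        qed
      qed
      also have "\<dots> = ennreal h * (\<integral>\<^sup>+\<omega>. sq_int t ?u (\<lambda>r. \<beta> (X r \<omega>) - \<beta> x0) \<partial>M)"
        using progressive_diff_const[OF progressive_\<beta>] tu
        by (intro nn_integral_cmult progressive_square_integral_measurable)
      also have "\<dots> \<le> ennreal h * ennreal (L\<^sup>2 * c * h\<^sup>2)"
        using E\<beta> by (intro mult_left_mono) auto
      also have "\<dots> = ennreal (L\<^sup>2 * c * h ^ 3)"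
        using h c by (simp add: ennreal_mult[symmetric] power2_eq_square power3_eq_cube mult_ac L_nonneg)
      also have "\<dots> \<le> ennreal (2 * (L\<^sup>2 * c) * h ^ 3)"
        using h c by (intro ennreal_leI) simp
      finally show ?thesis .
    qed
    show "\<exists>R J. short_time_errors (2 * (L\<^sup>2 * c)) h R J"
      unfolding short_time_errors_def
    proof (rule exI[of _ R], rule exI[of _ J], intro conjI allI)
      show "X ?u \<omega> - x0 = h *\<^sub>R \<beta> x0 + R \<omega> + J \<omega> + \<gamma> x0 *v (B ?u \<omega> - B t \<omega>)" for \<omega>
        by (simp add: R_def J_def)
    qed (rule Rm Jm J2 R2 ito_integral_mean_zero(2)[OF itoJ t_nonneg tu fin])+
  qed
qed

text \<open>Here \<open>h\<close> may be arbitrarily large, so the moment bound is taken on the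
  horizon \<open>t + h\<close> instead of the unit horizon of the expansion.\<close>

lemma displacement_integrable:
  assumes "0 < h"
  shows "integrable M (\<lambda>\<omega>. X (t + h) \<omega> $ i - x0 $ i)"
    and "integrable M (\<lambda>\<omega>. (X (t + h) \<omega> $ i - x0 $ i) * (X (t + h) \<omega> $ j - x0 $ j))"
proof -
  have th: "t \<le> t + h" using assms by simp
  obtain c where c0: "0 \<le> c"
    and mom: "\<And>u. u \<in> {t..t + h} \<Longrightarrow> (\<integral>\<^sup>+\<omega>. ennreal ((norm (X u \<omega> - x0))\<^sup>2) \<partial>M) \<le> ennreal (c * (u - t))"
    by (rule moment_bounds[OF th]) (rule that; assumption)
  have c: "(\<integral>\<^sup>+\<omega>. ennreal ((norm (X (t + h) \<omega> - x0))\<^sup>2) \<partial>M) \<le> ennreal (c * (t + h - t))"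
    using th by (intro mom) simp
  have m: "(\<lambda>\<omega>. X (t + h) \<omega> - x0) \<in> borel_measurable M"
    using X_measurable[OF th] by simp
  have "0 \<le> c * (t + h - t)" using c0 assms by simp
  from expectation_square_component_le(3,4)[OF m c this]
  show "integrable M (\<lambda>\<omega>. X (t + h) \<omega> $ i - x0 $ i)"
    and "integrable M (\<lambda>\<omega>. (X (t + h) \<omega> $ i - x0 $ i) * (X (t + h) \<omega> $ j - x0 $ j))" by simp_all
qed

lemma linear_increment_moments:
  fixes G :: "real^'m^'n"
  assumes "0 < h"
  defines "Y \<equiv> \<lambda>\<omega>. G *v (B (t + h) \<omega> - B t \<omega>)"
  shows "integrable M (\<lambda>\<omega>. Y \<omega> $ i)" "expectation (\<lambda>\<omega>. Y \<omega> $ i) = 0"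
    and "integrable M (\<lambda>\<omega>. Y \<omega> $ i * Y \<omega> $ j)"
    and "expectation (\<lambda>\<omega>. Y \<omega> $ i * Y \<omega> $ j) = h * (G ** transpose G) $ i $ j"
proof -
  have th: "t \<le> t + h" using assms(1) by simp
  note m = increment_moments[OF t_nonneg th]
  have Y: "Y \<omega> $ i = (\<Sum>k\<in>UNIV. G $ i $ k * (B (t + h) \<omega> - B t \<omega>) $ k)" for \<omega> i
    by (simp add: Y_def matrix_vector_mult_def)
  have YY: "Y \<omega> $ i * Y \<omega> $ j = (\<Sum>k\<in>UNIV. \<Sum>l\<in>UNIV. G $ i $ k * G $ j $ l *
      ((B (t + h) \<omega> - B t \<omega>) $ k * (B (t + h) \<omega> - B t \<omega>) $ l))" for \<omega>
    unfolding Y sum_product by (intro sum.cong refl) (simp only: mult_ac)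
  show "integrable M (\<lambda>\<omega>. Y \<omega> $ i)"
    unfolding Y by (intro Bochner_Integration.integrable_sum integrable_mult_right m)
  show "expectation (\<lambda>\<omega>. Y \<omega> $ i) = 0"
    unfolding Y
    by (subst Bochner_Integration.integral_sum, intro integrable_mult_right m)
       (intro sum.neutral ballI, simp only: integral_mult_right_zero m mult_zero_right)
  show "integrable M (\<lambda>\<omega>. Y \<omega> $ i * Y \<omega> $ j)"
    unfolding YY by (intro Bochner_Integration.integrable_sum integrable_mult_right m)
  have "expectation (\<lambda>\<omega>. Y \<omega> $ i * Y \<omega> $ j) =
     (\<Sum>k\<in>UNIV. \<Sum>l\<in>UNIV. G $ i $ k * G $ j $ l * (if k = l then t + h - t else 0))"
    unfolding YY
    by (subst Bochner_Integration.integral_sum, intro Bochner_Integration.integrable_sum integrable_mult_right m,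
        intro sum.cong refl, subst Bochner_Integration.integral_sum, intro integrable_mult_right m)
       (simp only: integral_mult_right_zero m)
  also have "\<dots> = h * (G ** transpose G) $ i $ j"
    by (simp add: if_distrib matrix_matrix_mult_def transpose_def sum_distrib_left mult_ac cong: if_cong)
  finally show "expectation (\<lambda>\<omega>. Y \<omega> $ i * Y \<omega> $ j) = h * (G ** transpose G) $ i $ j" .
qed

text \<open>The terms \<open>J\<close> and the Brownian increment, whose sizes \<open>h\<close> and
  \<open>sqrt h\<close> would survive division by \<open>h\<close>, have mean 0. What remains is the
  mean of \<open>R\<close>, at most \<open>sqrt (c * h ^ 3)\<close>, which leaves an error
  \<open>sqrt (c * h)\<close>.\<close>

lemma drift_limit:
  "((\<lambda>h. expectation (\<lambda>\<omega>. (X (t + h) \<omega> $ i - x0 $ i) / h)) \<longlongrightarrow> \<beta> x0 $ i) (at_right 0)"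
proof -
  obtain c where c: "0 \<le> c" and expansion: "\<And>h. 0 < h \<Longrightarrow> h \<le> 1 \<Longrightarrow> \<exists>R J. short_time_errors c h R J"
    by (rule short_time_expansion) (rule that; assumption)
  have bound: "norm (expectation (\<lambda>\<omega>. (X (t + h) \<omega> $ i - x0 $ i) / h) - \<beta> x0 $ i) \<le> sqrt (c * h)"
    if h: "0 < h" "h \<le> 1" for h
  proof -
    obtain R J where R: "R \<in> borel_measurable M" and J: "J \<in> borel_measurable M"
      and eq: "\<And>\<omega>. X (t + h) \<omega> - x0 = h *\<^sub>R \<beta> x0 + R \<omega> + J \<omega> + \<gamma> x0 *v (B (t + h) \<omega> - B t \<omega>)"
      and J0: "\<And>i. expectation (\<lambda>\<omega>. J \<omega> $ i) = 0"
      and J2: "(\<integral>\<^sup>+\<omega>. ennreal ((norm (J \<omega>))\<^sup>2) \<partial>M) \<le> ennreal (c * h\<^sup>2)"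
      and R2: "(\<integral>\<^sup>+\<omega>. ennreal ((norm (R \<omega>))\<^sup>2) \<partial>M) \<le> ennreal (c * h ^ 3)"
      using expansion[OF h] unfolding short_time_errors_def by blast
    have nn: "0 \<le> c * h\<^sup>2" "0 \<le> c * h ^ 3" using c h by auto
    note RR = expectation_square_component_le[OF R R2 nn(2)]
    note JJ = expectation_square_component_le[OF J J2 nn(1)]
    note Y = linear_increment_moments[OF h(1), of "\<gamma> x0"]
    have comp: "X (t + h) \<omega> $ i - x0 $ i = h * \<beta> x0 $ i + R \<omega> $ i + J \<omega> $ i + (\<gamma> x0 *v (B (t + h) \<omega> - B t \<omega>)) $ i" for \<omega>
      using arg_cong[OF eq[of \<omega>], of "\<lambda>x. x $ i"] by simp
    have "expectation (\<lambda>\<omega>. X (t + h) \<omega> $ i - x0 $ i) = h * \<beta> x0 $ i + expectation (\<lambda>\<omega>. R \<omega> $ i)"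
      unfolding comp using RR(4)[of i] JJ(4)[of i] Y(1,2)[of i] J0[of i]
      by (simp add: prob_space del: matrix_vector_mult_diff_distrib)
    then have "expectation (\<lambda>\<omega>. (X (t + h) \<omega> $ i - x0 $ i) / h) - \<beta> x0 $ i = expectation (\<lambda>\<omega>. R \<omega> $ i) / h"
      using h by (simp add: field_simps)
    moreover have "\<bar>expectation (\<lambda>\<omega>. R \<omega> $ i)\<bar> \<le> sqrt (c * h ^ 3)"
    proof (rule expectation_abs_le_sqrt[OF RR(4)])
      show "integrable M (\<lambda>\<omega>. (R \<omega> $ i)\<^sup>2)" using RR(3)[of i i] by (simp add: power2_eq_square)
      then have "expectation (\<lambda>\<omega>. (R \<omega> $ i)\<^sup>2) \<le> expectation (\<lambda>\<omega>. (norm (R \<omega>))\<^sup>2)"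
        using RR(1) component_le_norm_cart[of "R _" i]
        by (intro integral_mono) (auto intro: power2_le_imp_le simp: abs_le_square_iff[symmetric])
      then show "expectation (\<lambda>\<omega>. (R \<omega> $ i)\<^sup>2) \<le> c * h ^ 3" using RR(2) by simp
    qed
    moreover have "sqrt (c * h ^ 3) = sqrt (c * h) * h"
      using h by (simp add: power3_eq_cube real_sqrt_mult)
    ultimately show ?thesis using h by (simp add: field_simps)
  qed
  have "((\<lambda>h. sqrt (c * h)) \<longlongrightarrow> sqrt (c * 0)) (at_right 0)"
    by (intro tendsto_intros)
  then have lim: "((\<lambda>h. sqrt (c * h)) \<longlongrightarrow> 0) (at_right 0)" by simp
  have "\<forall>\<^sub>F h in at_right (0::real). h \<in> {0<..<1}" by (rule eventually_at_right_real) simp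
  then have "\<forall>\<^sub>F h in at_right 0. norm (expectation (\<lambda>\<omega>. (X (t + h) \<omega> $ i - x0 $ i) / h) - \<beta> x0 $ i) \<le> sqrt (c * h)"
    by eventually_elim (rule bound; simp)
  from Lim_null_comparison[OF this lim] show ?thesis by (simp add: LIM_zero_iff)
qed

text \<open>In L2 the Brownian part \<open>Y\<close> has size \<open>sqrt h\<close>, and the rest
  \<open>P\<close> has size \<open>h\<close>. Every product involving \<open>P\<close> therefore has
  mean of order at most \<open>h * sqrt h\<close> and disappears after division by \<open>h\<close>,
  leaving the exact covariance of \<open>Y\<close>.\<close>

lemma diffusion_limit:
  "((\<lambda>h. expectation (\<lambda>\<omega>. (X (t + h) \<omega> $ i - x0 $ i) * (X (t + h) \<omega> $ j - x0 $ j) / h)) \<longlongrightarrow>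
    (\<gamma> x0 ** transpose (\<gamma> x0)) $ i $ j) (at_right 0)"
proof -
  let ?G = "\<gamma> x0 ** transpose (\<gamma> x0)"
  obtain c where c: "0 \<le> c" and expansion: "\<And>h. 0 < h \<Longrightarrow> h \<le> 1 \<Longrightarrow> \<exists>R J. short_time_errors c h R J"
    by (rule short_time_expansion) (rule that; assumption)
  \<comment> \<open>Bounds the mean square of \<open>P\<close> divided by \<open>h^2\<close>: the
    drift enters with factor 2, \<open>R\<close> and \<open>J\<close> with \<open>4 * c\<close>
    each, where \<open>h ^ 3 \<le> h^2\<close> is used for \<open>R\<close>.\<close>
  define K where "K = 2 * (norm (\<beta> x0))\<^sup>2 + 8 * c"
  have K: "0 \<le> K" using c by (simp add: K_def)
  \<comment> \<open>\<open>K\<close> is counted twice, once for the product of two components of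
    \<open>P\<close> and once for the mixed products; the diagonal entries come from the squares of
    the components of \<open>Y\<close>.\<close>
  define K' where "K' = 2 * K + ?G $ i $ i + ?G $ j $ j"
  have bound: "norm (expectation (\<lambda>\<omega>. (X (t + h) \<omega> $ i - x0 $ i) * (X (t + h) \<omega> $ j - x0 $ j) / h) - ?G $ i $ j) \<le> K' * sqrt h"
    if h: "0 < h" "h \<le> 1" for h
  proof -
    obtain R J where R [measurable]: "R \<in> borel_measurable M" and J [measurable]: "J \<in> borel_measurable M"
      and eq: "\<And>\<omega>. X (t + h) \<omega> - x0 = h *\<^sub>R \<beta> x0 + R \<omega> + J \<omega> + \<gamma> x0 *v (B (t + h) \<omega> - B t \<omega>)"
      and J2: "(\<integral>\<^sup>+\<omega>. ennreal ((norm (J \<omega>))\<^sup>2) \<partial>M) \<le> ennreal (c * h\<^sup>2)"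
      and R2: "(\<integral>\<^sup>+\<omega>. ennreal ((norm (R \<omega>))\<^sup>2) \<partial>M) \<le> ennreal (c * h ^ 3)"
      using expansion[OF h] unfolding short_time_errors_def by blast
    have nn: "0 \<le> c * h\<^sup>2" "0 \<le> c * h ^ 3" using c h by auto
    note RR = expectation_square_component_le[OF R R2 nn(2)]
    note JJ = expectation_square_component_le[OF J J2 nn(1)]
    define P where "P \<omega> = h *\<^sub>R \<beta> x0 + (R \<omega> + J \<omega>)" for \<omega>
    define Y where "Y \<omega> = \<gamma> x0 *v (B (t + h) \<omega> - B t \<omega>)" for \<omega>
    note YY = linear_increment_moments[OF h(1), of "\<gamma> x0", folded Y_def]
    have [measurable]: "P \<in> borel_measurable M" unfolding P_def by measurable
    have Ym: "(\<lambda>\<omega>. Y \<omega> $ i) \<in> borel_measurable M" for i using YY(1) by auto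
    have comp: "X (t + h) \<omega> $ i - x0 $ i = P \<omega> $ i + Y \<omega> $ i" for \<omega> i
      using arg_cong[OF eq[of \<omega>], of "\<lambda>x. x $ i"] by (simp add: P_def Y_def)
    have P_le: "(norm (P \<omega>))\<^sup>2 \<le> 2 * h\<^sup>2 * (norm (\<beta> x0))\<^sup>2 + 4 * (norm (R \<omega>))\<^sup>2 + 4 * (norm (J \<omega>))\<^sup>2" for \<omega>
      using norm_square_triangle[of "h *\<^sub>R \<beta> x0" "R \<omega> + J \<omega>"] norm_square_triangle[of "R \<omega>" "J \<omega>"]
      by (simp add: P_def power_mult_distrib)
    have PI: "integrable M (\<lambda>\<omega>. 2 * h\<^sup>2 * (norm (\<beta> x0))\<^sup>2 + 4 * (norm (R \<omega>))\<^sup>2 + 4 * (norm (J \<omega>))\<^sup>2)"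
      using RR(1) JJ(1) by auto
    have P2: "integrable M (\<lambda>\<omega>. (norm (P \<omega>))\<^sup>2)"
    proof (rule Bochner_Integration.integrable_bound[OF PI _ AE_I2])
      show "norm ((norm (P \<omega>))\<^sup>2) \<le> norm (2 * h\<^sup>2 * (norm (\<beta> x0))\<^sup>2 + 4 * (norm (R \<omega>))\<^sup>2 + 4 * (norm (J \<omega>))\<^sup>2)" for \<omega>
        using P_le[of \<omega>] by simp
    qed measurable
    have P2E: "expectation (\<lambda>\<omega>. (norm (P \<omega>))\<^sup>2) \<le> K * h\<^sup>2"
    proof -
      have "expectation (\<lambda>\<omega>. (norm (P \<omega>))\<^sup>2) \<le>
          expectation (\<lambda>\<omega>. 2 * h\<^sup>2 * (norm (\<beta> x0))\<^sup>2 + 4 * (norm (R \<omega>))\<^sup>2 + 4 * (norm (J \<omega>))\<^sup>2)"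
        using P2 PI P_le by (rule integral_mono)
      also have "\<dots> = 2 * h\<^sup>2 * (norm (\<beta> x0))\<^sup>2 + 4 * expectation (\<lambda>\<omega>. (norm (R \<omega>))\<^sup>2) + 4 * expectation (\<lambda>\<omega>. (norm (J \<omega>))\<^sup>2)"
        using RR(1) JJ(1) by (simp add: prob_space)
      also have "\<dots> \<le> 2 * h\<^sup>2 * (norm (\<beta> x0))\<^sup>2 + 4 * (c * h ^ 3) + 4 * (c * h\<^sup>2)"
        using RR(2) JJ(2) by simp
      also have "\<dots> \<le> 2 * h\<^sup>2 * (norm (\<beta> x0))\<^sup>2 + 4 * (c * h\<^sup>2) + 4 * (c * h\<^sup>2)"
        using h c by (intro add_mono mult_left_mono power_decreasing order_refl) auto
      also have "\<dots> = K * h\<^sup>2" by (simp add: K_def algebra_simps)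
      finally show ?thesis .
    qed
    \<comment> \<open>The weight in Young's inequality \<open>2 x y \<le> x^2 / a + a y^2\<close>.
      It balances the two sides: with \<open>x\<close> of size \<open>h\<close> and \<open>y\<close>
      of size \<open>sqrt h\<close>, both have order \<open>h * sqrt h\<close>.\<close>
    let ?a = "sqrt h"
    have a: "0 < ?a" "?a * ?a = h" "?a \<le> 1" using h by auto
    define Z where "Z \<omega> = P \<omega> $ i * P \<omega> $ j + P \<omega> $ i * Y \<omega> $ j + Y \<omega> $ i * P \<omega> $ j" for \<omega>
    define W where "W \<omega> = (norm (P \<omega>))\<^sup>2 + ((norm (P \<omega>))\<^sup>2 / ?a + ?a * (Y \<omega> $ i * Y \<omega> $ i) + ?a * (Y \<omega> $ j * Y \<omega> $ j))" for \<omega>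
    have WI: "integrable M W" unfolding W_def using P2 YY(3) by auto
    have divide: "(p + (b * b) * z) / b = p / b + b * z" if "0 < b" for p b z :: real
      using that by (simp add: add_divide_distrib)
    have ab: "\<bar>x * y\<bar> \<le> (p / ?a + ?a * (y * y)) / 2" if "\<bar>x\<bar> \<le> sqrt p" "0 \<le> p" for x y p :: real
    proof -
      have "x\<^sup>2 \<le> p" using that real_sqrt_pow2[of p] by (metis abs_ge_zero power2_abs power_mono)
      have "0 \<le> (\<bar>x\<bar> - ?a * \<bar>y\<bar>)\<^sup>2" by simp
      also have "\<dots> = x\<^sup>2 - 2 * ?a * \<bar>x * y\<bar> + (?a * ?a) * (y * y)"
        by (simp add: power2_eq_square algebra_simps abs_mult)
      finally have "2 * ?a * \<bar>x * y\<bar> \<le> p + (?a * ?a) * (y * y)" using \<open>x\<^sup>2 \<le> p\<close> by simp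
      then have "2 * \<bar>x * y\<bar> \<le> (p + (?a * ?a) * (y * y)) / ?a"
        using a(1) by (simp only: pos_le_divide_eq mult_ac)
      also have "\<dots> = p / ?a + ?a * (y * y)" by (rule divide[OF a(1)])
      finally show ?thesis by simp
    qed
    have combine: "\<bar>x + y + z\<bar> \<le> n + (m + p + r)"
      if "\<bar>x\<bar> \<le> n" "\<bar>y\<bar> \<le> (m + r) / 2" "\<bar>z\<bar> \<le> (m + p) / 2" "0 \<le> p" "0 \<le> r" for x y z n m p r :: real
      using that abs_triangle_ineq[of "x + y" z] abs_triangle_ineq[of x y] by argo
    have ZW: "\<bar>Z \<omega>\<bar> \<le> W \<omega>" for \<omega>
    proof -
      have P': "\<bar>P \<omega> $ i\<bar> \<le> sqrt ((norm (P \<omega>))\<^sup>2)" for i using component_le_norm_cart[of "P \<omega>" i] by simp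
      have "\<bar>P \<omega> $ i * P \<omega> $ j\<bar> \<le> (norm (P \<omega>))\<^sup>2"
        unfolding abs_mult power2_eq_square by (intro mult_mono component_le_norm_cart) auto
      moreover have "\<bar>P \<omega> $ i * Y \<omega> $ j\<bar> \<le> ((norm (P \<omega>))\<^sup>2 / ?a + ?a * (Y \<omega> $ j * Y \<omega> $ j)) / 2"
        using P' by (intro ab) auto
      moreover have "\<bar>P \<omega> $ j * Y \<omega> $ i\<bar> \<le> ((norm (P \<omega>))\<^sup>2 / ?a + ?a * (Y \<omega> $ i * Y \<omega> $ i)) / 2"
        using P' by (intro ab) auto
      moreover have "0 \<le> ?a * (Y \<omega> $ i * Y \<omega> $ i)" "0 \<le> ?a * (Y \<omega> $ j * Y \<omega> $ j)" using a by auto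
      ultimately show ?thesis unfolding Z_def W_def mult.commute[of "Y \<omega> $ i" "P \<omega> $ j"] by (rule combine)
    qed
    have "Z \<in> borel_measurable M" unfolding Z_def using Ym by measurable
    then have ZI: "integrable M Z"
    proof (rule Bochner_Integration.integrable_bound[OF WI _ AE_I2])
      show "norm (Z \<omega>) \<le> norm (W \<omega>)" for \<omega> using ZW[of \<omega>] by simp
    qed
    have "expectation (\<lambda>\<omega>. (X (t + h) \<omega> $ i - x0 $ i) * (X (t + h) \<omega> $ j - x0 $ j)) = expectation (\<lambda>\<omega>. Z \<omega> + Y \<omega> $ i * Y \<omega> $ j)"
      unfolding comp Z_def by (intro Bochner_Integration.integral_cong refl) (simp add: algebra_simps)
    also have "\<dots> = expectation Z + h * ?G $ i $ j"
      using ZI YY(3,4) by simp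
    finally have "expectation (\<lambda>\<omega>. (X (t + h) \<omega> $ i - x0 $ i) * (X (t + h) \<omega> $ j - x0 $ j) / h) - ?G $ i $ j = expectation Z / h"
      using h by (simp add: field_simps)
    moreover have "\<bar>expectation Z\<bar> \<le> K' * ?a * h"
    proof -
      have "\<bar>expectation Z\<bar> \<le> expectation (\<lambda>\<omega>. \<bar>Z \<omega>\<bar>)" by (rule integral_abs_bound)
      also have "\<dots> \<le> expectation W" using ZI WI ZW by (intro integral_mono) auto
      also have "\<dots> = expectation (\<lambda>\<omega>. (norm (P \<omega>))\<^sup>2) + (expectation (\<lambda>\<omega>. (norm (P \<omega>))\<^sup>2) / ?a + ?a * (h * ?G $ i $ i) + ?a * (h * ?G $ j $ j))"
        unfolding W_def using P2 YY(3,4) by simp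
      also have "\<dots> \<le> K * h\<^sup>2 + (K * h\<^sup>2 / ?a + ?a * (h * ?G $ i $ i) + ?a * (h * ?G $ j $ j))"
        using P2E a by (intro add_mono divide_right_mono order_refl) auto
      also have "K * h\<^sup>2 / ?a = K * (?a * h)"
        using a by (simp add: power2_eq_square field_simps)
      also have "K * h\<^sup>2 \<le> K * (?a * h)"
      proof -
        have "h * h \<le> ?a * h" using a h mult_left_mono[OF a(3), of ?a] by (intro mult_right_mono) auto
        then show ?thesis using K by (simp add: power2_eq_square mult_left_mono)
      qed
      also have "K * (?a * h) + (K * (?a * h) + ?a * (h * ?G $ i $ i) + ?a * (h * ?G $ j $ j)) = K' * ?a * h"
        by (simp add: K'_def algebra_simps)
      finally show ?thesis by simp
    qed
    ultimately show ?thesis using h by (simp add: field_simps)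
  qed
  have "((\<lambda>h. K' * sqrt h) \<longlongrightarrow> K' * sqrt 0) (at_right 0)"
    by (intro tendsto_intros)
  then have lim: "((\<lambda>h. K' * sqrt h) \<longlongrightarrow> 0) (at_right 0)" by simp
  have "\<forall>\<^sub>F h in at_right (0::real). h \<in> {0<..<1}" by (rule eventually_at_right_real) simp
  then have "\<forall>\<^sub>F h in at_right 0. norm (expectation (\<lambda>\<omega>. (X (t + h) \<omega> $ i - x0 $ i) * (X (t + h) \<omega> $ j - x0 $ j) / h) - ?G $ i $ j) \<le> K' * sqrt h"
    by eventually_elim (rule bound; simp)
  from Lim_null_comparison[OF this lim] show ?thesis by (simp add: LIM_zero_iff)
qed

end

section \<open>Transfer to the transition kernel\<close>

theorem proposition1:
  fixes \<S> :: "(real^'n) set"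
    and \<A> :: "'a measure"
    and \<pi> :: "real^'n \<Rightarrow> 'a measure"
    and \<mu> :: "real^'n \<Rightarrow> 'a \<Rightarrow> real^'n"
    and \<sigma> :: "real^'n \<Rightarrow> 'a \<Rightarrow> real^'m^'n"
    and M :: "real \<Rightarrow> real^'n \<Rightarrow> 'w measure"
    and F :: "real \<Rightarrow> real^'n \<Rightarrow> real \<Rightarrow> 'w measure"
    and B :: "real \<Rightarrow> real^'n \<Rightarrow> real \<Rightarrow> 'w \<Rightarrow> real^'m"
    and A :: "real \<Rightarrow> real^'n \<Rightarrow> real \<Rightarrow> 'w \<Rightarrow> 'a"
    and S :: "real \<Rightarrow> real^'n \<Rightarrow> real \<Rightarrow> 'w \<Rightarrow> real^'n"
    and M' :: "real \<Rightarrow> real^'n \<Rightarrow> 'v measure"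
    and F' :: "real \<Rightarrow> real^'n \<Rightarrow> real \<Rightarrow> 'v measure"
    and B' S' :: "real \<Rightarrow> real^'n \<Rightarrow> real \<Rightarrow> 'v \<Rightarrow> real^'n"
  assumes policy: "stochastic_policy \<S> \<A> \<pi>"
    and controlled: "\<And>t s. t \<ge> 0 \<Longrightarrow> s \<in> \<S> \<Longrightarrow>
      controlled_process \<S> \<A> \<pi> \<mu> \<sigma> (M t s) (F t s) (B t s) (A t s) t s (S t s)"
    and regular: "regular_averaged_coefficients \<S> \<pi> \<mu> \<sigma>"
    and averaged: "\<And>t s. t \<ge> 0 \<Longrightarrow> s \<in> \<S> \<Longrightarrow>
      averaged_process \<S> \<pi> \<mu> \<sigma> (M' t s) (F' t s) (B' t s) t s (S' t s)"
    and same_law: "\<And>t s u. t \<ge> 0 \<Longrightarrow> s \<in> \<S> \<Longrightarrow> u \<ge> t \<Longrightarrow>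
      distr (M t s) borel (S t s u) = distr (M' t s) borel (S' t s u)"
  shows "\<forall>t\<ge>0. \<forall>s\<in>\<S>. \<forall>i j.
    (\<forall>h>0. integrable (transition_kernel M S t s (t + h)) (\<lambda>x. (x $ i - s $ i) / h)) \<and>
    ((\<lambda>h. \<integral>x. (x $ i - s $ i) / h \<partial>transition_kernel M S t s (t + h))
       \<longlongrightarrow> (\<integral>a. \<mu> s a $ i \<partial>\<pi> s)) (at_right 0) \<and>
    (\<forall>h>0. integrable (transition_kernel M S t s (t + h)) (\<lambda>x. (x $ i - s $ i) * (x $ j - s $ j) / h)) \<and>
    ((\<lambda>h. \<integral>x. (x $ i - s $ i) * (x $ j - s $ j) / h \<partial>transition_kernel M S t s (t + h))
       \<longlongrightarrow> (\<integral>a. (\<sigma> s a ** transpose (\<sigma> s a)) $ i $ j \<partial>\<pi> s)) (at_right 0)"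
proof (intro allI impI ballI)
  fix t :: real and s :: "real^'n" and i j :: 'n
  assume t: "t \<ge> 0" and s: "s \<in> \<S>"
  let ?\<beta> = "avg_drift \<pi> \<mu>" and ?\<gamma> = "avg_diffusion \<pi> \<sigma>"
  obtain L1 L2 where L1: "L1-lipschitz_on \<S> ?\<beta>" and L2: "L2-lipschitz_on \<S> ?\<gamma>"
    using regular unfolding regular_averaged_coefficients_def by blast
  have L: "(max L1 L2)-lipschitz_on \<S> ?\<beta>" "(max L1 L2)-lipschitz_on \<S> ?\<gamma>"
    using lipschitz_on_le[OF L1, of "max L1 L2"] lipschitz_on_le[OF L2, of "max L1 L2"] by auto
  have avg: "averaged_process \<S> \<pi> \<mu> \<sigma> (M' t s) (F' t s) (B' t s) t s (S' t s)"
    using t s by (rule averaged)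
  \<comment> \<open>The averaged equation is driven by noise of the dimension of the state, so both
    dimensions of the locale become that of the state space.\<close>
  interpret lipschitz_diffusion "M' t s" "F' t s" "B' t s" \<S> ?\<beta> ?\<gamma> t s "S' t s" "max L1 L2"
    using avg t s L unfolding averaged_process_def ito_process_def by unfold_locales (auto simp: ito_process_def)
  have int_\<mu>: "integrable (\<pi> s) (\<mu> s)" and int_\<sigma>: "integrable (\<pi> s) (\<lambda>a. \<sigma> s a ** transpose (\<sigma> s a))"
    using regular s unfolding regular_averaged_coefficients_def by auto
  have drift: "?\<beta> s $ i = (\<integral>a. \<mu> s a $ i \<partial>\<pi> s)"
    unfolding avg_drift_def by (rule integral_bounded_linear[symmetric, OF bounded_linear_vec_nth int_\<mu>])
  have diffusion: "(?\<gamma> s ** transpose (?\<gamma> s)) $ i $ j = (\<integral>a. (\<sigma> s a ** transpose (\<sigma> s a)) $ i $ j \<partial>\<pi> s)"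
  proof -
    \<comment> \<open>The root is symmetric, so multiplying it by its transpose is squaring
      it.\<close>
    have "?\<gamma> s ** transpose (?\<gamma> s) = (\<integral>a. \<sigma> s a ** transpose (\<sigma> s a) \<partial>\<pi> s)"
      unfolding avg_diffusion_def using psd_sqrt_square[OF psd_integral_mult_transpose[OF int_\<sigma>]] by simp
    then show ?thesis
      using integral_bounded_linear[OF bounded_linear_compose[OF bounded_linear_vec_nth bounded_linear_vec_nth] int_\<sigma>, of i j]
      by simp
  qed
  have law: "transition_kernel M S t s (t + h) = distr (M' t s) borel (S' t s (t + h))" if "0 < h" for h
    unfolding transition_kernel_def using same_law[OF t s] that by simp
  have Xm: "S' t s (t + h) \<in> borel_measurable (M' t s)" if "0 < h" for h
    using that by (intro X_measurable) simp
  have int_law: "integrable (transition_kernel M S t s (t + h)) f \<longleftrightarrow> integrable (M' t s) (\<lambda>\<omega>. f (S' t s (t + h) \<omega>))"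
    and integral_law: "(\<integral>x. f x \<partial>transition_kernel M S t s (t + h)) = expectation (\<lambda>\<omega>. f (S' t s (t + h) \<omega>))"
    if "0 < h" "f \<in> borel_measurable borel" for h and f :: "real^'n \<Rightarrow> real"
    unfolding law[OF that(1)] using Xm[OF that(1)] that(2) by (simp_all add: integrable_distr_eq integral_distr)
  have m1: "(\<lambda>x::real^'n. (x $ i - s $ i) / h) \<in> borel_measurable borel" for h by measurable
  have m2: "(\<lambda>x::real^'n. (x $ i - s $ i) * (x $ j - s $ j) / h) \<in> borel_measurable borel" for h by measurable
  \<comment> \<open>The transfer of integrals along the laws is stated for \<open>h > 0\<close>,
    which is all that \<open>at_right 0\<close> sees.\<close>
  have pos: "\<forall>\<^sub>F h in at_right (0::real). 0 < h" by (rule eventually_at_right_less)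
  show "(\<forall>h>0. integrable (transition_kernel M S t s (t + h)) (\<lambda>x. (x $ i - s $ i) / h)) \<and>
    ((\<lambda>h. \<integral>x. (x $ i - s $ i) / h \<partial>transition_kernel M S t s (t + h))
       \<longlongrightarrow> (\<integral>a. \<mu> s a $ i \<partial>\<pi> s)) (at_right 0) \<and>
    (\<forall>h>0. integrable (transition_kernel M S t s (t + h)) (\<lambda>x. (x $ i - s $ i) * (x $ j - s $ j) / h)) \<and>
    ((\<lambda>h. \<integral>x. (x $ i - s $ i) * (x $ j - s $ j) / h \<partial>transition_kernel M S t s (t + h))
       \<longlongrightarrow> (\<integral>a. (\<sigma> s a ** transpose (\<sigma> s a)) $ i $ j \<partial>\<pi> s)) (at_right 0)"
  proof (intro conjI allI impI)
    fix h :: real assume "0 < h"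
    then show "integrable (transition_kernel M S t s (t + h)) (\<lambda>x. (x $ i - s $ i) / h)"
      and "integrable (transition_kernel M S t s (t + h)) (\<lambda>x. (x $ i - s $ i) * (x $ j - s $ j) / h)"
      using displacement_integrable[of h] by (simp_all add: int_law m1 m2)
  next
    show "((\<lambda>h. \<integral>x. (x $ i - s $ i) / h \<partial>transition_kernel M S t s (t + h))
       \<longlongrightarrow> (\<integral>a. \<mu> s a $ i \<partial>\<pi> s)) (at_right 0)"
      unfolding drift[symmetric]
      by (rule Lim_transform_eventually[OF drift_limit eventually_mono[OF pos integral_law[OF _ m1, symmetric]]])
  next
    show "((\<lambda>h. \<integral>x. (x $ i - s $ i) * (x $ j - s $ j) / h \<partial>transition_kernel M S t s (t + h))
       \<longlongrightarrow> (\<integral>a. (\<sigma> s a ** transpose (\<sigma> s a)) $ i $ j \<partial>\<pi> s)) (at_right 0)"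
      unfolding diffusion[symmetric]
      by (rule Lim_transform_eventually[OF diffusion_limit eventually_mono[OF pos integral_law[OF _ m2, symmetric]]])
  qed
qed

end
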